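(* Let $W_1,W_2,\dots$ be i.i.d. with law $\lambda_0\in\mathcal{P}(\mathcal{W})$, let $\hat x^n_i:\mathcal{W}^n\to\mathcal{X}$ be measurable functions such that $(\hat x^n_1(\vec w),\dots,\hat x^n_n(\vec w))$ is a Nash equilibrium with type vector $\vec w$ for every $\vec w\in\mathcal{W}^n$, and let $\mu_n=\frac1n\sum_{i=1}^n\delta_{(W_i,\hat x^n_i(W_1,\dots,W_n))}$. Assume that $\mathcal{M}(\lambda)$ is a singleton for each $\lambda\in\mathcal{P}(\mathcal{W})$ with $\lambda\ll\lambda_0$. Then for every measurable $A\subset\mathcal{P}(\mathcal{W}\times\mathcal{X})$, $$\limsup_{n\to\infty}\frac1n\log\mathbb{P}(\mu_n\in A)\le-\inf_{m\in\overline{A}\cap\mathcal{M}}H(m^w|\lambda_0),\qquad \liminf_{n\to\infty}\frac1n\log\mathbb{P}(\mu_n\in A)\ge-\inf_{m\in A^\circ\cap\mathcal{M}}H(m^w|\lambda_0).$$ In other words, $\{\mu_n\}$ satisfies a large deviation principle on $\mathcal{P}(\mathcal{W}\times\mathcal{X})$ with good rate function equal to $H(m^w|\lambda_0)$ if $m\in\mathcal{M}$ and $+\infty$ otherwise.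
   Context: Standing assumptions: $\mathcal{X}$ compact metric space, $\mathcal{W}$ complete separable metric space; $\mathcal{P}(S)$ = Borel probability measures on $S$ with the weak topology. $\mathcal{C}$ maps $w\in\mathcal{W}$ to a nonempty closed $\mathcal{C}(w)\subset\mathcal{X}$, continuous in the sense that $\mathrm{Gr}(\mathcal{C})=\{(w,x):x\in\mathcal{C}(w)\}$ is closed and whenever $w_n\to w$, $x\in\mathcal{C}(w)$ there exist $n_k$ and $x_{n_k}\in\mathcal{C}(w_{n_k})$ with $x_{n_k}\to x$. $F:\mathcal{P}(\mathcal{W}\times\mathcal{X})\times\mathcal{W}\times\mathcal{X}\to\mathbb{R}$ is bounded and continuous. A Nash equilibrium with type vector $(w_1,\dots,w_n)$ is $(x_1,\dots,x_n)$ with $x_i\in\mathcal{C}(w_i)$ and $F(\frac1n\sum_k\delta_{(w_k,x_k)},w_i,x_i)=\inf_{y\in\mathcal{C}(w_i)}F(\frac1n\sum_{k\ne i}\delta_{(w_k,x_k)}+\frac1n\delta_{(w_i,y)},w_i,y)$ for all $i$; Nash equilibria are assumed to exist for every $n$ and type vector. $m^w$ is the first marginal of $m$. $\mathcal{M}(\lambda)$ (Cournot-Nash equilibria with type distribution $\lambda$) is the set of $m$ with $m^w=\lambda$ such that for $m$-a.e. $(w,x)$, $x\in\mathcal{C}(w)$ and $F(m,w,x)=\inf_{y\in\mathcal{C}(w)}F(m,w,y)$; $\mathcal{M}=\bigcup_{\lambda\in\mathcal{P}(\mathcal{W})}\mathcal{M}(\lambda)$. $H(\lambda|\lambda_0)=\int\log\frac{d\lambda}{d\lambda_0}d\lambda$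 if $\lambda\ll\lambda_0$ and $+\infty$ otherwise. $A^\circ,\overline A$ are interior and closure; $\inf\emptyset=\infty$. A rate function is good if its sublevel sets are compact. *)

theory Defs
  imports "HOL-Probability.Probability"
begin

definition prob_measures :: "'a::topological_space measure set" where
  "prob_measures = {m. sets m = sets borel \<and> prob_space m}"

definition weak_top :: "'a::topological_space measure topology" where
  "weak_top = topology_generated_by
     {{m \<in> (prob_measures :: 'a measure set). (\<integral>x. f x \<partial>m) \<in> U} | (f :: 'a \<Rightarrow> real) U.
        continuous_on UNIV f \<and> bounded (range f) \<and> open U}"

definition weak_borel_sets :: "'a::topological_space measure set set" where
  "weak_borel_sets = sigma_sets prob_measures {U. openin weak_top U}"

definition emp_measure :: "nat \<Rightarrow> (nat \<Rightarrow> 'a::topological_space) \<Rightarrow> 'a measure" where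
  "emp_measure n z = measure_of UNIV (sets borel)
     (\<lambda>A. ennreal (real (card {k. k < n \<and> z k \<in> A}) / real n))"

definition wmarg :: "('w::topological_space \<times> 'x::topological_space) measure \<Rightarrow> 'w measure" where
  "wmarg m = distr m borel fst"

definition nash_eq ::
  "(('w::topological_space \<times> 'x::topological_space) measure \<Rightarrow> 'w \<Rightarrow> 'x \<Rightarrow> real)
   \<Rightarrow> ('w \<Rightarrow> 'x set) \<Rightarrow> nat \<Rightarrow> (nat \<Rightarrow> 'w) \<Rightarrow> (nat \<Rightarrow> 'x) \<Rightarrow> bool" where
  "nash_eq F C n w x \<longleftrightarrow>
     (\<forall>i<n. x i \<in> C (w i) \<and>
        F (emp_measure n (\<lambda>k. (w k, x k))) (w i) (x i) =
        (INF y\<in>C (w i). F (emp_measure n (\<lambda>k. (w k, (x(i := y)) k))) (w i) y))"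

definition cournot_nash ::
  "(('w::topological_space \<times> 'x::topological_space) measure \<Rightarrow> 'w \<Rightarrow> 'x \<Rightarrow> real)
   \<Rightarrow> ('w \<Rightarrow> 'x set) \<Rightarrow> 'w measure \<Rightarrow> ('w \<times> 'x) measure set" where
  "cournot_nash F C lam = {m \<in> prob_measures. wmarg m = lam \<and>
     (AE z in m. snd z \<in> C (fst z) \<and> F m (fst z) (snd z) = (INF y\<in>C (fst z). F m (fst z) y))}"

definition all_cournot_nash ::
  "(('w::topological_space \<times> 'x::topological_space) measure \<Rightarrow> 'w \<Rightarrow> 'x \<Rightarrow> real)
   \<Rightarrow> ('w \<Rightarrow> 'x set) \<Rightarrow> ('w \<times> 'x) measure set" where
  "all_cournot_nash F C = (\<Union>lam\<in>prob_measures. cournot_nash F C lam)"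

(* relative entropy H(lam | lam0) = \<integral> log (d lam / d lam0) d lam if lam \<ll> lam0, else \<infinity>;
   the integral is split into positive and negative parts (the negative part is always finite) *)
definition rel_entropy :: "'a measure \<Rightarrow> 'a measure \<Rightarrow> ereal" where
  "rel_entropy lam lam0 =
     (if sets lam = sets lam0 \<and> absolutely_continuous lam0 lam then
        enn2ereal (\<integral>\<^sup>+x. ennreal (ln (enn2real (RN_deriv lam0 lam x))) \<partial>lam)
        - enn2ereal (\<integral>\<^sup>+x. ennreal (- ln (enn2real (RN_deriv lam0 lam x))) \<partial>lam)
      else \<infinity>)"

definition eln :: "real \<Rightarrow> ereal" where
  "eln p = (if p = 0 then -\<infinity> else ereal (ln p))"

end

theory Submission
  imports Defs
begin

text \<open>
  Replacing one agent changes an empirical measure by \<open>O(1/n)\<close>, so every \<open>m\<close> that is not a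
  Cournot-Nash equilibrium has a weak neighbourhood that contains no Cournot-Nash equilibrium and, for
  large \<open>n\<close>, no empirical measure of an \<open>n\<close>-player Nash equilibrium.
  Since the action space is compact, exponential tightness of the types confines the empirical measures
  to a compact set. That set is covered by finitely many such neighbourhoods and neighbourhoods
  \<open>{\<integral> f d\<nu>\<^sup>w > c + ln \<integral> exp f d\<lambda>}\<close>, to which Chernoff's bound applies; by the Donsker-Varadhan formula
  this gives the upper bound, and it does so for every type law \<open>\<lambda>\<close>.

  For the lower bound at an equilibrium \<open>m\<close> with marginal \<open>\<lambda>\<close>, draw the types from \<open>\<lambda>\<close> instead. As \<open>m\<close>
  is the only equilibrium with this marginal, the upper bound for \<open>\<lambda>\<close> shows that the empirical measures
  concentrate near \<open>m\<close>, and the entropy inequality transfers this to the original law at the exponential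
  cost \<open>n H(\<lambda>|\<lambda>\<^sub>0)\<close>.
\<close>

subsection \<open>Bounded continuous functions and the weak topology\<close>

text \<open>The weak topology is known here only through its subbasis of integrals; no metric and no
  countable basis for it is at hand. Compactness therefore does not come from sequences but from
  Tychonoff's theorem: the integral functionals of a uniformly tight family form a closed set in a
  product of compact intervals, and every functional in that set is represented by a measure, with
  tightness supplying the continuity that a Riesz representation requires on a noncompact space. For
  the same reason measurability of the empirical measures is derived from a countable basis of the
  underlying product space, not of the space of measures. The variational formula is needed with
  bounded continuous test functions, since only these define weakly open sets. The optimal test
  function is the log-density, which is in general neither continuous nor bounded, so it is first
  truncated and then approximated in mean, simultaneously for both measures. The lower bound rests
  on concentration under the tilted type law. To reach it, the upper bound must yield a rate
  strictly above its threshold, so that threshold 0 still gives exponential decay.\<close>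

definition bcont :: "('a::topological_space \<Rightarrow> real) \<Rightarrow> bool" where
  "bcont f \<longleftrightarrow> continuous_on UNIV f \<and> bounded (range f)"

lemma bcontI: "continuous_on UNIV f \<Longrightarrow> (\<And>x. \<bar>f x\<bar> \<le> B) \<Longrightarrow> bcont f"
  unfolding bcont_def bounded_iff by (metis rangeE real_norm_def)

lemma bcontE:
  assumes "bcont f"
  obtains B where "0 < B" "\<And>x. \<bar>f x\<bar> \<le> B"
  using assms unfolding bcont_def bounded_pos by (metis rangeI real_norm_def)

lemma bcont_continuous: "bcont f \<Longrightarrow> continuous_on UNIV f"
  by (simp add: bcont_def)

lemma bcont_measurable: "bcont f \<Longrightarrow> f \<in> borel_measurable borel"
  by (simp add: bcont_def borel_measurable_continuous_onI)

lemma bcont_const: "bcont (\<lambda>x. c)"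
  by (rule bcontI[where B = "\<bar>c\<bar>"]) auto

lemma bcont_add: "bcont f \<Longrightarrow> bcont g \<Longrightarrow> bcont (\<lambda>x. f x + g x)"
  unfolding bcont_def by (auto intro: continuous_intros bounded_plus_comp)

lemma bcont_diff: "bcont f \<Longrightarrow> bcont g \<Longrightarrow> bcont (\<lambda>x. f x - g x)"
  unfolding bcont_def by (auto intro: continuous_intros bounded_minus_comp)

lemma bcont_mult:
  assumes "bcont f" "bcont g" shows "bcont (\<lambda>x. f x * g x)"
proof -
  obtain B where "0 < B" "\<And>x. \<bar>f x\<bar> \<le> B" using bcontE[OF assms(1)] by blast
  moreover obtain D where "0 < D" "\<And>x. \<bar>g x\<bar> \<le> D" using bcontE[OF assms(2)] by blast
  ultimately show ?thesis
    using assms by (intro bcontI[where B = "B * D"])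
      (auto simp: abs_mult bcont_def intro!: continuous_intros mult_mono)
qed

lemma bcont_min: "bcont f \<Longrightarrow> bcont g \<Longrightarrow> bcont (\<lambda>x. min (f x) (g x))"
proof -
  assume a: "bcont f" "bcont g"
  obtain B where "0 < B" "\<And>x. \<bar>f x\<bar> \<le> B" using bcontE[OF a(1)] by blast
  note B = this
  obtain D where "0 < D" "\<And>x. \<bar>g x\<bar> \<le> D" using bcontE[OF a(2)] by blast
  note D = this
  show ?thesis
  proof (intro bcontI[where B = "B + D"] continuous_on_min)
    show "\<bar>min (f x) (g x)\<bar> \<le> B + D" for x
      using B(2)[of x] D(2)[of x] by linarith
  qed (use a in \<open>auto simp: bcont_def\<close>)
qed

lemma bcont_max: "bcont f \<Longrightarrow> bcont g \<Longrightarrow> bcont (\<lambda>x. max (f x) (g x))"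
proof -
  assume a: "bcont f" "bcont g"
  have "bcont (\<lambda>x. 0 - min (0 - f x) (0 - g x))"
    by (intro bcont_diff bcont_min bcont_const a)
  then show ?thesis by (simp add: minus_min_eq_max)
qed

lemma bcont_sum: "(\<And>i. i \<in> I \<Longrightarrow> bcont (f i)) \<Longrightarrow> bcont (\<lambda>x. \<Sum>i\<in>I. f i x)"
  by (induction I rule: infinite_finite_induct) (auto intro: bcont_const bcont_add)

lemma bcont_compose: "bcont f \<Longrightarrow> continuous_on UNIV g \<Longrightarrow> bcont (\<lambda>x. f (g x))"
  unfolding bcont_def
  by (auto intro: continuous_on_compose2[of UNIV f] bounded_subset[of "range f"])

section \<open>Borel probability measures, weak neighbourhoods and determining functions\<close>

lemma prob_measuresD:
  assumes "m \<in> prob_measures"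
  shows "sets m = sets borel" "prob_space m" "space m = UNIV"
  using assms sets_eq_imp_space_eq[of m borel] by (auto simp: prob_measures_def)

lemma integrable_bounded_measurable:
  fixes f :: "_ \<Rightarrow> real"
  assumes "m \<in> prob_measures" "f \<in> borel_measurable borel" "\<And>x. \<bar>f x\<bar> \<le> B"
  shows "integrable m f"
proof -
  interpret prob_space m by (rule prob_measuresD[OF assms(1)])
  show ?thesis
    by (rule integrable_const_bound[where B = B])
      (use assms prob_measuresD[OF assms(1)] in \<open>auto cong: measurable_cong_sets\<close>)
qed

lemma measurable_prob_measures:
  assumes "m \<in> prob_measures" "f \<in> borel_measurable borel" shows "f \<in> borel_measurable m"
  using assms(2) prob_measuresD(1)[OF assms(1)] by (simp cong: measurable_cong_sets)

lemma
  fixes f :: "_ \<Rightarrow> real"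
  assumes m: "m \<in> prob_measures" and f: "f \<in> borel_measurable borel" "\<And>x. \<bar>f x\<bar> \<le> B"
  shows integrable_exp_bounded: "integrable m (\<lambda>x. exp (f x))"
    and integral_exp_pos: "0 < (\<integral>x. exp (f x) \<partial>m)"
proof -
  interpret prob_space m by (rule prob_measuresD[OF m])
  show ie: "integrable m (\<lambda>x. exp (f x))"
    by (rule integrable_bounded_measurable[OF m, where B = "exp B"]) (use f in \<open>auto simp: abs_le_iff\<close>)
  have "exp (- B) = (\<integral>x. exp (- B) \<partial>m)" by (simp add: prob_space)
  also have "\<dots> \<le> (\<integral>x. exp (f x) \<partial>m)"
    by (rule integral_mono[OF _ ie]) (use f in \<open>auto simp: abs_le_iff minus_le_iff\<close>)
  finally show "0 < (\<integral>x. exp (f x) \<partial>m)" using exp_gt_zero less_le_trans by blast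
qed

lemma bcont_integrable: "m \<in> prob_measures \<Longrightarrow> bcont f \<Longrightarrow> integrable m f"
  by (metis bcontE bcont_measurable integrable_bounded_measurable)

lemma weak_top_subbasis:
  assumes "bcont f" "open U"
  shows "openin weak_top {m \<in> prob_measures. (\<integral>x. f x \<partial>m) \<in> U}"
  unfolding weak_top_def
  by (rule topology_generated_by_Basis) (use assms in \<open>auto simp: bcont_def\<close>)

lemma topspace_weak_top: "topspace weak_top = (prob_measures :: 'a::topological_space measure set)"
proof
  show "topspace weak_top \<subseteq> (prob_measures :: 'a measure set)"
    unfolding weak_top_def by auto
  \<comment> \<open>A constant function and the whole line give a subbasic set that exhausts
    \<open>prob_measures\<close>.\<close>
  have "openin weak_top {m \<in> prob_measures. (\<integral>x. 0 \<partial>m) \<in> (UNIV :: real set)}"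
    by (rule weak_top_subbasis) (auto intro: bcont_const)
  then show "(prob_measures :: 'a measure set) \<subseteq> topspace weak_top"
    by (auto dest: openin_subset)
qed

text \<open>Induction over the generation of the topology. Containing a ball around \<open>m\<close>
  cut out by finitely many test functions survives unions trivially, and intersections by uniting
  the test functions and shrinking the radius. The balls have real radii, which later estimates for
  empirical measures can be measured against.\<close>

lemma weak_top_nhd:
  fixes m :: "'a::topological_space measure"
  assumes "openin weak_top U" "m \<in> U"
  obtains S d where "finite S" "0 < d" "\<And>f. f \<in> S \<Longrightarrow> bcont f"
    "{k \<in> prob_measures. \<forall>f\<in>S. \<bar>(\<integral>x. f x \<partial>k) - (\<integral>x. f x \<partial>m)\<bar> < d} \<subseteq> U"
proof -
  let ?G = "{{m \<in> (prob_measures :: 'a measure set). (\<integral>x. f x \<partial>m) \<in> U} | (f :: 'a \<Rightarrow> real) U.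
        continuous_on UNIV f \<and> bounded (range f) \<and> open U}"
  define N where "N U \<longleftrightarrow> (\<exists>S d. finite S \<and> 0 < d \<and> (\<forall>f\<in>S. bcont f) \<and>
    {k \<in> prob_measures. \<forall>f\<in>S. \<bar>(\<integral>x. f x \<partial>k) - (\<integral>x. f x \<partial>m)\<bar> < d} \<subseteq> U)" for U
  have "generate_topology_on ?G U"
    using assms(1) unfolding weak_top_def by (rule openin_topology_generated_by)
  then have "m \<in> U \<longrightarrow> N U"
  proof (induction rule: generate_topology_on.induct)
    case Empty
    then show ?case by simp
  next
    case (Int A B)
    show ?case
    proof
      assume m: "m \<in> A \<inter> B"
      obtain S d where 1: "finite S" "0 < d" "\<forall>f\<in>S. bcont f"
        "{k \<in> prob_measures. \<forall>f\<in>S. \<bar>(\<integral>x. f x \<partial>k) - (\<integral>x. f x \<partial>m)\<bar> < d} \<subseteq> A"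
        using Int m unfolding N_def by auto
      obtain S' d' where 2: "finite S'" "0 < d'" "\<forall>f\<in>S'. bcont f"
        "{k \<in> prob_measures. \<forall>f\<in>S'. \<bar>(\<integral>x. f x \<partial>k) - (\<integral>x. f x \<partial>m)\<bar> < d'} \<subseteq> B"
        using Int m unfolding N_def by auto
      show "N (A \<inter> B)"
        unfolding N_def
        by (rule exI[of _ "S \<union> S'"], rule exI[of _ "min d d'"]) (use 1 2 in auto)
    qed
  next
    case (UN K)
    show ?case
    proof
      assume "m \<in> \<Union>K"
      then obtain k where "k \<in> K" "m \<in> k" by auto
      then have "N k" using UN by blast
      with \<open>k \<in> K\<close> show "N (\<Union>K)" unfolding N_def by (meson Union_upper subset_trans)
    qed
  next
    case (Basis s)
    show ?case
    proof
      assume m: "m \<in> s"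
      obtain f :: "'a \<Rightarrow> real" and V where s: "s = {m \<in> prob_measures. (\<integral>x. f x \<partial>m) \<in> V}"
        "bcont f" "open V"
        using Basis unfolding bcont_def by auto
      then obtain d where d: "0 < d" "ball (\<integral>x. f x \<partial>m) d \<subseteq> V"
        using m by (auto simp: open_contains_ball)
      have "k \<in> s" if "k \<in> prob_measures" "\<bar>(\<integral>x. f x \<partial>k) - (\<integral>x. f x \<partial>m)\<bar> < d" for k
        using that d(2) by (simp add: s(1) subset_iff dist_real_def abs_minus_commute)
      then have "{k \<in> prob_measures. \<forall>f\<in>{f}. \<bar>(\<integral>x. f x \<partial>k) - (\<integral>x. f x \<partial>m)\<bar> < d} \<subseteq> s"
        by blast
      then show "N s"
        unfolding N_def using s(2) d(1) by (intro exI[of _ "{f}"] exI[of _ d]) simp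
    qed
  qed
  then have "N U" using assms(2) by blast
  then show thesis unfolding N_def using that by blast
qed

text \<open>The distance to the complement, capped at 1. The case \<open>U = UNIV\<close> is
  separate because \<open>infdist\<close> to the empty set is 0 by convention.\<close>

lemma open_bump:
  fixes U :: "'a::metric_space set"
  assumes "open U"
  obtains f :: "'a \<Rightarrow> real" where "bcont f" "\<And>x. 0 \<le> f x" "\<And>x. f x \<le> 1" "U = {x. 0 < f x}"
proof (cases "U = UNIV")
  case True
  then show thesis using that[of "\<lambda>x. 1"] by (auto simp: bcont_const)
next
  case False
  define f where "f x = min 1 (infdist x (- U))" for x
  show thesis
  proof (rule that)
    show "bcont f"
      unfolding f_def by (rule bcontI[where B = 1]) (auto simp: infdist_nonneg intro!: continuous_intros)
    show "0 \<le> f x" "f x \<le> 1" for x by (simp_all add: f_def infdist_nonneg)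
    show "U = {x. 0 < f x}"
    proof (intro set_eqI iffI)
      show "x \<in> {x. 0 < f x}" if "x \<in> U" for x
        using \<open>open U\<close> that False infdist_pos_not_in_closed[of "- U" x] by (auto simp: f_def closed_Compl)
      show "x \<in> U" if "x \<in> {x. 0 < f x}" for x
        using that infdist_zero[of x "- U"] by (cases "x \<in> U") (auto simp: f_def)
    qed
  qed
qed

text \<open>Continuous functions that decrease to the indicator of a closed set \<open>C\<close> as
  \<open>k\<close> grows. For empty \<open>C\<close> the convention for \<open>infdist\<close> makes
  them constantly 1, which is why nonemptiness appears below.\<close>

definition sep_fun :: "'a::metric_space set \<Rightarrow> nat \<Rightarrow> 'a \<Rightarrow> real" where
  "sep_fun C k x = max 0 (1 - real k * infdist x C)"

lemma bcont_sep_fun: "bcont (sep_fun C k)"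
  unfolding sep_fun_def
  by (rule bcontI[where B = 1]) (auto simp: infdist_nonneg intro!: continuous_intros)

lemma sep_fun_range: "0 \<le> sep_fun C k x" "sep_fun C k x \<le> 1"
  by (auto simp: sep_fun_def infdist_nonneg)

lemma sep_fun_eq_1: "x \<in> C \<Longrightarrow> sep_fun C k x = 1"
  by (simp add: sep_fun_def)

lemma sep_fun_tendsto:
  assumes "closed C" "C \<noteq> {}"
  shows "(\<lambda>k. sep_fun C k x) \<longlonglongrightarrow> indicator C x"
proof (cases "x \<in> C")
  case True
  then show ?thesis by (simp add: sep_fun_eq_1)
next
  case False
  then have pos: "0 < infdist x C"
    using assms infdist_pos_not_in_closed by blast
  obtain n where n: "1 / infdist x C < real n" using reals_Archimedean2 by blast
  have "sep_fun C k x = 0" if "n \<le> k" for k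
  proof -
    have "1 / infdist x C < real k" using n that by linarith
    then have "1 < real k * infdist x C" using pos by (simp add: field_simps)
    then show ?thesis by (simp add: sep_fun_def)
  qed
  then have "eventually (\<lambda>k. sep_fun C k x = 0) sequentially"
    by (auto simp: eventually_sequentially)
  then show ?thesis using False by (simp add: tendsto_eventually)
qed

lemma sep_fun_integral_tendsto:
  assumes "m \<in> prob_measures" "closed C" "C \<noteq> {}"
  shows "(\<lambda>k. \<integral>x. sep_fun C k x \<partial>m) \<longlonglongrightarrow> measure m C"
proof -
  interpret prob_space m by (rule prob_measuresD[OF assms(1)])
  have C: "C \<in> sets m" using assms prob_measuresD by (metis borel_closed)
  have "(\<lambda>k. \<integral>x. sep_fun C k x \<partial>m) \<longlonglongrightarrow> (\<integral>x. indicator C x \<partial>m)"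
  proof (rule integral_dominated_convergence[where w = "\<lambda>_. 1"])
    show "\<And>k. sep_fun C k \<in> borel_measurable m"
      using assms(1) bcont_integrable bcont_sep_fun by blast
  qed (use C sep_fun_tendsto[OF assms(2,3)] in \<open>auto simp: sep_fun_range\<close>)
  then show ?thesis using C by simp
qed

text \<open>The functions \<open>sep_fun\<close> recover the measure of closed sets, and these form
  an intersection-stable generator of the Borel sets.\<close>

lemma prob_measures_eqI:
  fixes m k :: "'a::metric_space measure"
  assumes "m \<in> prob_measures" "k \<in> prob_measures"
    and "\<And>f. bcont f \<Longrightarrow> (\<integral>x. f x \<partial>m) = (\<integral>x. f x \<partial>k)"
  shows "m = k"
proof -
  interpret m: prob_space m by (rule prob_measuresD[OF assms(1)])
  interpret k: prob_space k by (rule prob_measuresD[OF assms(2)])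
  have closed_eq: "emeasure m C = emeasure k C" if "closed C" for C
  proof (cases "C = {}")
    case False
    have "(\<lambda>i. \<integral>x. sep_fun C i x \<partial>m) \<longlonglongrightarrow> measure k C"
      unfolding assms(3)[OF bcont_sep_fun] by (rule sep_fun_integral_tendsto[OF assms(2) that False])
    from LIMSEQ_unique[OF this sep_fun_integral_tendsto[OF assms(1) that False]]
    show ?thesis by (simp add: m.emeasure_eq_measure k.emeasure_eq_measure)
  qed simp
  show ?thesis
  proof (rule measure_eqI_generator_eq[where \<Omega> = UNIV and E = "{C. closed C}" and A = "\<lambda>_. UNIV"])
    show "Int_stable {C::'a set. closed C}" by (auto simp: Int_stable_def)
    show "sets m = sigma_sets UNIV {C. closed C}" "sets k = sigma_sets UNIV {C. closed C}"
      by (simp_all add: prob_measuresD(1)[OF assms(1)] prob_measuresD(1)[OF assms(2)] borel_eq_closed)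
    show "\<And>X. X \<in> {C. closed C} \<Longrightarrow> emeasure m X = emeasure k X"
      using closed_eq by blast
  qed auto
qed

subsection \<open>Riesz representation of tight functionals\<close>

text \<open>For fixed \<open>K\<close> and \<open>e\<close>, each axiom on \<open>L\<close> is an
  equation or a non-strict inequality between finitely many values of \<open>L\<close>. Hence the
  axioms survive pointwise limits, which is what Tychonoff's theorem needs. Values of
  \<open>L\<close> outside the bounded continuous functions are left open.\<close>

locale tight_functional =
  fixes L :: "('a::metric_space \<Rightarrow> real) \<Rightarrow> real" and K :: "nat \<Rightarrow> 'a set" and e :: "nat \<Rightarrow> real"
  assumes L_add: "bcont f \<Longrightarrow> bcont g \<Longrightarrow> L (\<lambda>x. f x + g x) = L f + L g"
    and L_scale: "bcont f \<Longrightarrow> L (\<lambda>x. c * f x) = c * L f"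
    and L_nonneg: "bcont f \<Longrightarrow> (\<And>x. 0 \<le> f x) \<Longrightarrow> 0 \<le> L f"
    and L_one: "L (\<lambda>x. 1) = 1"
    and K_compact: "compact (K j)"
    and e_tendsto: "e \<longlonglongrightarrow> 0"
    and L_tight: "bcont f \<Longrightarrow> (\<And>x. 0 \<le> f x) \<Longrightarrow> (\<And>x. f x \<le> 1) \<Longrightarrow>
      (\<And>x. x \<in> K j \<Longrightarrow> f x = 0) \<Longrightarrow> L f \<le> e j"
begin

lemma L_zero: "L (\<lambda>x. 0) = 0"
  using L_scale[of "\<lambda>x. 0" 0] bcont_const[of 0] by simp

lemma L_diff:
  assumes "bcont f" "bcont g" shows "L (\<lambda>x. f x - g x) = L f - L g"
  using L_add[OF bcont_diff[OF assms] assms(2)] by simp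

lemma L_mono:
  assumes "bcont f" "bcont g" "\<And>x. f x \<le> g x" shows "L f \<le> L g"
  using L_nonneg[OF bcont_diff[OF assms(2,1)]] assms by (simp add: L_diff)

lemma L_sum: "(\<And>i. i \<in> I \<Longrightarrow> bcont (f i)) \<Longrightarrow> L (\<lambda>x. \<Sum>i\<in>I. f i x) = (\<Sum>i\<in>I. L (f i))"
  by (induction I rule: infinite_finite_induct) (auto simp: L_zero L_add bcont_sum)

text \<open>Covering by series of functions instead of series of sets makes the outer measure countably
  subadditive without any continuity of \<open>L\<close>; tightness enters only through the total mass.\<close>

definition covers :: "'a set \<Rightarrow> (nat \<Rightarrow> 'a \<Rightarrow> real) \<Rightarrow> bool" where
  "covers A f \<longleftrightarrow> (\<forall>n. bcont (f n)) \<and> (\<forall>n x. 0 \<le> f n x) \<and> (\<forall>x\<in>A. 1 \<le> (\<Sum>n. ennreal (f n x)))"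

definition omeas :: "'a set \<Rightarrow> ennreal" where
  "omeas A = (INF f \<in> Collect (covers A). \<Sum>n. ennreal (L (f n)))"

lemma omeas_le: "covers A f \<Longrightarrow> omeas A \<le> (\<Sum>n. ennreal (L (f n)))"
  unfolding omeas_def by (rule INF_lower) simp

text \<open>A doubly indexed cover is flattened by the pairing bijection. This serves both to unite
  countably many covers and to cut each function of one cover into countably many pieces.\<close>

lemma omeas_le_double:
  assumes "\<And>k n. bcont (u k n)" "\<And>k n x. 0 \<le> u k n x"
    and "\<And>x. x \<in> A \<Longrightarrow> 1 \<le> (\<Sum>k. \<Sum>n. ennreal (u k n x))"
  shows "omeas A \<le> (\<Sum>k. \<Sum>n. ennreal (L (u k n)))"
proof -
  define f where "f i = u (fst (prod_decode i)) (snd (prod_decode i))" for i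
  have s: "(\<Sum>i. ennreal (f i x)) = (\<Sum>k. \<Sum>n. ennreal (u k n x))" for x
    unfolding f_def
    using suminf_ennreal_2dimen[of "\<lambda>k. \<Sum>n. ennreal (u k n x)" "\<lambda>p. ennreal (u (fst p) (snd p) x)"]
    by simp
  have "covers A f"
    unfolding covers_def using assms(3) by (simp add: s) (simp add: f_def assms(1,2))
  then have "omeas A \<le> (\<Sum>i. ennreal (L (f i)))" by (rule omeas_le)
  also have "\<dots> = (\<Sum>k. \<Sum>n. ennreal (L (u k n)))"
    unfolding f_def
    using suminf_ennreal_2dimen[of "\<lambda>k. \<Sum>n. ennreal (L (u k n))" "\<lambda>p. ennreal (L (u (fst p) (snd p)))"]
    by simp
  finally show ?thesis .
qed

lemma suminf_first: "(\<Sum>n. ennreal (if n = (0::nat) then c else 0)) = ennreal c"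
  using suminf_finite[of "{0::nat}" "\<lambda>n. ennreal (if n = 0 then c else 0)"] by simp

text \<open>A single function becomes a cover when padded with zero functions.\<close>

lemma omeas_le_L:
  assumes "bcont f" "\<And>x. 0 \<le> f x" "\<And>x. x \<in> A \<Longrightarrow> 1 \<le> f x"
  shows "omeas A \<le> ennreal (L f)"
proof -
  define g where "g n x = (if n = 0 then f x else 0)" for n :: nat and x
  have "g 0 = f" "\<And>n. n \<noteq> 0 \<Longrightarrow> g n = (\<lambda>x. 0)" by (auto simp: g_def)
  then have Lg: "L (g n) = (if n = 0 then L f else 0)" and gb: "bcont (g n)" for n
    using assms(1) bcont_const[of 0] by (cases "n = 0"; simp add: L_zero)+
  have "covers A g"
    unfolding covers_def using assms gb by (auto simp: g_def suminf_first)
  from omeas_le[OF this] show ?thesis by (simp add: Lg suminf_first)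
qed

lemma omeas_finite: "omeas A < \<infinity>"
proof -
  have "omeas A \<le> ennreal (L (\<lambda>x. 1))" by (rule omeas_le_L) (auto simp: bcont_const)
  then show ?thesis by (simp add: L_one) (metis ennreal_one_less_top order.strict_trans1)
qed

lemma outer_measure_space_omeas: "outer_measure_space UNIV omeas"
  unfolding outer_measure_space_def
proof (intro conjI)
  have "omeas {} \<le> ennreal (L (\<lambda>x. 0))" by (rule omeas_le_L) (auto simp: bcont_const)
  then show "positive UNIV omeas" by (simp add: L_zero positive_def)
  have "omeas A \<le> omeas B" if "A \<subseteq> B" for A B
  proof -
    have "Collect (covers B) \<subseteq> Collect (covers A)" using that unfolding covers_def by blast
    then show ?thesis unfolding omeas_def by (rule INF_superset_mono) simp
  qed
  then show "increasing UNIV omeas" by (simp add: increasing_def)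
  show "countably_subadditive UNIV omeas"
    unfolding countably_subadditive_def
  proof (intro allI impI)
    fix A :: "nat \<Rightarrow> 'a set"
    show "omeas (\<Union>i. A i) \<le> (\<Sum>i. omeas (A i))"
    proof (rule ennreal_le_epsilon)
      fix d :: real assume d: "0 < d"
      have "\<exists>f. covers (A k) f \<and> (\<Sum>n. ennreal (L (f n))) < omeas (A k) + ennreal (d * (1/2) ^ Suc k)" for k
      proof -
        \<comment> \<open>Strictness rests on \<open>omeas_finite\<close>: every set is covered by
          the constant 1, whose value under \<open>L\<close> is 1.\<close>
        have "omeas (A k) < omeas (A k) + ennreal (d * (1/2) ^ Suc k)"
          using omeas_finite[of "A k"] d
          by (cases "omeas (A k)") (auto simp: ennreal_less_iff simp flip: ennreal_plus)
        then show ?thesis unfolding omeas_def[of "A k"] by (subst (asm) INF_less_iff) auto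
      qed
      then obtain f where f: "\<And>k. covers (A k) (f k)"
        "\<And>k. (\<Sum>n. ennreal (L (f k n))) < omeas (A k) + ennreal (d * (1/2) ^ Suc k)"
        by metis
      have "omeas (\<Union>i. A i) \<le> (\<Sum>k. \<Sum>n. ennreal (L (f k n)))"
      proof (rule omeas_le_double)
        fix x assume "x \<in> (\<Union>i. A i)"
        then obtain k where "x \<in> A k" by auto
        then have "1 \<le> (\<Sum>n. ennreal (f k n x))" using f(1) by (auto simp: covers_def)
        also have "\<dots> = (\<Sum>k\<in>{k}. \<Sum>n. ennreal (f k n x))" by simp
        also have "\<dots> \<le> (\<Sum>k. \<Sum>n. ennreal (f k n x))"
          by (rule sum_le_suminf) auto
        finally show "1 \<le> (\<Sum>k. \<Sum>n. ennreal (f k n x))" .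
      qed (use f(1) in \<open>auto simp: covers_def\<close>)
      also have "\<dots> \<le> (\<Sum>k. omeas (A k) + ennreal (d * (1/2) ^ Suc k))"
        using f(2) by (intro suminf_le) (auto intro: less_imp_le)
      also have "\<dots> = (\<Sum>k. omeas (A k)) + (\<Sum>k. ennreal (d * (1/2) ^ Suc k))"
        by (rule suminf_add[symmetric]) auto
      also have "(\<Sum>k. ennreal (d * (1/2) ^ Suc k)) = ennreal d"
        using d sums_mult[OF power_half_series, of d] by (intro suminf_ennreal_eq) auto
      finally show "omeas (\<Union>i. A i) \<le> (\<Sum>i. omeas (A i)) + ennreal d" .
    qed
  qed
qed

text \<open>Caratheodory's condition for an open set. The functions
  \<open>h k = min 1 (k * g)\<close> increase to the indicator of \<open>{x. 0 < g x}\<close> and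
  vanish off that set. Every cover \<open>f\<close> of \<open>A\<close> splits into
  \<open>f n * h N\<close> and \<open>f n * (1 - h N)\<close>. The second part covers the portion of
  \<open>A\<close> outside the open set; the increments of the first part in \<open>N\<close> cover
  the portion inside. Masses add up by additivity of \<open>L\<close> alone, as no limit is ever
  taken inside \<open>L\<close>.\<close>

lemma omeas_open_split:
  assumes g: "bcont g" "\<And>x. 0 \<le> g x"
  shows "omeas (A \<inter> {x. 0 < g x}) + omeas (A - {x. 0 < g x}) \<le> omeas A"
proof -
  define h where "h k x = min 1 (real k * g x)" for k :: nat and x
  have h: "bcont (h k)" "0 \<le> h k x" "h k x \<le> 1" "h k x \<le> h (Suc k) x" for k x
    using g mult_right_mono[of "real k" "real (Suc k)" "g x"] unfolding h_def
    by (auto intro!: bcont_min bcont_mult bcont_const min.mono simp del: of_nat_Suc)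
  have h0: "h 0 = (\<lambda>x. 0)" by (auto simp: h_def)
  have lim: "(\<lambda>k. h (Suc k) x - h k x) sums 1" if "0 < g x" for x
  proof -
    obtain N where N: "1 / g x < real N" using reals_Archimedean2 by blast
    have "h k x = 1" if "N \<le> k" for k
    proof -
      have "1 / g x < real k" using N that by linarith
      then have "1 < real k * g x" using \<open>0 < g x\<close> by (simp add: field_simps)
      then show ?thesis by (simp add: h_def)
    qed
    then have "(\<lambda>k. h k x) \<longlonglongrightarrow> 1"
      by (intro tendsto_eventually) (auto simp: eventually_sequentially)
    from telescope_sums[OF this] show ?thesis by (simp add: h0)
  qed
  have "omeas (A \<inter> {x. 0 < g x}) + omeas (A - {x. 0 < g x}) \<le> (\<Sum>n. ennreal (L (f n)))"
    if "covers A f" for f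
  proof -
    have f: "bcont (f n)" "0 \<le> f n x" for n x using that by (auto simp: covers_def)
    define u where "u k n x = f n x * (h (Suc k) x - h k x)" for k n x
    define v where "v k n x = f n x * (1 - h k x)" for k n x
    define w where "w k n x = f n x * h k x" for k n x
    have u: "bcont (u k n)" "0 \<le> u k n x" for k n x
      unfolding u_def using f h by (auto intro!: bcont_mult bcont_diff)
    have v: "bcont (v k n)" "0 \<le> v k n x" for k n x
      unfolding v_def using f h by (auto intro!: bcont_mult bcont_diff bcont_const)
    have w: "bcont (w k n)" "0 \<le> w k n x" for k n x
      unfolding w_def using f h by (auto intro!: bcont_mult bcont_diff bcont_const)
    have wv: "ennreal (L (w k n)) + ennreal (L (v k n)) = ennreal (L (f n))" for k n
    proof -
      have "L (\<lambda>x. w k n x + v k n x) = L (w k n) + L (v k n)" using w(1) v(1) by (rule L_add)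
      moreover have "(\<lambda>x. w k n x + v k n x) = f n" by (auto simp: w_def v_def algebra_simps)
      ultimately show ?thesis using w v by (simp add: L_nonneg flip: ennreal_plus)
    qed
    \<comment> \<open>The increments telescope before \<open>L\<close> is applied, so
      \<open>L\<close> meets only finite sums.\<close>
    have sum_u: "(\<Sum>k<N. ennreal (L (u k n))) = ennreal (L (w N n))" for N n
    proof -
      have "(\<Sum>k<N. u k n x) = w N n x" for x
        unfolding u_def w_def sum_distrib_left[symmetric]
        using sum_lessThan_telescope[of "\<lambda>k. h k x" N] by (simp add: h0)
      then have "w N n = (\<lambda>x. \<Sum>k<N. u k n x)" by auto
      then show ?thesis using u by (simp add: L_sum L_nonneg sum_ennreal)
    qed
    have "omeas (A \<inter> {x. 0 < g x}) \<le> (\<Sum>k. \<Sum>n. ennreal (L (u k n)))"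
    proof (rule omeas_le_double[OF u])
      fix x assume x: "x \<in> A \<inter> {x. 0 < g x}"
      have "(\<Sum>k. \<Sum>n. ennreal (u k n x)) = (\<Sum>k. \<Sum>n. ennreal (f n x) * ennreal (h (Suc k) x - h k x))"
        unfolding u_def using f h by (simp add: ennreal_mult)
      also have "\<dots> = (\<Sum>n. ennreal (f n x)) * (\<Sum>k. ennreal (h (Suc k) x - h k x))" by simp
      also have "(\<Sum>k. ennreal (h (Suc k) x - h k x)) = 1"
      proof -
        have "(\<Sum>k. ennreal (h (Suc k) x - h k x)) = ennreal 1"
          by (rule suminf_ennreal_eq) (use h(4) lim x in auto)
        then show ?thesis by simp
      qed
      finally show "1 \<le> (\<Sum>k. \<Sum>n. ennreal (u k n x))" using that x by (simp add: covers_def)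
    qed
    \<comment> \<open>Writing the outer series as a supremum over \<open>N\<close> allows each
      partial sum to be paired with the remainder cover \<open>v N\<close> of the same
      index.\<close>
    also have "\<dots> = (SUP N. \<Sum>k<N. \<Sum>n. ennreal (L (u k n)))" by (rule suminf_eq_SUP)
    also have "\<dots> = (SUP N. \<Sum>n. ennreal (L (w N n)))"
      by (subst suminf_sum[symmetric]) (auto simp: sum_u)
    finally have "omeas (A \<inter> {x. 0 < g x}) + omeas (A - {x. 0 < g x})
      \<le> (SUP N. \<Sum>n. ennreal (L (w N n))) + omeas (A - {x. 0 < g x})"
      by (rule add_right_mono)
    also have "\<dots> = (SUP N. (\<Sum>n. ennreal (L (w N n))) + omeas (A - {x. 0 < g x}))"
      by (rule ennreal_SUP_add_left[symmetric]) simp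
    also have "\<dots> \<le> (\<Sum>n. ennreal (L (f n)))"
    proof (rule SUP_least)
      fix N
      have "v N n x = f n x" if "x \<in> A - {x. 0 < g x}" for n x
      proof -
        have "g x = 0" using that g(2)[of x] by auto
        then show ?thesis by (simp add: v_def h_def)
      qed
      then have "covers (A - {x. 0 < g x}) (v N)"
        using that v unfolding covers_def by simp
      then have "omeas (A - {x. 0 < g x}) \<le> (\<Sum>n. ennreal (L (v N n)))" by (rule omeas_le)
      then have "(\<Sum>n. ennreal (L (w N n))) + omeas (A - {x. 0 < g x})
        \<le> (\<Sum>n. ennreal (L (w N n))) + (\<Sum>n. ennreal (L (v N n)))" by (rule add_left_mono)
      also have "\<dots> = (\<Sum>n. ennreal (L (f n)))" by (subst suminf_add) (auto simp: wv)
      finally show "(\<Sum>n. ennreal (L (w N n))) + omeas (A - {x. 0 < g x}) \<le> (\<Sum>n. ennreal (L (f n)))" .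
    qed
    finally show ?thesis .
  qed
  then show ?thesis unfolding omeas_def[of A] by (intro INF_greatest) simp
qed

lemma borel_subset_lambda_system: "sets borel \<subseteq> lambda_system UNIV UNIV omeas"
proof -
  have ms: "measure_space UNIV (lambda_system UNIV UNIV omeas) omeas"
    using sigma_algebra.caratheodory_lemma[OF sigma_algebra_Pow, of UNIV omeas] outer_measure_space_omeas
    by simp
  then interpret L: sigma_algebra UNIV "lambda_system UNIV UNIV omeas"
    by (simp add: measure_space_def)
  have "U \<in> lambda_system UNIV UNIV omeas" if "open U" for U
  proof -
    obtain g where g: "bcont g" "\<And>x. 0 \<le> g x" "U = {x. 0 < g x}"
      using open_bump[OF \<open>open U\<close>] by blast
    have split: "omeas (A \<inter> U) + omeas (A - U) \<le> omeas A" for A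
      unfolding g(3) by (rule omeas_open_split[OF g(1,2)])
    \<comment> \<open>Countable subadditivity speaks of disjoint sequences, so the two pieces are
      padded with empty sets.\<close>
    have "omeas A \<le> omeas (A \<inter> U) + omeas (A - U)" for A
    proof -
      define B where "B i = (if i = 0 then A \<inter> U else if i = Suc 0 then A - U else {})" for i
      have "disjoint_family B" by (auto simp: disjoint_family_on_def B_def)
      moreover have "(\<Union>i. B i) = A" by (auto simp: B_def split: if_splits)
      ultimately have "omeas A \<le> (\<Sum>i. omeas (B i))"
        using outer_measure_space_omeas
        by (auto simp: outer_measure_space_def countably_subadditive_def)
      also have "\<dots> = (\<Sum>i\<in>{0, Suc 0}. omeas (B i))"
        using outer_measure_space_omeas
        by (intro suminf_finite) (auto simp: B_def outer_measure_space_def positive_def)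
      finally show ?thesis by (simp add: B_def)
    qed
    with split show ?thesis
      by (auto simp: lambda_system_def Int_commute Diff_eq intro!: antisym)
  qed
  then have "sigma_sets UNIV {U. open U} \<subseteq> lambda_system UNIV UNIV omeas"
    by (intro L.sigma_sets_subset) auto
  then show ?thesis by (simp add: borel_def)
qed

definition rep :: "'a measure" where
  "rep = measure_of UNIV (sets borel) omeas"

lemma sets_rep: "sets rep = sets borel"
  unfolding rep_def by (simp add: sets.sigma_sets_eq[of borel, simplified])

lemma emeasure_rep: "A \<in> sets borel \<Longrightarrow> emeasure rep A = omeas A"
proof -
  have ms: "measure_space UNIV (lambda_system UNIV UNIV omeas) omeas"
    using sigma_algebra.caratheodory_lemma[OF sigma_algebra_Pow, of UNIV omeas] outer_measure_space_omeas
    by simp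
  have "measure_space UNIV (sets borel) omeas"
    by (rule measure_down[OF ms _ borel_subset_lambda_system]) (metis sets.sigma_algebra_axioms space_borel)
  then show "A \<in> sets borel \<Longrightarrow> emeasure rep A = omeas A"
    unfolding rep_def
    by (intro emeasure_measure_of_sigma) (auto simp: measure_space_def)
qed

text \<open>Dini's argument for the lower bound. The partial sums of a cover increase, so on the
  compact set \<open>K j\<close> one of them exceeds \<open>1 - d/2\<close> uniformly; what is
  missing elsewhere is a function vanishing on \<open>K j\<close>, and tightness makes its value
  under \<open>L\<close> at most \<open>e j < d/2\<close>.\<close>

lemma omeas_UNIV: "omeas UNIV = 1"
proof (rule antisym)
  show "omeas UNIV \<le> 1"
    using omeas_le_L[of "\<lambda>x. 1" UNIV] by (simp add: L_one bcont_const)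
  show "1 \<le> omeas UNIV"
    unfolding omeas_def
  proof (rule INF_greatest)
    fix f assume "f \<in> Collect (covers UNIV)"
    then have f: "bcont (f n)" "0 \<le> f n x" "1 \<le> (\<Sum>n. ennreal (f n x))" for n x
      by (auto simp: covers_def)
    define G where "G N x = (\<Sum>n<N. f n x)" for N x
    have G: "bcont (G N)" "0 \<le> G N x" for N x
      using f(1,2) by (auto simp: G_def[abs_def] intro: bcont_sum sum_nonneg)
    have Gmono: "G N x \<le> G N' x" if "N \<le> N'" for N N' x
      unfolding G_def using that f(2) by (intro sum_mono2) auto
    have LG: "ennreal (L (G N)) \<le> (\<Sum>n. ennreal (L (f n)))" for N
    proof -
      have "ennreal (L (G N)) = (\<Sum>n<N. ennreal (L (f n)))"
        unfolding G_def using f(1,2) by (simp add: L_sum L_nonneg sum_ennreal)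
      also have "\<dots> \<le> (\<Sum>n. ennreal (L (f n)))" by (rule sum_le_suminf) auto
      finally show ?thesis .
    qed
    show "1 \<le> (\<Sum>n. ennreal (L (f n)))"
    proof (rule ennreal_le_epsilon)
      fix d :: real assume d: "0 < d"
      obtain j where j: "e j < d / 2"
        using order_tendstoD(2)[OF e_tendsto, of "d/2"] d by (auto simp: eventually_sequentially)
      have "\<exists>N. \<forall>x\<in>K j. 1 - d / 2 < G N x"
      proof -
        have op: "open {x. 1 - d/2 < G N x}" for N
          using bcont_continuous[OF G(1)] by (intro open_Collect_less continuous_intros)
        have "K j \<subseteq> (\<Union>N\<in>UNIV. {x. 1 - d/2 < G N x})"
        proof
          fix x
          have "ennreal (1 - d/2) < 1" using d by (simp add: ennreal_less_one_iff)
          also note f(3)[of x]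
          finally have "ennreal (1 - d/2) < (SUP N. \<Sum>n<N. ennreal (f n x))"
            by (simp add: suminf_eq_SUP)
          then obtain N where "ennreal (1 - d/2) < (\<Sum>n<N. ennreal (f n x))"
            by (auto simp: less_SUP_iff)
          also have "\<dots> = ennreal (G N x)" using f(1,2) by (simp add: G_def sum_ennreal)
          finally have "1 - d/2 < G N x" by (meson ennreal_leI not_le)
          then show "x \<in> (\<Union>N\<in>UNIV. {x. 1 - d/2 < G N x})" by auto
        qed
        from compactE_image[OF K_compact _ this] op
        obtain I where I: "finite I" "K j \<subseteq> (\<Union>N\<in>I. {x. 1 - d/2 < G N x})" by metis
        have "\<forall>x\<in>K j. 1 - d / 2 < G (Max (insert 0 I)) x"
        proof
          fix x assume "x \<in> K j"
          then obtain N where N: "N \<in> I" "1 - d/2 < G N x" using I by auto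
          with I have "G N x \<le> G (Max (insert 0 I)) x" by (intro Gmono) auto
          with N show "1 - d / 2 < G (Max (insert 0 I)) x" by linarith
        qed
        then show ?thesis ..
      qed
      then obtain N where N: "\<And>x. x \<in> K j \<Longrightarrow> 1 - d/2 < G N x" by auto
      \<comment> \<open>The deficit of the partial sum below \<open>1 - d/2\<close>.\<close>
      define p where "p x = max 0 (1 - d/2 - G N x)" for x
      have p: "bcont p" unfolding p_def by (intro bcont_max bcont_diff bcont_const G)
      have "L p \<le> e j"
      proof (rule L_tight[OF p])
        fix x
        show "p x \<le> 1" using G(2)[of N x] d by (auto simp: p_def)
        show "x \<in> K j \<Longrightarrow> p x = 0" using N[of x] by (auto simp: p_def)
      qed (auto simp: p_def)
      have "1 - d/2 = L (\<lambda>x. (1 - d/2) * 1)" using L_scale[of "\<lambda>x. 1" "1 - d/2"] by (simp add: bcont_const L_one)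
      also have "\<dots> \<le> L (\<lambda>x. G N x + p x)"
        by (intro L_mono bcont_add bcont_mult bcont_const p G) (simp add: p_def)
      also have "\<dots> = L (G N) + L p" by (intro L_add p G)
      finally have "1 \<le> L (G N) + d" using \<open>L p \<le> e j\<close> j by linarith
      then have "ennreal 1 \<le> ennreal (L (G N)) + ennreal d"
        using d G by (simp add: L_nonneg flip: ennreal_plus ennreal_1)
      also have "\<dots> \<le> (\<Sum>n. ennreal (L (f n))) + ennreal d"
        using LG by (rule add_right_mono)
      finally show "1 \<le> (\<Sum>n. ennreal (L (f n))) + ennreal d" by simp
    qed
  qed
qed

lemma rep_prob: "rep \<in> prob_measures"
proof -
  have "space rep = UNIV" using sets_eq_imp_space_eq[OF sets_rep] by simp
  then have "prob_space rep"
    by (intro prob_spaceI) (simp add: emeasure_rep omeas_UNIV)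
  then show ?thesis by (simp add: prob_measures_def sets_rep)
qed

text \<open>A layer-cake comparison. The function is cut into layers \<open>p i\<close> of height
  \<open>1/n\<close>. The scaled layer \<open>n * p i\<close> equals 1 on the level set
  \<open>E (Suc i)\<close>, so its value under \<open>L\<close> dominates the measure of that set,
  while the integral of \<open>p (Suc i)\<close> is at most that measure divided by
  \<open>n\<close>. Integrals and values under \<open>L\<close> thus compare after a shift by one
  layer, and the unmatched bottom layer costs only \<open>1/n\<close>.\<close>

lemma integral_rep_le:
  assumes f: "bcont f" "\<And>x. 0 \<le> f x" "\<And>x. f x \<le> 1"
  shows "(\<integral>x. f x \<partial>rep) \<le> L f"
proof -
  interpret prob_space rep by (rule prob_measuresD[OF rep_prob])
  have "(\<integral>x. f x \<partial>rep) \<le> L f + 1 / real (Suc N)" for N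
  proof -
    define n where "n = Suc N"
    have n: "0 < real n" by (simp add: n_def)
    define p where "p i x = min (f x) (real (Suc i) / n) - min (f x) (real i / n)" for i x
    have p: "bcont (p i)" "0 \<le> p i x" for i x
    proof -
      show "bcont (p i)" unfolding p_def by (intro bcont_diff bcont_min bcont_const f)
      have "real i / n \<le> real (Suc i) / n" by (intro divide_right_mono) auto
      then show "0 \<le> p i x" unfolding p_def by linarith
    qed
    have sum_p: "f = (\<lambda>x. \<Sum>i<n. p i x)"
    proof
      fix x
      have "(\<Sum>i<n. p i x) = min (f x) (real n / n) - min (f x) (real 0 / n)"
        unfolding p_def by (rule sum_lessThan_telescope)
      then show "f x = (\<Sum>i<n. p i x)" using f(2,3)[of x] n by simp
    qed
    define E where "E i = {x. real i / n \<le> f x}" for i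
    have E: "E i \<in> sets borel" for i
      unfolding E_def using bcont_measurable[OF f(1)] by measurable
    have p_le: "p i x \<le> indicator (E i) x * (1 / n)" for i x
      using n by (auto simp: p_def E_def indicator_def min_def field_simps)
    have meas_le: "measure rep (E (Suc i)) \<le> n * L (p i)" for i
    proof -
      have "omeas (E (Suc i)) \<le> ennreal (L (\<lambda>x. n * p i x))"
        using n by (intro omeas_le_L bcont_mult bcont_const p)
          (auto simp: p(2), auto simp: p_def E_def min_def field_simps)
      then show ?thesis
        using n p by (simp add: measure_def emeasure_rep E L_scale L_nonneg enn2real_leI)
    qed
    have int_le: "(\<integral>x. p i x \<partial>rep) \<le> measure rep (E i) / n" for i
    proof -
      have "(\<integral>x. p i x \<partial>rep) \<le> (\<integral>x. indicator (E i) x * (1 / n) \<partial>rep)"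
      proof (rule integral_mono)
        show "integrable rep (p i)" by (intro bcont_integrable rep_prob p)
        show "integrable rep (\<lambda>x. indicator (E i) x * (1 / n))"
          by (rule integrable_bounded_measurable[OF rep_prob, where B = "1 / n"])
            (use E n in \<open>auto simp: indicator_def\<close>)
      qed (rule p_le)
      then show ?thesis using E by (simp add: sets_rep)
    qed
    have "(\<integral>x. f x \<partial>rep) = (\<Sum>i<Suc N. \<integral>x. p i x \<partial>rep)"
      unfolding n_def[symmetric] by (subst sum_p) (intro Bochner_Integration.integral_sum bcont_integrable rep_prob p)
    also have "\<dots> = (\<integral>x. p 0 x \<partial>rep) + (\<Sum>i<N. \<integral>x. p (Suc i) x \<partial>rep)"
      by (rule sum.lessThan_Suc_shift)
    also have "\<dots> \<le> 1 / n + (\<Sum>i<N. L (p i))"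
    proof (intro add_mono sum_mono)
      show "(\<integral>x. p 0 x \<partial>rep) \<le> 1 / n"
        by (rule order_trans[OF int_le]) (simp add: divide_right_mono)
      fix i
      show "(\<integral>x. p (Suc i) x \<partial>rep) \<le> L (p i)"
        using order_trans[OF int_le[of "Suc i"] divide_right_mono[OF meas_le[of i], of "real n"]] n by simp
    qed
    also have "(\<Sum>i<N. L (p i)) \<le> (\<Sum>i<n. L (p i))"
      unfolding n_def using p by (intro sum_mono2) (auto simp: L_nonneg)
    also have "(\<Sum>i<n. L (p i)) = L f"
      using L_sum[of "{..<n}" p, OF p(1)] arg_cong[OF sum_p, of L] by (rule trans[OF sym sym])
    finally show ?thesis by (simp add: n_def)
  qed
  moreover have "(\<lambda>N. L f + 1 / real (Suc N)) \<longlonglongrightarrow> L f + 0"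
    by (intro tendsto_intros LIMSEQ_inverse_real_of_nat[unfolded inverse_eq_divide])
  ultimately show ?thesis by (intro LIMSEQ_le_const[where X = "\<lambda>N. L f + 1 / real (Suc N)"]) auto
qed

text \<open>The one-sided bound applied to \<open>g\<close> and to \<open>1 - g\<close> gives
  equality for values in the unit interval; an affine change of scale does the rest.\<close>

lemma integral_rep:
  assumes f: "bcont f" shows "(\<integral>x. f x \<partial>rep) = L f"
proof -
  interpret prob_space rep by (rule prob_measuresD[OF rep_prob])
  have unit: "(\<integral>x. g x \<partial>rep) = L g" if g: "bcont g" "\<And>x. 0 \<le> g x" "\<And>x. g x \<le> 1" for g
  proof (rule antisym)
    show "(\<integral>x. g x \<partial>rep) \<le> L g" using g by (rule integral_rep_le)
    have "(\<integral>x. 1 - g x \<partial>rep) \<le> L (\<lambda>x. 1 - g x)"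
      using g by (intro integral_rep_le bcont_diff bcont_const) auto
    moreover have "(\<integral>x. 1 - g x \<partial>rep) = 1 - (\<integral>x. g x \<partial>rep)"
      by (subst Bochner_Integration.integral_diff) (auto simp: bcont_integrable rep_prob g prob_space)
    ultimately show "L g \<le> (\<integral>x. g x \<partial>rep)"
      using g by (simp add: L_diff bcont_const L_one)
  qed
  obtain B where B: "0 < B" "\<And>x. \<bar>f x\<bar> \<le> B" using bcontE[OF f] by blast
  define g where "g x = 1 / (2 * B) * f x + 1 / 2" for x
  have gb: "bcont g" unfolding g_def by (intro bcont_add bcont_mult bcont_const f)
  have "0 \<le> g x" "g x \<le> 1" for x
    using B(1) B(2)[of x] by (auto simp: g_def field_simps abs_le_iff)
  from unit[OF gb this] have g: "(\<integral>x. g x \<partial>rep) = L g" .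
  have fg: "f = (\<lambda>x. 2 * B * g x + (- B) * 1)" using B(1) by (auto simp: g_def field_simps)
  have "(\<integral>x. f x \<partial>rep) = 2 * B * (\<integral>x. g x \<partial>rep) - B"
    by (subst fg, subst Bochner_Integration.integral_add) (auto simp: bcont_integrable rep_prob gb prob_space)
  moreover have "L f = 2 * B * L g + (- B) * L (\<lambda>x. 1)"
    by (subst fg, subst L_add) (simp_all only: L_scale gb bcont_mult bcont_const)
  ultimately show ?thesis by (simp add: g L_one)
qed

end

subsection \<open>Compactness of tight sets of measures\<close>

lemma closed_tight_functional: "closed {L. tight_functional L K e}"
proof -
  have c: "continuous_on UNIV (\<lambda>L :: ('a::metric_space \<Rightarrow> real) \<Rightarrow> real. L f)" for f
    by (rule continuous_on_product_coordinates)
  note cl = closed_Collect_all closed_Collect_imp closed_Collect_eq closed_Collect_le closed_Collect_conj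
    open_Collect_const closed_Collect_const
  show ?thesis
    unfolding tight_functional_def by (intro cl continuous_intros c)
qed

text \<open>Prokhorov's theorem in the form of compactness. Since an integral of \<open>f\<close> is
  bounded by the supremum of its absolute value, the functionals lie in a product of compact
  intervals. The representing measure depends continuously on the functional because subbasic sets
  pull back to conditions on one coordinate. The image is the whole tight set, since integration
  against a tight measure is itself a tight functional.\<close>

theorem compactin_tight:
  fixes K :: "nat \<Rightarrow> 'a::metric_space set"
  assumes K: "\<And>j. compact (K j)" and e: "e \<longlonglongrightarrow> 0"
  shows "compactin weak_top {m \<in> prob_measures. \<forall>j. measure m (- K j) \<le> e j}" (is "compactin _ ?T")
proof -
  \<comment> \<open>Coordinates outside the bounded continuous functions are pinned to 0 so that
    their factors are compact too.\<close>
  define B where "B f = (if bcont f then {- (SUP x. \<bar>f x\<bar>)..(SUP x. \<bar>f x\<bar>)} else {0})" for f :: "'a \<Rightarrow> real"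
  have "compactin (product_topology (\<lambda>_. euclidean) UNIV) (PiE UNIV B)"
    unfolding compactin_PiE by (auto simp: B_def)
  then have cB: "compact {L. \<forall>f. L f \<in> B f}"
    by (simp add: euclidean_product_topology PiE_UNIV_domain Pi_def)
  define R where "R = {L. \<forall>f. L f \<in> B f} \<inter> {L. tight_functional L K e}"
  have "compact R"
    unfolding R_def by (rule compact_Int_closed[OF cB closed_tight_functional])
  then have R: "compactin (top_of_set R) R" by (simp add: compactin_subtopology)
  have rep: "tight_functional.rep L \<in> prob_measures"
    "\<And>f. bcont f \<Longrightarrow> (\<integral>x. f x \<partial>(tight_functional.rep L)) = L f" if "L \<in> R" for L
  proof -
    interpret tight_functional L K e using that by (simp add: R_def)
    show "rep \<in> prob_measures" by (rule rep_prob)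
    show "\<And>f. bcont f \<Longrightarrow> (\<integral>x. f x \<partial>rep) = L f" by (rule integral_rep)
  qed
  have cont: "continuous_map (top_of_set R) weak_top tight_functional.rep"
    unfolding weak_top_def
  proof (rule continuous_on_generated_topo)
    fix V :: "'a measure set"
    assume "V \<in> {{m \<in> prob_measures. integral\<^sup>L m f \<in> U} |(f :: 'a \<Rightarrow> real) U. continuous_on UNIV f \<and> bounded (range f) \<and> open U}"
    then have "\<exists>(f :: 'a \<Rightarrow> real) U. V = {m \<in> prob_measures. integral\<^sup>L m f \<in> U} \<and> bcont f \<and> open U"
      unfolding bcont_def by (simp only: mem_Collect_eq conj_assoc)
    then obtain f :: "'a \<Rightarrow> real" and U where V: "V = {m \<in> prob_measures. integral\<^sup>L m f \<in> U}" "bcont f" "open U"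
      by (elim exE conjE)
    have "tight_functional.rep -` V \<inter> topspace (top_of_set R) = R \<inter> (\<lambda>L. L f) -` U"
      using rep V by auto
    also have "openin (top_of_set R) \<dots>"
      by (rule continuous_openin_preimage_gen)
        (use V continuous_on_subset[OF continuous_on_product_coordinates] in auto)
    finally show "openin (top_of_set R) (tight_functional.rep -` V \<inter> topspace (top_of_set R))" .
  next
    show "tight_functional.rep ` topspace (top_of_set R) \<subseteq>
       \<Union>{{m \<in> prob_measures. integral\<^sup>L m f \<in> U} |(f :: 'a \<Rightarrow> real) U. continuous_on UNIV f \<and> bounded (range f) \<and> open U}"
      using topspace_weak_top[where 'a = 'a] rep(1) unfolding weak_top_def by auto
  qed
  have "tight_functional.rep ` R = ?T"
  proof (intro equalityI subsetI)
    fix m assume "m \<in> tight_functional.rep ` R"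
    then obtain L where L: "L \<in> R" and m: "m = tight_functional.rep L" by auto
    interpret tight_functional L K e using L by (simp add: R_def)
    interpret prob_space rep by (rule prob_measuresD[OF rep_prob])
    have "measure rep (- K j) \<le> e j" for j
    \<comment> \<open>For empty \<open>K j\<close> the functions \<open>sep_fun\<close> do not
      approximate the indicator; here tightness applied to the constant 1 already gives
      \<open>1 \<le> e j\<close>.\<close>
    proof (cases "K j = {}")
      case True
      then have "L (\<lambda>x. 1) \<le> e j" by (intro L_tight) (auto simp: bcont_const)
      then show ?thesis by (simp add: L_one order_trans[OF prob_le_1])
    next
      case False
      have cl: "closed (K j)" using K by (rule compact_imp_closed)
      have "1 - (\<integral>x. sep_fun (K j) k x \<partial>rep) \<le> e j" for k
      proof -
        have "L (\<lambda>x. 1 - sep_fun (K j) k x) \<le> e j"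
          by (rule L_tight) (auto intro: bcont_diff bcont_const bcont_sep_fun simp: sep_fun_range sep_fun_eq_1)
        then show ?thesis by (simp add: L_diff bcont_const bcont_sep_fun L_one integral_rep)
      qed
      moreover have "(\<lambda>k. 1 - (\<integral>x. sep_fun (K j) k x \<partial>rep)) \<longlonglongrightarrow> 1 - measure rep (K j)"
        by (intro tendsto_intros sep_fun_integral_tendsto rep_prob cl False)
      ultimately have "1 - measure rep (K j) \<le> e j" by (intro LIMSEQ_le_const2) auto
      moreover have "measure rep (- K j) = 1 - measure rep (K j)"
        using prob_compl[of "K j"] cl prob_measuresD(3)[OF rep_prob] by (simp add: Compl_eq_Diff_UNIV sets_rep)
      ultimately show ?thesis by simp
    qed
    then show "m \<in> ?T" using m rep_prob by simp
  next
    fix m assume m: "m \<in> ?T"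
    then have mp: "m \<in> prob_measures" by simp
    interpret prob_space m by (rule prob_measuresD[OF mp])
    define L where "L f = (if bcont f then \<integral>x. f x \<partial>m else 0)" for f
    have "tight_functional L K e"
    proof
      show "L (\<lambda>x. f x + g x) = L f + L g" if "bcont f" "bcont g" for f g
        using that by (simp add: L_def bcont_add bcont_integrable[OF mp])
      show "L (\<lambda>x. c * f x) = c * L f" if "bcont f" for f c
        using that bcont_mult[OF bcont_const that] by (simp add: L_def)
      show "0 \<le> L f" if "bcont f" "\<And>x. 0 \<le> f x" for f
        using that by (simp add: L_def)
      show "L (\<lambda>x. 1) = 1" by (simp add: L_def bcont_const prob_space)
      show "L f \<le> e j" if f: "bcont f" "\<And>x. 0 \<le> f x" "\<And>x. f x \<le> 1" "\<And>x. x \<in> K j \<Longrightarrow> f x = 0" for f j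
      proof -
        have KB: "- K j \<in> sets borel" using compact_imp_closed[OF K] by (simp add: borel_comp)
        have "(\<integral>x. f x \<partial>m) \<le> (\<integral>x. indicator (- K j) x \<partial>m)"
        proof (rule integral_mono)
          show "integrable m f" by (intro bcont_integrable[OF mp] f)
          show "integrable m (indicator (- K j) :: 'a \<Rightarrow> real)"
            by (rule integrable_bounded_measurable[OF mp, where B = 1]) (use KB in \<open>auto simp: indicator_def\<close>)
          show "f x \<le> indicator (- K j) x" for x using f by (auto simp: indicator_def)
        qed
        also have "\<dots> = measure m (- K j)" using KB prob_measuresD(1)[OF mp] by simp
        also have "\<dots> \<le> e j" using m by simp
        finally show ?thesis using f by (simp add: L_def)
      qed
    qed (use K e in auto)
    moreover have "L f \<in> B f" for f
    proof (cases "bcont f")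
      case True
      then obtain D where D: "\<And>x. \<bar>f x\<bar> \<le> D" using bcontE by metis
      have le: "\<bar>f x\<bar> \<le> (SUP x. \<bar>f x\<bar>)" for x
        by (rule cSUP_upper) (use D in \<open>auto intro!: bdd_aboveI2\<close>)
      have "\<bar>\<integral>x. f x \<partial>m\<bar> \<le> (\<integral>x. \<bar>f x\<bar> \<partial>m)" by (rule integral_abs_bound)
      also have "\<dots> \<le> (\<integral>x. (SUP x. \<bar>f x\<bar>) \<partial>m)"
        using bcont_integrable[OF mp True] le by (intro integral_mono) auto
      finally show ?thesis using True by (auto simp: L_def B_def prob_space abs_le_iff)
    qed (simp add: L_def B_def)
    ultimately have LR: "L \<in> R" by (simp add: R_def)
    have "tight_functional.rep L = m"
      by (rule prob_measures_eqI) (use rep[OF LR] mp in \<open>auto simp: L_def\<close>)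
    with LR show "m \<in> tight_functional.rep ` R" by blast
  qed
  with image_compactin[OF R cont] show ?thesis by simp
qed

subsection \<open>Approximation of measurable functions in mean\<close>

text \<open>One function has to be good for two measures at once: the variational formula has a
  linear term under one measure and an exponential moment under the other.\<close>

definition l1_err :: "'a measure \<Rightarrow> 'a measure \<Rightarrow> ('a \<Rightarrow> real) \<Rightarrow> ('a \<Rightarrow> real) \<Rightarrow> real" where
  "l1_err m k f g = (\<integral>x. \<bar>f x - g x\<bar> \<partial>m) + (\<integral>x. \<bar>f x - g x\<bar> \<partial>k)"

lemma integrable_indicator_borel:
  "m \<in> prob_measures \<Longrightarrow> A \<in> sets borel \<Longrightarrow> integrable m (indicator A :: 'a::topological_space \<Rightarrow> real)"
  by (rule integrable_bounded_measurable[where B = 1]) (auto simp: indicator_def)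

lemma integrable_abs_diff:
  fixes f g :: "_ \<Rightarrow> real"
  assumes "m \<in> prob_measures" "f \<in> borel_measurable borel" "\<And>x. \<bar>f x\<bar> \<le> B"
    "g \<in> borel_measurable borel" "\<And>x. \<bar>g x\<bar> \<le> D"
  shows "integrable m (\<lambda>x. \<bar>f x - g x\<bar>)"
  using assms
  by (intro integrable_abs Bochner_Integration.integrable_diff integrable_bounded_measurable[where B = B and f = f]
      integrable_bounded_measurable[where B = D and f = g])

text \<open>Dynkin's argument from the closed sets. The approximations are \<open>sep_fun\<close>
  for closed sets, \<open>1 - f\<close> for complements, and for a disjoint union the capped sum
  over finitely many members, whose remainder is small under both measures.\<close>

lemma approx_indicator:
  fixes m k :: "'a::metric_space measure"
  assumes m: "m \<in> prob_measures" and k: "k \<in> prob_measures" and A: "A \<in> sets borel" and "0 < d"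
  shows "\<exists>f. bcont f \<and> (\<forall>x. 0 \<le> f x \<and> f x \<le> 1) \<and> l1_err m k f (indicator A) < d"
proof -
  have *: "A \<in> sigma_sets UNIV {C. closed C}" using A by (simp add: borel_eq_closed)
  have "Int_stable {C::'a set. closed C}" by (auto simp: Int_stable_def)
  moreover have "{C::'a set. closed C} \<subseteq> Pow UNIV" by simp
  ultimately show ?thesis using * \<open>0 < d\<close>
  proof (induction arbitrary: d rule: sigma_sets_induct_disjoint)
    case (basic A)
    then have A: "closed A" "A \<in> sets borel" by auto
    show ?case
    proof (cases "A = {}")
      case True
      then show ?thesis
        using basic(2) by (intro exI[of _ "\<lambda>x. 0"]) (auto simp: l1_err_def bcont_const)
    next
      case False
      have lim: "(\<lambda>i. \<integral>x. \<bar>sep_fun A i x - indicator A x\<bar> \<partial>n) \<longlonglongrightarrow> 0" if n: "n \<in> prob_measures" for n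
      proof -
        have "(\<integral>x. \<bar>sep_fun A i x - indicator A x\<bar> \<partial>n) = (\<integral>x. sep_fun A i x \<partial>n) - measure n A" for i
        proof -
          have "(\<integral>x. \<bar>sep_fun A i x - indicator A x\<bar> \<partial>n) = (\<integral>x. sep_fun A i x - indicator A x \<partial>n)"
            by (rule Bochner_Integration.integral_cong) (auto simp: sep_fun_range sep_fun_eq_1 indicator_def)
          also have "\<dots> = (\<integral>x. sep_fun A i x \<partial>n) - (\<integral>x. indicator A x \<partial>n)"
            by (intro Bochner_Integration.integral_diff bcont_integrable[OF n bcont_sep_fun]
                integrable_indicator_borel n A(2))
          finally show ?thesis using A prob_measuresD[OF n] by simp
        qed
        then show ?thesis
          using tendsto_diff[OF sep_fun_integral_tendsto[OF n A(1) False] tendsto_const[of "measure n A"]] by simp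
      qed
      have "(\<lambda>i. l1_err m k (sep_fun A i) (indicator A)) \<longlonglongrightarrow> 0 + 0"
        unfolding l1_err_def by (intro tendsto_add lim m k)
      then have "eventually (\<lambda>i. l1_err m k (sep_fun A i) (indicator A) < d) sequentially"
        using basic(2) by (intro order_tendstoD) auto
      then obtain i where "l1_err m k (sep_fun A i) (indicator A) < d"
        by (auto simp: eventually_sequentially)
      then show ?thesis by (intro exI[of _ "sep_fun A i"]) (auto simp: bcont_sep_fun sep_fun_range)
    qed
  next
    case empty
    then show ?case by (intro exI[of _ "\<lambda>x. 0"]) (auto simp: l1_err_def bcont_const)
  next
    case (compl A)
    obtain f where f: "bcont f" "\<forall>x. 0 \<le> f x \<and> f x \<le> 1" "l1_err m k f (indicator A) < d"
      using compl.IH[OF compl.prems] by auto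
    have "\<bar>1 - f x - indicator (UNIV - A) x\<bar> = \<bar>f x - indicator A x\<bar>" for x
      by (auto simp: indicator_def)
    then have "l1_err m k (\<lambda>x. 1 - f x) (indicator (UNIV - A)) = l1_err m k f (indicator A)"
      by (simp add: l1_err_def)
    with f show ?case by (intro exI[of _ "\<lambda>x. 1 - f x"]) (auto intro: bcont_diff bcont_const)
  next
    case (union A)
    have A: "A i \<in> sets borel" for i using union.hyps(2) by (auto simp: borel_eq_closed)
    have tail: "(\<lambda>n. measure p ((\<Union>i. A i) - (\<Union>i<n. A i))) \<longlonglongrightarrow> 0" if p: "p \<in> prob_measures" for p
    proof -
      interpret prob_space p by (rule prob_measuresD[OF p])
      have "(\<lambda>n. measure p ((\<Union>i. A i) - (\<Union>i<n. A i))) \<longlonglongrightarrow> measure p (\<Inter>n. (\<Union>i. A i) - (\<Union>i<n. A i))"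
        by (rule finite_Lim_measure_decseq)
          (use A prob_measuresD[OF p] in \<open>auto simp: decseq_def intro!: sets.Diff sets.countable_UN\<close>)
      moreover have "(\<Inter>n. (\<Union>i. A i) - (\<Union>i<n. A i)) = {}" by auto
      ultimately show ?thesis by (simp only: measure_empty)
    qed
    have "(\<lambda>n. measure m ((\<Union>i. A i) - (\<Union>i<n. A i)) + measure k ((\<Union>i. A i) - (\<Union>i<n. A i))) \<longlonglongrightarrow> 0 + 0"
      by (intro tendsto_add tail m k)
    then have "eventually (\<lambda>n. measure m ((\<Union>i. A i) - (\<Union>i<n. A i)) + measure k ((\<Union>i. A i) - (\<Union>i<n. A i)) < d / 2) sequentially"
      using union.prems by (intro order_tendstoD) auto
    then obtain n where n: "measure m ((\<Union>i. A i) - (\<Union>i<n. A i)) + measure k ((\<Union>i. A i) - (\<Union>i<n. A i)) < d / 2"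
      by (auto simp: eventually_sequentially)
    define R where "R = (\<Union>i. A i) - (\<Union>i<n. A i)"
    have R: "R \<in> sets borel" unfolding R_def using A by auto
    \<comment> \<open>The \<open>n\<close> approximations together use up less than
      \<open>d/2\<close>, the remainder \<open>R\<close> the other half; \<open>Suc n\<close> keeps
      the divisor positive for \<open>n = 0\<close>.\<close>
    have "0 < d / (2 * real (Suc n))" using union.prems by simp
    then have "\<forall>i. \<exists>f. bcont f \<and> (\<forall>x. 0 \<le> f x \<and> f x \<le> 1) \<and> l1_err m k f (indicator (A i)) < d / (2 * real (Suc n))"
      using union.IH by blast
    then obtain f where f: "\<And>i. bcont (f i)" "\<And>i x. 0 \<le> f i x" "\<And>i x. f i x \<le> 1"
      "\<And>i. l1_err m k (f i) (indicator (A i)) < d / (2 * real (Suc n))"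
      by metis
    define F where "F x = min 1 (\<Sum>i<n. f i x)" for x
    have F: "bcont F" unfolding F_def by (intro bcont_min bcont_const bcont_sum f)
    have F01: "0 \<le> F x" "F x \<le> 1" for x unfolding F_def using f by (auto intro: sum_nonneg)
    have pw: "\<bar>F x - indicator (\<Union>i. A i) x\<bar> \<le> (\<Sum>i<n. \<bar>f i x - indicator (A i) x\<bar>) + indicator R x" for x
    proof (cases "x \<in> (\<Union>i<n. A i)")
      case True
      then obtain j where j: "j < n" "x \<in> A j" by auto
      then have "1 - f j x \<le> \<bar>f j x - indicator (A j) x\<bar>" by simp
      also have "\<dots> \<le> (\<Sum>i<n. \<bar>f i x - indicator (A i) x\<bar>)"
        using j by (intro member_le_sum) auto
      finally have "1 - f j x \<le> (\<Sum>i<n. \<bar>f i x - indicator (A i) x\<bar>)" .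
      moreover have "f j x \<le> F x"
        unfolding F_def using j f member_le_sum[of j "{..<n}" "\<lambda>i. f i x"] by auto
      moreover have "x \<in> (\<Union>i. A i)" "x \<notin> R" using j by (auto simp: R_def)
      ultimately show ?thesis using F01[of x] by (simp add: abs_if)
    next
      case False
      show ?thesis
      proof (cases "x \<in> (\<Union>i. A i)")
        case True
        then have "x \<in> R" using False by (auto simp: R_def)
        moreover have "0 \<le> (\<Sum>i<n. \<bar>f i x - indicator (A i) x\<bar>)" by (intro sum_nonneg) auto
        ultimately show ?thesis using True F01[of x] by (simp add: abs_if)
      next
        case F: False
        then have "(\<Sum>i<n. \<bar>f i x - indicator (A i) x\<bar>) = (\<Sum>i<n. f i x)"
          using f by (intro sum.cong) auto
        moreover have "x \<notin> R" using F by (auto simp: R_def)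
        ultimately show ?thesis using F F01[of x] by (simp add: F_def)
      qed
    qed
    have int: "(\<integral>x. \<bar>F x - indicator (\<Union>i. A i) x\<bar> \<partial>p) \<le>
      (\<Sum>i<n. \<integral>x. \<bar>f i x - indicator (A i) x\<bar> \<partial>p) + measure p R" if p: "p \<in> prob_measures" for p
    proof -
      have i1: "integrable p (\<lambda>x. \<bar>f i x - indicator (A i) x\<bar>)" for i
        by (rule integrable_abs_diff[OF p, where B = 1 and D = 1])
          (use f A in \<open>auto simp: bcont_measurable indicator_def\<close>)
      have i2: "integrable p (indicator R :: 'a \<Rightarrow> real)"
        by (rule integrable_indicator_borel[OF p R])
      have "(\<integral>x. \<bar>F x - indicator (\<Union>i. A i) x\<bar> \<partial>p)
        \<le> (\<integral>x. (\<Sum>i<n. \<bar>f i x - indicator (A i) x\<bar>) + indicator R x \<partial>p)"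
      proof (rule integral_mono)
        show "integrable p (\<lambda>x. \<bar>F x - indicator (\<Union>i. A i) x\<bar>)"
          by (rule integrable_abs_diff[OF p, where B = 1 and D = 1])
            (use F F01 A in \<open>auto simp: bcont_measurable indicator_def\<close>)
      qed (use i1 i2 pw in auto)
      also have "\<dots> = (\<Sum>i<n. \<integral>x. \<bar>f i x - indicator (A i) x\<bar> \<partial>p) + measure p R"
        using i1 i2 R prob_measuresD[OF p] by simp
      finally show ?thesis .
    qed
    have "l1_err m k F (indicator (\<Union>i. A i)) \<le> (\<Sum>i<n. l1_err m k (f i) (indicator (A i))) + (measure m R + measure k R)"
      using int[OF m] int[OF k] unfolding l1_err_def sum.distrib by linarith
    also have "\<dots> < (\<Sum>i<n. d / (2 * real (Suc n))) + d / 2 + 0"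
      using n less_imp_le[OF f(4)] unfolding R_def[symmetric] by (simp add: add_mono sum_mono add_le_less_mono del: sum_constant)
    also have "\<dots> \<le> d" using union.prems by (simp add: field_simps)
    finally show ?case using F F01 by blast
  qed
qed

text \<open>After rescaling to the unit interval, \<open>g\<close> is close to an average of
  indicators of level sets, and each indicator is replaced by a continuous function with values in
  the unit interval. The approximation thereby inherits the bound \<open>B\<close>, which later
  gives a uniform Lipschitz constant for the exponential.\<close>

lemma approx_measurable:
  fixes m k :: "'a::metric_space measure"
  assumes m: "m \<in> prob_measures" and k: "k \<in> prob_measures" and g: "g \<in> borel_measurable borel"
    and B: "0 < B" "\<And>x. \<bar>g x\<bar> \<le> B" and "0 < d"
  shows "\<exists>f. bcont f \<and> (\<forall>x. \<bar>f x\<bar> \<le> B) \<and> l1_err m k f g < d"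
proof -
  \<comment> \<open>Rounding to multiples of \<open>1/N\<close> costs \<open>2 * B / N\<close> under
    each measure; the total \<open>4 * B / N\<close> has to stay below \<open>d/2\<close>.\<close>
  obtain N0 where N0: "8 * B / d < real N0" using reals_Archimedean2 by blast
  define N where "N = Suc N0"
  have N: "0 < real N" "8 * B / d < real N" using N0 by (auto simp: N_def)
  define u where "u x = (g x + B) / (2 * B)" for x
  have u: "u \<in> borel_measurable borel" "0 \<le> u x" "u x \<le> 1" for x
  proof -
    show "u \<in> borel_measurable borel" unfolding u_def using g by measurable
  qed (use B(1) B(2)[of x] in \<open>auto simp: u_def field_simps abs_le_iff\<close>)
  \<comment> \<open>With thresholds starting at \<open>1/N\<close>, the average \<open>s\<close> is
    \<open>u\<close> rounded down to a multiple of \<open>1/N\<close>.\<close>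
  define E where "E i = {x. real (Suc i) / N \<le> u x}" for i
  have E: "E i \<in> sets borel" for i unfolding E_def using u(1) by measurable
  define s where "s x = (\<Sum>i<N. indicator (E i) x) / N" for x
  have s: "\<bar>s x - u x\<bar> \<le> 1 / N" for x
  proof -
    have e: "indicator (E i) x / N \<le> min (u x) (real (Suc i) / N) - min (u x) (real i / N)" for i
      using N(1) u(2)[of x] by (auto simp: E_def indicator_def min_def field_simps)
    have "s x \<le> (\<Sum>i<N. min (u x) (real (Suc i) / N) - min (u x) (real i / N))"
      unfolding s_def sum_divide_distrib using e by (intro sum_mono) simp
    also have "\<dots> = min (u x) (real N / N) - min (u x) (real 0 / N)"
      by (rule sum_lessThan_telescope)
    also have "\<dots> = u x" using u N by simp
    finally have le: "s x \<le> u x" .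
    have e': "min (u x - 1 / N) (real (Suc i) / N) - min (u x - 1 / N) (real i / N) \<le> indicator (E i) x / N" for i
    proof -
      have "real (Suc i) / N = real i / N + 1 / N" by (simp add: add_divide_distrib)
      then show ?thesis using N(1) by (auto simp: E_def indicator_def min_def simp del: of_nat_Suc)
    qed
    have "u x - 1 / N \<le> min (u x - 1 / N) (real N / N) - min (u x - 1 / N) (real 0 / N)"
    proof -
      have "real N / real N = 1" "real 0 / real N = 0" "0 \<le> 1 / real N" using N by auto
      then show ?thesis using u(2,3)[of x] by linarith
    qed
    also have "\<dots> = (\<Sum>i<N. min (u x - 1 / N) (real (Suc i) / N) - min (u x - 1 / N) (real i / N))"
      by (rule sum_lessThan_telescope[symmetric])
    also have "\<dots> \<le> s x"
      unfolding s_def sum_divide_distrib using e' by (intro sum_mono) simp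
    finally show ?thesis using le N by simp
  qed
  have "0 < d / (4 * B)" using B \<open>0 < d\<close> by simp
  then have "\<forall>i. \<exists>f. bcont f \<and> (\<forall>x. 0 \<le> f x \<and> f x \<le> 1) \<and> l1_err m k f (indicator (E i)) < d / (4 * B)"
    using approx_indicator[OF m k E] by blast
  then obtain f where f: "\<And>i. bcont (f i)" "\<And>i x. 0 \<le> f i x" "\<And>i x. f i x \<le> 1"
    "\<And>i. l1_err m k (f i) (indicator (E i)) < d / (4 * B)"
    by metis
  define F where "F x = 2 * B * ((1 / N) * (\<Sum>i<N. f i x)) + (- B)" for x
  have F: "bcont F" unfolding F_def by (intro bcont_add bcont_mult bcont_const bcont_sum f)
  have FB: "\<bar>F x\<bar> \<le> B" for x
  proof -
    define q where "q = (1 / N) * (\<Sum>i<N. f i x)"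
    have "0 \<le> (\<Sum>i<N. f i x)" using f(2) by (intro sum_nonneg) auto
    then have "0 \<le> q" by (simp add: q_def)
    have "(\<Sum>i<N. f i x) \<le> real N" using sum_mono[of "{..<N}" "\<lambda>i. f i x" "\<lambda>i. 1"] f(3) by simp
    then have "q \<le> 1" using N(1) by (simp add: q_def)
    have "0 \<le> 2 * B * q" using \<open>0 \<le> q\<close> B(1) by simp
    moreover have "2 * B * q \<le> 2 * B" using mult_left_mono[OF \<open>q \<le> 1\<close>, of "2 * B"] B(1) by simp
    ultimately show ?thesis unfolding F_def q_def[symmetric] by linarith
  qed
  have pw: "\<bar>F x - g x\<bar> \<le> (2 * B / N) * (\<Sum>i<N. \<bar>f i x - indicator (E i) x\<bar>) + 2 * B / N" for x
  proof -
    have gx: "g x = 2 * B * u x - B" using B by (simp add: u_def)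
    have "F x - g x = (2 * B / N) * (\<Sum>i<N. f i x - indicator (E i) x) + 2 * B * (s x - u x)"
      unfolding F_def s_def gx sum_subtractf by (simp add: algebra_simps diff_divide_distrib)
    also have "\<bar>\<dots>\<bar> \<le> (2 * B / N) * \<bar>\<Sum>i<N. f i x - indicator (E i) x\<bar> + 2 * B * \<bar>s x - u x\<bar>"
      using B N by (intro order_trans[OF abs_triangle_ineq]) (simp add: abs_mult)
    also have "\<dots> \<le> (2 * B / N) * (\<Sum>i<N. \<bar>f i x - indicator (E i) x\<bar>) + 2 * B * (1 / N)"
      using B N s[of x] by (intro add_mono mult_left_mono sum_abs) auto
    finally show ?thesis by simp
  qed
  have int: "(\<integral>x. \<bar>F x - g x\<bar> \<partial>p) \<le> (2 * B / N) * (\<Sum>i<N. \<integral>x. \<bar>f i x - indicator (E i) x\<bar> \<partial>p) + 2 * B / N"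
    if p: "p \<in> prob_measures" for p
  proof -
    interpret p: prob_space p by (rule prob_measuresD[OF p])
    have i1: "integrable p (\<lambda>x. \<bar>f i x - indicator (E i) x\<bar>)" for i
      by (rule integrable_abs_diff[OF p, where B = 1 and D = 1])
        (use f E in \<open>auto simp: bcont_measurable indicator_def\<close>)
    have "(\<integral>x. \<bar>F x - g x\<bar> \<partial>p) \<le> (\<integral>x. (2 * B / N) * (\<Sum>i<N. \<bar>f i x - indicator (E i) x\<bar>) + 2 * B / N \<partial>p)"
    proof (rule integral_mono)
      show "integrable p (\<lambda>x. \<bar>F x - g x\<bar>)"
        by (rule integrable_abs_diff[OF p, where B = B and D = B])
          (use F FB g B in \<open>auto simp: bcont_measurable\<close>)
    qed (use i1 pw in auto)
    also have "\<dots> = (2 * B / N) * (\<Sum>i<N. \<integral>x. \<bar>f i x - indicator (E i) x\<bar> \<partial>p) + 2 * B / N"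
      using i1 by (simp add: p.prob_space)
    finally show ?thesis .
  qed
  have "l1_err m k F g \<le> (2 * B / N) * (\<Sum>i<N. l1_err m k (f i) (indicator (E i))) + 4 * B / N"
  proof -
    have "4 * B / N = 2 * B / N + 2 * B / N" by simp
    then show ?thesis using int[OF m] int[OF k] unfolding l1_err_def sum.distrib distrib_left by linarith
  qed
  also have "\<dots> \<le> (2 * B / N) * (\<Sum>i<N. d / (4 * B)) + 4 * B / N"
    using B N f(4) by (intro add_mono mult_left_mono sum_mono) (auto intro: less_imp_le)
  also have "\<dots> = d / 2 + 4 * B / N" using B N by simp
  also have "\<dots> < d" using N B \<open>0 < d\<close> by (simp add: field_simps)
  finally show ?thesis using F FB by blast
qed

subsection \<open>Relative entropy and its variational formula\<close>

text \<open>Jensen's inequality in its tangent form \<open>1 + a \<le> exp a\<close>, applied to the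
  logarithm of the ratio \<open>r\<close> between the tilted density \<open>exp g / Z\<close> and
  \<open>D\<close>. The \<open>Q\<close>-integral of \<open>r\<close> is at most 1; it may be
  smaller because the set where \<open>D\<close> vanishes is lost.\<close>

lemma gibbs_variational:
  fixes D g :: "'a \<Rightarrow> real"
  assumes P: "prob_space P" and Q: "prob_space Q" and D: "D \<in> borel_measurable P" "\<And>x. 0 \<le> D x"
    and QD: "Q = density P (\<lambda>x. ennreal (D x))" and int: "integrable Q (\<lambda>x. ln (D x))"
    and g: "g \<in> borel_measurable P" "\<And>x. \<bar>g x\<bar> \<le> B"
  shows "(\<integral>x. g x \<partial>Q) - ln (\<integral>x. exp (g x) \<partial>P) \<le> (\<integral>x. ln (D x) \<partial>Q)"
proof -
  interpret P: prob_space P by fact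
  interpret Q: prob_space Q by fact
  have gQ: "g \<in> borel_measurable Q" using g(1) QD by simp
  have DQ: "D \<in> borel_measurable Q" using D(1) QD by simp
  have iexp: "integrable P (\<lambda>x. exp (g x))"
    by (rule P.integrable_const_bound[where B = "exp B"]) (use g in \<open>auto simp: abs_le_iff\<close>)
  have ig: "integrable Q g"
    by (rule Q.integrable_const_bound[where B = B]) (use g gQ in auto)
  define Z where "Z = (\<integral>x. exp (g x) \<partial>P)"
  have "exp (- B) = (\<integral>x. exp (- B) \<partial>P)" by (simp add: P.prob_space)
  also have "\<dots> \<le> Z"
    unfolding Z_def by (rule integral_mono) (use iexp g(2) in \<open>auto simp: abs_le_iff minus_le_iff\<close>)
  finally have Z: "0 < Z" using exp_gt_zero less_le_trans by blast
  define r where "r x = exp (g x) / (D x * Z)" for x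
  have r: "r \<in> borel_measurable Q" "r \<in> borel_measurable P" "\<And>x. 0 \<le> r x"
    unfolding r_def using gQ DQ g(1) D Z by auto
  have "(\<integral>\<^sup>+x. ennreal (r x) \<partial>Q) = (\<integral>\<^sup>+x. ennreal (D x) * ennreal (r x) \<partial>P)"
    unfolding QD by (rule nn_integral_density) (use D r in auto)
  also have "\<dots> \<le> (\<integral>\<^sup>+x. ennreal (exp (g x) / Z) \<partial>P)"
    by (rule nn_integral_mono) (use D Z in \<open>auto simp: r_def ennreal_mult'[symmetric] field_simps intro!: ennreal_leI\<close>)
  also have "\<dots> = ennreal (\<integral>x. exp (g x) / Z \<partial>P)"
    by (rule nn_integral_eq_integral) (use iexp Z in auto)
  also have "\<dots> = 1" using Z by (simp add: Z_def[symmetric])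
  finally have nn: "(\<integral>\<^sup>+x. ennreal (r x) \<partial>Q) \<le> 1" .
  then have ir: "integrable Q r"
    using r by (intro integrableI_nonneg) (auto simp: order.strict_trans1[OF _ ennreal_one_less_top])
  have r1: "(\<integral>x. r x \<partial>Q) \<le> 1"
    using nn r by (simp add: nn_integral_eq_integral[OF ir])
  have pos: "AE x in Q. 0 < D x"
    unfolding QD using D by (subst AE_density) (auto simp: less_le)
  have "(\<integral>x. g x - ln (D x) - ln Z \<partial>Q) \<le> (\<integral>x. r x - 1 \<partial>Q)"
  proof (rule integral_mono_AE)
    show "AE x in Q. g x - ln (D x) - ln Z \<le> r x - 1"
      using pos
    proof eventually_elim
      case (elim x)
      have "1 + (g x - ln (D x) - ln Z) \<le> exp (g x - ln (D x) - ln Z)" by (rule exp_ge_add_one_self)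
      also have "\<dots> = r x" using elim Z by (simp add: r_def exp_diff)
      finally show ?case by simp
    qed
  qed (use ig int ir in auto)
  also have "\<dots> \<le> 0" using r1 ir by (simp add: Q.prob_space)
  finally have "(\<integral>x. g x - ln (D x) - ln Z \<partial>Q) \<le> 0" .
  moreover have "(\<integral>x. g x - ln (D x) - ln Z \<partial>Q) = (\<integral>x. g x \<partial>Q) - (\<integral>x. ln (D x) \<partial>Q) - ln Z"
    using ig int by (simp add: Q.prob_space)
  ultimately show ?thesis by (simp add: Z_def)
qed

text \<open>The negative part of the logarithm is harmless because
  \<open>h * (- ln h) \<le> 1 - h\<close> wherever \<open>h\<close> is positive. The difference in
  the definition of the entropy is therefore never of the form infinity minus infinity, and the
  statement covers finite and infinite entropy alike.\<close>

lemma rel_entropy_density_nn: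
  assumes "lam0 \<in> prob_measures" "lam \<in> prob_measures" "absolutely_continuous lam0 lam"
  obtains h where "h \<in> borel_measurable borel" "\<And>x. 0 \<le> h x" "lam = density lam0 (\<lambda>x. ennreal (h x))"
    "rel_entropy lam lam0 = enn2ereal (\<integral>\<^sup>+x. ennreal (ln (h x)) \<partial>lam) - enn2ereal (\<integral>\<^sup>+x. ennreal (- ln (h x)) \<partial>lam)"
    "(\<integral>\<^sup>+x. ennreal (- ln (h x)) \<partial>lam) \<le> 1"
proof -
  interpret p0: prob_space lam0 by (rule prob_measuresD[OF assms(1)])
  interpret p1: prob_space lam by (rule prob_measuresD[OF assms(2)])
  note sets0 = prob_measuresD(1)[OF assms(1)] and sets1 = prob_measuresD(1)[OF assms(2)]
  have sets: "sets lam = sets lam0" by (simp add: sets0 sets1)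
  define h where "h x = enn2real (RN_deriv lam0 lam x)" for x
  have h0: "h \<in> borel_measurable lam0" unfolding h_def by measurable
  then have h: "h \<in> borel_measurable borel" using sets0 by (simp cong: measurable_cong_sets)
  have "AE x in lam0. RN_deriv lam0 lam x \<noteq> \<infinity>"
    by (rule p0.RN_deriv_finite[OF _ assms(3) sets]) (rule p1.sigma_finite_measure_axioms)
  then have "density lam0 (\<lambda>x. ennreal (h x)) = density lam0 (RN_deriv lam0 lam)"
    using h0 by (intro density_cong) (auto simp: h_def less_top)
  also have "\<dots> = lam" by (rule p0.density_RN_deriv[OF assms(3) sets])
  finally have dens: "lam = density lam0 (\<lambda>x. ennreal (h x))" by simp
  have "(\<integral>\<^sup>+x. ennreal (- ln (h x)) \<partial>lam) = (\<integral>\<^sup>+x. ennreal (h x) * ennreal (- ln (h x)) \<partial>lam0)"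
    by (subst dens, rule nn_integral_density) (use h0 in auto)
  also have "\<dots> \<le> (\<integral>\<^sup>+x. 1 \<partial>lam0)"
  proof (rule nn_integral_mono)
    fix x
    have hx: "0 \<le> h x" by (simp add: h_def)
    have "h x * (- ln (h x)) \<le> 1"
    proof (cases "h x = 0")
      case False
      then have "ln (1 / h x) \<le> 1 / h x - 1" using hx by (intro ln_le_minus_one) auto
      then have "- ln (h x) \<le> 1 / h x - 1" using False hx by (simp add: ln_div)
      then have "h x * (- ln (h x)) \<le> h x * (1 / h x - 1)" using hx by (intro mult_left_mono) auto
      also have "\<dots> = 1 - h x" using False by (simp add: algebra_simps)
      finally show ?thesis using hx by simp
    qed simp
    then show "ennreal (h x) * ennreal (- ln (h x)) \<le> 1"
      using hx by (simp add: ennreal_mult'[symmetric])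
  qed
  also have "\<dots> = 1" by (simp add: p0.emeasure_space_1)
  finally have "(\<integral>\<^sup>+x. ennreal (- ln (h x)) \<partial>lam) \<le> 1" .
  then show thesis
    using that[OF h _ dens] assms(3) sets by (simp add: rel_entropy_def h_def)
qed

text \<open>With the negative part bounded, finite entropy forces a finite positive part, so the
  logarithm is integrable and the split difference is an ordinary integral.\<close>

lemma rel_entropy_finite_density:
  assumes "lam0 \<in> prob_measures" "lam \<in> prob_measures" "rel_entropy lam lam0 \<noteq> \<infinity>"
  obtains h where "h \<in> borel_measurable borel" "\<And>x. 0 \<le> h x" "lam = density lam0 (\<lambda>x. ennreal (h x))"
    "integrable lam (\<lambda>x. ln (h x))" "rel_entropy lam lam0 = ereal (\<integral>x. ln (h x) \<partial>lam)"
proof -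
  have ac: "absolutely_continuous lam0 lam"
    using assms(3) by (auto simp: rel_entropy_def split: if_splits)
  obtain h where h: "h \<in> borel_measurable borel" "\<And>x. 0 \<le> h x" "lam = density lam0 (\<lambda>x. ennreal (h x))"
    "rel_entropy lam lam0 = enn2ereal (\<integral>\<^sup>+x. ennreal (ln (h x)) \<partial>lam) - enn2ereal (\<integral>\<^sup>+x. ennreal (- ln (h x)) \<partial>lam)"
    "(\<integral>\<^sup>+x. ennreal (- ln (h x)) \<partial>lam) \<le> 1"
    using rel_entropy_density_nn[OF assms(1,2) ac] by blast
  obtain a where a: "(\<integral>\<^sup>+x. ennreal (- ln (h x)) \<partial>lam) = ennreal a" "0 \<le> a"
    using h(5) by (cases "\<integral>\<^sup>+x. ennreal (- ln (h x)) \<partial>lam" rule: ennreal_cases) (auto simp: top_unique)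
  obtain b where b: "(\<integral>\<^sup>+x. ennreal (ln (h x)) \<partial>lam) = ennreal b" "0 \<le> b"
    using h(4) assms(3) a by (cases "\<integral>\<^sup>+x. ennreal (ln (h x)) \<partial>lam" rule: ennreal_cases) auto
  have "h \<in> borel_measurable lam" by (rule measurable_prob_measures[OF assms(2) h(1)])
  then have int: "integrable lam (\<lambda>x. ln (h x))"
    by (auto simp: real_integrable_def a b)
  have "(\<integral>x. ln (h x) \<partial>lam) = b - a"
    using real_lebesgue_integral_def[OF int] a b by simp
  then have "rel_entropy lam lam0 = ereal (\<integral>x. ln (h x) \<partial>lam)"
    using h(4) a b by simp
  then show thesis using that[OF h(1-3) int] by blast
qed

text \<open>The easy half of the Donsker-Varadhan formula. Its measurable test functions are needed
  for indicators of complements of compact sets.\<close>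

lemma rel_entropy_ge:
  assumes "lam0 \<in> prob_measures" "lam \<in> prob_measures" "g \<in> borel_measurable borel" "\<And>x. \<bar>g x\<bar> \<le> B"
  shows "ereal ((\<integral>x. g x \<partial>lam) - ln (\<integral>x. exp (g x) \<partial>lam0)) \<le> rel_entropy lam lam0"
proof (cases "rel_entropy lam lam0 = \<infinity>")
  case False
  obtain h where h: "h \<in> borel_measurable borel" "\<And>x. 0 \<le> h x" "lam = density lam0 (\<lambda>x. ennreal (h x))"
    "integrable lam (\<lambda>x. ln (h x))" "rel_entropy lam lam0 = ereal (\<integral>x. ln (h x) \<partial>lam)"
    using rel_entropy_finite_density[OF assms(1,2) False] by blast
  have "(\<integral>x. g x \<partial>lam) - ln (\<integral>x. exp (g x) \<partial>lam0) \<le> (\<integral>x. ln (h x) \<partial>lam)"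
  proof (rule gibbs_variational[OF prob_measuresD(2)[OF assms(1)] prob_measuresD(2)[OF assms(2)] _ h(2,3,4) _ assms(4)])
    show "h \<in> borel_measurable lam0" "g \<in> borel_measurable lam0"
      by (rule measurable_prob_measures[OF assms(1)], fact)+
  qed
  then show ?thesis by (simp add: h(5))
qed simp

text \<open>The hard half of the Donsker-Varadhan formula. Without absolute continuity, a large
  multiple of the indicator of a \<open>lam0\<close>-null set with positive \<open>lam\<close>-mass
  has arbitrarily large value. Otherwise the optimal test function \<open>ln h\<close> is truncated
  at levels \<open>-k\<close> and \<open>k\<close>: the upper truncation loses little by monotone
  convergence, and the lower one adds at most \<open>exp (- k)\<close> to the normalising
  integral.\<close>

lemma rel_entropy_witness_measurable:
  assumes l0: "lam0 \<in> prob_measures" and l: "lam \<in> prob_measures" and c: "ereal c < rel_entropy lam lam0"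
  obtains g B where "g \<in> borel_measurable borel" "0 < B" "\<And>x. \<bar>g x\<bar> \<le> B"
    "c < (\<integral>x. g x \<partial>lam) - ln (\<integral>x. exp (g x) \<partial>lam0)"
proof -
  interpret p0: prob_space lam0 by (rule prob_measuresD[OF l0])
  interpret p1: prob_space lam by (rule prob_measuresD[OF l])
  note sets0 = prob_measuresD(1)[OF l0] and sets1 = prob_measuresD(1)[OF l]
  show thesis
  proof (cases "absolutely_continuous lam0 lam")
    case False
    then obtain A where A: "A \<in> sets borel" "emeasure lam0 A = 0" "emeasure lam A \<noteq> 0"
      using sets0 sets1 by (auto simp: absolutely_continuous_def null_sets_def)
    then have pos: "0 < measure lam A"
      by (simp add: p1.emeasure_eq_measure zero_less_measure_iff)
    \<comment> \<open>A factor \<open>t\<close> for which \<open>t * measure lam A\<close> exceeds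
      the absolute value of \<open>c\<close>.\<close>
    obtain t0 where "\<bar>c\<bar> / measure lam A < real t0" using reals_Archimedean2 by blast
    define t where "t = real (Suc t0)"
    have t: "0 < t" "\<bar>c\<bar> / measure lam A < t" using \<open>_ < real t0\<close> by (auto simp: t_def)
    define g where "g x = t * indicator A x" for x
    have "AE x in lam0. x \<notin> A" using A sets0 by (intro AE_not_in) (auto simp: null_sets_def)
    then have "AE x in lam0. exp (g x) = 1" by eventually_elim (simp add: g_def)
    moreover have "g \<in> borel_measurable lam0" unfolding g_def using A sets0 by measurable
    ultimately have "(\<integral>x. exp (g x) \<partial>lam0) = (\<integral>x. 1 \<partial>lam0)" by (intro integral_cong_AE) auto
    then have "ln (\<integral>x. exp (g x) \<partial>lam0) = 0" by (simp add: p0.prob_space)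
    moreover have "(\<integral>x. g x \<partial>lam) = t * measure lam A" using A sets1 by (simp add: g_def)
    moreover have "c < t * measure lam A" using t pos by (simp add: field_simps abs_if split: if_splits)
    ultimately show thesis
      using that[of g t] A t by (auto simp: g_def[abs_def] indicator_def)
  next
    case True
    obtain h where h: "h \<in> borel_measurable borel" "\<And>x. 0 \<le> h x" "lam = density lam0 (\<lambda>x. ennreal (h x))"
      "rel_entropy lam lam0 = enn2ereal (\<integral>\<^sup>+x. ennreal (ln (h x)) \<partial>lam) - enn2ereal (\<integral>\<^sup>+x. ennreal (- ln (h x)) \<partial>lam)"
      "(\<integral>\<^sup>+x. ennreal (- ln (h x)) \<partial>lam) \<le> 1"
      using rel_entropy_density_nn[OF l0 l True] by blast
    have h1[measurable]: "h \<in> borel_measurable lam" by (rule measurable_prob_measures[OF l h(1)])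
    have h0[measurable]: "h \<in> borel_measurable lam0" by (rule measurable_prob_measures[OF l0 h(1)])
    note [measurable] = h(1)
    obtain a where a: "(\<integral>\<^sup>+x. ennreal (- ln (h x)) \<partial>lam) = ennreal a" "0 \<le> a"
      using h(5) by (cases "\<integral>\<^sup>+x. ennreal (- ln (h x)) \<partial>lam" rule: ennreal_cases) (auto simp: top_unique)
    \<comment> \<open>The gap between \<open>c\<close> and \<open>c'\<close> absorbs the error
      \<open>exp (- k)\<close> of the normalising integral.\<close>
    obtain c' where c': "c < c'" "ereal c' < rel_entropy lam lam0"
      using ereal_dense2[OF c] by (metis ereal_dense2 c ereal_less_eq(3) less_ereal.simps(1))
    define I where "I k = (\<integral>\<^sup>+x. ennreal (min (real k) (max 0 (ln (h x)))) \<partial>lam)" for k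
    have Imono: "I k \<le> I k'" if "k \<le> k'" for k k'
      unfolding I_def using that by (intro nn_integral_mono ennreal_leI) auto
    have "(\<integral>\<^sup>+x. ennreal (ln (h x)) \<partial>lam) = (\<integral>\<^sup>+x. (SUP k. ennreal (min (real k) (max 0 (ln (h x))))) \<partial>lam)"
    proof (rule nn_integral_cong)
      fix x
      obtain K where K: "max 0 (ln (h x)) \<le> real K" using real_arch_simple by blast
      show "ennreal (ln (h x)) = (SUP k. ennreal (min (real k) (max 0 (ln (h x)))))"
      proof (rule antisym)
        have "ennreal (ln (h x)) \<le> ennreal (min (real K) (max 0 (ln (h x))))"
          using K by (simp add: min_absorb2 ennreal_leI)
        then show "ennreal (ln (h x)) \<le> (SUP k. ennreal (min (real k) (max 0 (ln (h x)))))"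
          by (rule SUP_upper2[rotated]) simp
        have "ennreal (min (real k) (max 0 (ln (h x)))) \<le> ennreal (ln (h x))" for k
        proof -
          have "ennreal (min (real k) (max 0 (ln (h x)))) \<le> ennreal (max 0 (ln (h x)))" by (rule ennreal_leI) simp
          then show ?thesis by (simp add: max_def ennreal_neg split: if_splits)
        qed
        then show "(SUP k. ennreal (min (real k) (max 0 (ln (h x))))) \<le> ennreal (ln (h x))"
          by (rule SUP_least)
      qed
    qed
    also have "\<dots> = (SUP k. I k)"
      unfolding I_def by (rule nn_integral_monotone_convergence_SUP)
        (auto simp: incseq_def le_fun_def intro!: ennreal_leI)
    finally have Ipos: "(\<integral>\<^sup>+x. ennreal (ln (h x)) \<partial>lam) = (SUP k. I k)" .
    have big: "ereal (c' + a) < enn2ereal (SUP k. I k)"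
      unfolding Ipos[symmetric]
      using c'(2) h(4) a by (cases "\<integral>\<^sup>+x. ennreal (ln (h x)) \<partial>lam" rule: ennreal_cases) auto
    \<comment> \<open>The coercion to \<open>ennreal\<close> sends negative reals to 0, so a
      negative threshold is treated apart.\<close>
    have "\<exists>k. ereal (c' + a) < enn2ereal (I k)"
    proof (cases "c' + a < 0")
      case True
      have "ereal (c' + a) < 0" using True by simp
      also have "0 \<le> enn2ereal (I 0)" by simp
      finally show ?thesis ..
    next
      case False
      then have "ennreal (c' + a) < (SUP k. I k)"
        using big by (simp add: less_ennreal.rep_eq enn2ereal_ennreal)
      then obtain k where "ennreal (c' + a) < I k" by (auto simp: less_SUP_iff)
      then show ?thesis using False by (auto simp: less_ennreal.rep_eq enn2ereal_ennreal)
    qed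
    then obtain k0 where k0: "ereal (c' + a) < enn2ereal (I k0)" ..
    obtain k1 where k1: "1 / (c' - c) < real k1" using reals_Archimedean2 by blast
    \<comment> \<open>Level \<open>k0\<close> suffices for the positive part, level
      \<open>k1\<close> for \<open>exp (- k) < c' - c\<close>; the successor makes the bound
      positive.\<close>
    define k where "k = Suc (max k0 k1)"
    have "I k0 \<le> I k" by (rule Imono) (simp add: k_def)
    then have Ik: "ereal (c' + a) < enn2ereal (I k)" using k0 by (simp add: less_eq_ennreal.rep_eq)
    have kpos: "0 < real k" by (simp add: k_def)
    have ek: "exp (- real k) < c' - c"
    proof -
      have "1 / (c' - c) < real k" using k1 by (simp add: k_def)
      also have "real k \<le> exp (real k)" using exp_ge_add_one_self[of "real k"] by linarith
      finally show ?thesis using c'(1) by (simp add: exp_minus field_simps)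
    qed
    define u where "u x = min (real k) (max 0 (ln (h x)))" for x
    have um: "u \<in> borel_measurable lam" unfolding u_def by measurable
    have iu: "integrable lam u"
      by (rule p1.integrable_const_bound[where B = "real k"]) (use um in \<open>auto simp: u_def\<close>)
    have "I k = ennreal (\<integral>x. u x \<partial>lam)"
      unfolding I_def u_def[symmetric] by (rule nn_integral_eq_integral[OF iu]) (auto simp: u_def)
    then have u_int: "c' + a < (\<integral>x. u x \<partial>lam)"
      using Ik integral_nonneg_AE[of u lam] by (simp add: enn2ereal_ennreal u_def)
    define v where "v x = max 0 (- ln (h x))" for x
    have v_nn: "(\<integral>\<^sup>+x. ennreal (v x) \<partial>lam) = ennreal a"
      unfolding a(1)[symmetric] v_def by (rule nn_integral_cong) (auto simp: max_def ennreal_neg)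
    have vm: "v \<in> borel_measurable lam" unfolding v_def by measurable
    have iv: "integrable lam v"
      by (rule integrableI_nonneg) (use vm v_nn in \<open>auto simp: v_def\<close>)
    have v_int: "(\<integral>x. v x \<partial>lam) = a"
    proof -
      have "0 \<le> v x" for x by (simp add: v_def)
      then have "(\<integral>\<^sup>+x. ennreal (v x) \<partial>lam) = ennreal (\<integral>x. v x \<partial>lam)" "0 \<le> (\<integral>x. v x \<partial>lam)"
        using nn_integral_eq_integral[OF iv] by auto
      then show ?thesis using v_nn a(2) by simp
    qed
    \<comment> \<open>\<open>ln 0\<close> is a default value rather than minus infinity, so the
      zeros of \<open>h\<close> get the lower truncation level explicitly.\<close>
    define g where "g x = (if h x = 0 then - real k else max (- real k) (min (real k) (ln (h x))))" for x
    have g: "g \<in> borel_measurable borel" unfolding g_def by measurable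
    have gb: "\<bar>g x\<bar> \<le> real k" for x by (auto simp: g_def)
    have "c' < (\<integral>x. u x \<partial>lam) - (\<integral>x. v x \<partial>lam)" using u_int v_int by simp
    also have "\<dots> = (\<integral>x. u x - v x \<partial>lam)" using iu iv by simp
    \<comment> \<open>The negative part \<open>v\<close> is not truncated, and truncating from below
      can only raise the test function.\<close>
    also have "\<dots> \<le> (\<integral>x. g x \<partial>lam)"
    proof (rule integral_mono_AE)
      have "AE x in lam. 0 < h x" using h(2) h0 by (subst h(3), subst AE_density) (auto simp: less_le)
      then show "AE x in lam. u x - v x \<le> g x"
        by eventually_elim (auto simp: u_def v_def g_def)
      show "integrable lam g" by (rule integrable_bounded_measurable[OF l g gb])
    qed (use iu iv in auto)
    finally have lower: "c' < (\<integral>x. g x \<partial>lam)" .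
    have "(\<integral>\<^sup>+x. ennreal (h x) \<partial>lam0) = emeasure lam (space lam0)"
      by (subst h(3)) (simp add: emeasure_density)
    also have "\<dots> = 1" using p1.emeasure_space_1 prob_measuresD(3)[OF l0] prob_measuresD(3)[OF l] by simp
    finally have hnn: "(\<integral>\<^sup>+x. ennreal (h x) \<partial>lam0) = 1" .
    have ih: "integrable lam0 h" by (rule integrableI_nonneg) (use hnn h(2) in auto)
    have hint: "(\<integral>x. h x \<partial>lam0) = 1"
      using hnn nn_integral_eq_integral[OF ih] h(2) by (simp add: ennreal_eq_1)
    have ieg: "integrable lam0 (\<lambda>x. exp (g x))" by (rule integrable_exp_bounded[OF l0 g gb])
    have "(\<integral>x. exp (g x) \<partial>lam0) \<le> (\<integral>x. h x + exp (- real k) \<partial>lam0)"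
    proof (rule integral_mono[OF ieg])
      fix x show "exp (g x) \<le> h x + exp (- real k)"
      proof (cases "h x = 0 \<or> ln (h x) \<le> - real k")
        case True
        then have "g x = - real k" by (auto simp: g_def)
        then show ?thesis using h(2)[of x] by simp
      next
        case False
        then have "0 < h x" using h(2)[of x] by (auto simp: less_le)
        moreover have "g x \<le> ln (h x)" using False by (auto simp: g_def)
        ultimately have "exp (g x) \<le> h x" by (metis exp_le_cancel_iff exp_ln)
        then show ?thesis using exp_ge_zero[of "- real k"] by linarith
      qed
    qed (use ih in auto)
    also have "\<dots> = 1 + exp (- real k)" using ih hint by (simp add: p0.prob_space)
    finally have Z: "(\<integral>x. exp (g x) \<partial>lam0) \<le> 1 + exp (- real k)" .
    have "0 < (\<integral>x. exp (g x) \<partial>lam0)" by (rule integral_exp_pos[OF l0 g gb])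
    then have "ln (\<integral>x. exp (g x) \<partial>lam0) \<le> exp (- real k)"
      using Z ln_le_minus_one[of "\<integral>x. exp (g x) \<partial>lam0"] by linarith
    then have "c < (\<integral>x. g x \<partial>lam) - ln (\<integral>x. exp (g x) \<partial>lam0)" using lower ek by linarith
    then show thesis using that[OF g kpos gb] by blast
  qed
qed

text \<open>Continuous approximations with the same bound \<open>B\<close> converge to the
  measurable witness in mean under both measures. On \<open>[-B, B]\<close> the exponential is
  Lipschitz with constant \<open>exp B\<close>, so the exponential moments converge too, and the
  strict inequality passes to a late approximation.\<close>

lemma rel_entropy_witness:
  fixes lam :: "'a::metric_space measure"
  assumes l0: "lam0 \<in> prob_measures" and l: "lam \<in> prob_measures" and c: "ereal c < rel_entropy lam lam0"
  obtains f where "bcont f" "c < (\<integral>x. f x \<partial>lam) - ln (\<integral>x. exp (f x) \<partial>lam0)"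
proof -
  obtain g B where g: "g \<in> borel_measurable borel" "0 < B" "\<And>x. \<bar>g x\<bar> \<le> B"
    "c < (\<integral>x. g x \<partial>lam) - ln (\<integral>x. exp (g x) \<partial>lam0)"
    using rel_entropy_witness_measurable[OF assms] by blast
  have "\<forall>n. \<exists>f. bcont f \<and> (\<forall>x. \<bar>f x\<bar> \<le> B) \<and> l1_err lam lam0 f g < 1 / real (Suc n)"
    using approx_measurable[OF l l0 g(1-3)] by simp
  then obtain f where f: "\<And>n. bcont (f n)" "\<And>n x. \<bar>f n x\<bar> \<le> B" "\<And>n. l1_err lam lam0 (f n) g < 1 / real (Suc n)"
    by metis
  note null = LIMSEQ_inverse_real_of_nat[unfolded inverse_eq_divide]
  have err: "integrable p (\<lambda>x. \<bar>f n x - g x\<bar>)" if "p \<in> prob_measures" for p n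
    by (rule integrable_abs_diff[OF that, where B = B and D = B]) (use f g in \<open>auto simp: bcont_measurable\<close>)
  have e1: "(\<integral>x. \<bar>f n x - g x\<bar> \<partial>lam) < 1 / real (Suc n)" "(\<integral>x. \<bar>f n x - g x\<bar> \<partial>lam0) < 1 / real (Suc n)" for n
  proof -
    have "0 \<le> (\<integral>x. \<bar>f n x - g x\<bar> \<partial>lam)" "0 \<le> (\<integral>x. \<bar>f n x - g x\<bar> \<partial>lam0)" by auto
    then show "(\<integral>x. \<bar>f n x - g x\<bar> \<partial>lam) < 1 / real (Suc n)" "(\<integral>x. \<bar>f n x - g x\<bar> \<partial>lam0) < 1 / real (Suc n)"
      using f(3)[of n] unfolding l1_err_def by linarith+
  qed
  have lim1: "(\<lambda>n. \<integral>x. f n x \<partial>lam) \<longlonglongrightarrow> (\<integral>x. g x \<partial>lam)"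
  proof (rule LIM_zero_cancel, rule Lim_null_comparison[OF _ null], rule always_eventually, rule allI)
    fix n
    have "norm ((\<integral>x. f n x \<partial>lam) - (\<integral>x. g x \<partial>lam)) = \<bar>\<integral>x. f n x - g x \<partial>lam\<bar>"
      by (subst Bochner_Integration.integral_diff) (auto intro: bcont_integrable l f integrable_bounded_measurable g)
    also have "\<dots> \<le> (\<integral>x. \<bar>f n x - g x\<bar> \<partial>lam)" by (rule integral_abs_bound)
    finally show "norm ((\<integral>x. f n x \<partial>lam) - (\<integral>x. g x \<partial>lam)) \<le> 1 / real (Suc n)" using e1(1)[of n] by linarith
  qed
  have iexp: "integrable lam0 (\<lambda>x. exp (q x))" if "q \<in> borel_measurable borel" "\<And>x. \<bar>q x\<bar> \<le> B" for q
    by (rule integrable_exp_bounded[OF l0 that])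
  have expl: "exp a - exp b \<le> exp B * \<bar>a - b\<bar>" if "\<bar>a\<bar> \<le> B" "\<bar>b\<bar> \<le> B" for a b
  proof -
    have "1 + (b - a) \<le> exp (b - a)" by (rule exp_ge_add_one_self)
    then have "exp a * (1 + (b - a)) \<le> exp a * exp (b - a)" by (intro mult_left_mono) auto
    then have "exp a - exp b \<le> exp a * (a - b)" by (simp add: algebra_simps flip: exp_add)
    also have "\<dots> \<le> exp a * \<bar>a - b\<bar>" by (intro mult_left_mono) auto
    also have "\<dots> \<le> exp B * \<bar>a - b\<bar>" using that by (intro mult_right_mono) auto
    finally show ?thesis .
  qed
  have null': "(\<lambda>n. exp B * (1 / real (Suc n))) \<longlonglongrightarrow> 0" using tendsto_mult_right_zero[OF null] by simp
  have lim2: "(\<lambda>n. \<integral>x. exp (f n x) \<partial>lam0) \<longlonglongrightarrow> (\<integral>x. exp (g x) \<partial>lam0)"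
  proof (rule LIM_zero_cancel, rule Lim_null_comparison[OF _ null'], rule always_eventually, rule allI)
    fix n
    have "norm ((\<integral>x. exp (f n x) \<partial>lam0) - (\<integral>x. exp (g x) \<partial>lam0)) = \<bar>\<integral>x. exp (f n x) - exp (g x) \<partial>lam0\<bar>"
      by (subst Bochner_Integration.integral_diff) (auto intro: iexp f bcont_measurable g)
    also have "\<dots> \<le> (\<integral>x. \<bar>exp (f n x) - exp (g x)\<bar> \<partial>lam0)" by (rule integral_abs_bound)
    also have "\<dots> \<le> (\<integral>x. exp B * \<bar>f n x - g x\<bar> \<partial>lam0)"
    proof (rule integral_mono)
      show "integrable lam0 (\<lambda>x. \<bar>exp (f n x) - exp (g x)\<bar>)"
        by (intro integrable_abs Bochner_Integration.integrable_diff iexp f bcont_measurable g)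
      show "integrable lam0 (\<lambda>x. exp B * \<bar>f n x - g x\<bar>)" using err[OF l0] by simp
      show "\<bar>exp (f n x) - exp (g x)\<bar> \<le> exp B * \<bar>f n x - g x\<bar>" for x
        using expl[of "f n x" "g x"] expl[of "g x" "f n x"] f(2)[of n x] g(3)[of x]
        by (simp add: abs_le_iff abs_minus_commute)
    qed
    also have "\<dots> \<le> exp B * (1 / real (Suc n))"
      using e1(2)[of n] by (simp only: integral_mult_right_zero) (intro mult_left_mono, auto)
    finally show "norm ((\<integral>x. exp (f n x) \<partial>lam0) - (\<integral>x. exp (g x) \<partial>lam0)) \<le> exp B * (1 / real (Suc n))" .
  qed
  have Zpos: "(\<integral>x. exp (g x) \<partial>lam0) \<noteq> 0" using integral_exp_pos[OF l0 g(1,3)] by simp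
  have "(\<lambda>n. (\<integral>x. f n x \<partial>lam) - ln (\<integral>x. exp (f n x) \<partial>lam0)) \<longlonglongrightarrow> (\<integral>x. g x \<partial>lam) - ln (\<integral>x. exp (g x) \<partial>lam0)"
    by (intro tendsto_diff lim1 tendsto_ln lim2 Zpos)
  then have "eventually (\<lambda>n. c < (\<integral>x. f n x \<partial>lam) - ln (\<integral>x. exp (f n x) \<partial>lam0)) sequentially"
    by (rule order_tendstoD(1)[OF _ g(4)])
  then show thesis using that f(1) by (auto simp: eventually_sequentially)
qed

subsection \<open>Empirical measures and Cournot-Nash equilibria\<close>

lemma integral_pos_iff:
  assumes "m \<in> prob_measures" "bcont f" "\<And>x. 0 \<le> f x"
  shows "0 < (\<integral>x. f x \<partial>m) \<longleftrightarrow> \<not> (AE x in m. f x = 0)"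
proof -
  have "(\<integral>x. f x \<partial>m) = 0 \<longleftrightarrow> (AE x in m. f x = 0)"
    by (rule integral_nonneg_eq_0_iff_AE[OF bcont_integrable[OF assms(1,2)]]) (use assms(3) in auto)
  moreover have "0 \<le> (\<integral>x. f x \<partial>m)" using assms(3) by simp
  ultimately show ?thesis by linarith
qed

lemma openin_weak_ball:
  assumes "finite S" "\<And>g. g \<in> S \<Longrightarrow> bcont g"
  shows "openin weak_top {k \<in> prob_measures. \<forall>g\<in>S. \<bar>(\<integral>x. g x \<partial>k) - a g\<bar> < d}"
  using assms
proof (induction S rule: finite_induct)
  case empty
  have "openin weak_top (topspace weak_top)" by (rule openin_topspace)
  then show ?case by (simp add: topspace_weak_top)
next
  case (insert g S)
  have "openin weak_top ({k \<in> prob_measures. (\<integral>x. g x \<partial>k) \<in> ball (a g) d} \<inter>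
    {k \<in> prob_measures. \<forall>g\<in>S. \<bar>(\<integral>x. g x \<partial>k) - a g\<bar> < d})"
    by (intro openin_Int weak_top_subbasis insert.IH) (use insert.prems in auto)
  also have "{k \<in> prob_measures. (\<integral>x. g x \<partial>k) \<in> ball (a g) d} \<inter>
    {k \<in> prob_measures. \<forall>g\<in>S. \<bar>(\<integral>x. g x \<partial>k) - a g\<bar> < d}
    = {k \<in> prob_measures. \<forall>g\<in>insert g S. \<bar>(\<integral>x. g x \<partial>k) - a g\<bar> < d}"
    by (auto simp: dist_real_def abs_minus_commute)
  finally show ?case .
qed

text \<open>Ulam's theorem, from inner regularity by compact sets on a Polish space.\<close>

lemma prob_tight:
  fixes lam :: "'w::polish_space measure"
  assumes "lam \<in> prob_measures" "0 < e"
  obtains K where "compact K" "measure lam (- K) < e"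
proof -
  interpret prob_space lam by (rule prob_measuresD[OF assms(1)])
  note sets = prob_measuresD(1)[OF assms(1)] and space = prob_measuresD(3)[OF assms(1)]
  have "emeasure lam UNIV = (SUP K \<in> {K. K \<subseteq> UNIV \<and> compact K}. emeasure lam K)"
    by (rule inner_regular) (auto simp: sets)
  then have "(SUP K \<in> {K. compact K}. emeasure lam K) = 1" using emeasure_space_1 space by simp
  moreover have "ennreal (1 - e) < 1" using assms(2) by (simp add: ennreal_less_one_iff)
  ultimately obtain K where K: "compact K" "ennreal (1 - e) < emeasure lam K"
    by (metis (mono_tags, lifting) less_SUP_iff mem_Collect_eq)
  then have "1 - e < measure lam K"
    unfolding emeasure_eq_measure by (meson ennreal_leI not_le)
  moreover have "measure lam (- K) = 1 - measure lam K"
    using prob_compl[of K] K(1) by (simp add: sets space Compl_eq_Diff_UNIV borel_compact)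
  ultimately show thesis using that K(1) by simp
qed

text \<open>\<open>measure_of\<close> yields the intended values only for a countably additive set
  function. The push-forward of the uniform measure on the indices supplies this, together with the
  formula for integrals.\<close>

lemma emp_measure_eq_distr:
  assumes "0 < n" shows "emp_measure n z = distr (uniform_count_measure {..<n}) borel z"
proof -
  let ?D = "distr (uniform_count_measure {..<n}) borel z"
  have z: "z \<in> measurable (uniform_count_measure {..<n}) borel"
    by (simp add: measurable_def sets_uniform_count_measure space_uniform_count_measure)
  have "emp_measure n z = measure_of (space ?D) (sets ?D) (emeasure ?D)"
    unfolding emp_measure_def space_distr sets_distr space_borel
  proof (rule measure_of_eq)
    fix A assume "A \<in> sigma_sets UNIV (sets (borel :: 'a measure))"
    then have A: "A \<in> sets borel" using sets.sigma_sets_eq[of "borel :: 'a measure"] by simp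
    have "emeasure ?D A = emeasure (uniform_count_measure {..<n}) (z -` A \<inter> {..<n})"
      using emeasure_distr[OF z A] by (simp add: space_uniform_count_measure)
    also have "\<dots> = ennreal (real (card (z -` A \<inter> {..<n})) / real n)"
      using assms by (subst emeasure_uniform_count_measure) (auto simp: ennreal_of_nat_eq_real_of_nat divide_ennreal)
    also have "z -` A \<inter> {..<n} = {k. k < n \<and> z k \<in> A}" by auto
    finally show "ennreal (real (card {k. k < n \<and> z k \<in> A}) / real n) = emeasure ?D A" ..
  qed auto
  then show ?thesis by (simp only: measure_of_of_measure)
qed

section \<open>Integration against empirical measures and first marginals\<close>

lemma emp_measure_prob:
  assumes "0 < n" shows "emp_measure n z \<in> prob_measures"
proof -
  have "prob_space (uniform_count_measure {..<n})" using assms by (intro prob_space_uniform_count_measure) auto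
  then show ?thesis
    unfolding prob_measures_def emp_measure_eq_distr[OF assms]
    by (auto intro!: prob_space.prob_space_distr simp: measurable_def sets_uniform_count_measure space_uniform_count_measure)
qed

lemma integral_emp_measure:
  fixes f :: "_ \<Rightarrow> real"
  assumes "0 < n" "f \<in> borel_measurable borel"
  shows "(\<integral>x. f x \<partial>(emp_measure n z)) = (\<Sum>i<n. f (z i)) / real n"
  unfolding emp_measure_eq_distr[OF assms(1)]
  using assms by (subst integral_distr)
    (auto simp: integral_uniform_count_measure measurable_def sets_uniform_count_measure space_uniform_count_measure)

lemma emp_measure_cong:
  assumes "\<And>i. i < n \<Longrightarrow> z i = z' i" shows "emp_measure n z = emp_measure n z'"
proof -
  have "{k. k < n \<and> z k \<in> A} = {k. k < n \<and> z' k \<in> A}" for A using assms by auto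
  then show ?thesis by (simp add: emp_measure_def)
qed

lemma fst_borel_measurable: "fst \<in> borel_measurable (borel :: ('w::topological_space \<times> 'x::topological_space) measure)"
  by (intro borel_measurable_continuous_onI continuous_intros)

lemma fst_measurable_prob:
  assumes "m \<in> prob_measures" shows "fst \<in> measurable m (borel :: 'w::topological_space measure)"
  by (rule measurable_prob_measures[OF assms fst_borel_measurable])

lemma wmarg_prob:
  assumes "m \<in> prob_measures" shows "wmarg m \<in> prob_measures"
  using prob_space.prob_space_distr[OF prob_measuresD(2)[OF assms] fst_measurable_prob[OF assms]]
  by (simp add: prob_measures_def wmarg_def)

lemma integral_wmarg:
  fixes f :: "'w::topological_space \<Rightarrow> real"
  assumes "m \<in> prob_measures" "f \<in> borel_measurable borel"
  shows "(\<integral>x. f x \<partial>wmarg m) = (\<integral>z. f (fst z) \<partial>m)"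
  unfolding wmarg_def by (rule integral_distr[OF fst_measurable_prob[OF assms(1)] assms(2)])

lemma measure_wmarg:
  assumes "m \<in> prob_measures" "A \<in> sets borel"
  shows "measure (wmarg m) A = measure m (A \<times> UNIV)"
proof -
  have "fst -` A \<inter> space m = A \<times> UNIV" using prob_measuresD(3)[OF assms(1)] by auto
  then show ?thesis
    unfolding wmarg_def by (subst measure_distr[OF fst_measurable_prob[OF assms(1)] assms(2)]) simp
qed

text \<open>The type of actions is a bare metric space, so second countability has to be extracted
  from compactness, by finite nets of radius \<open>1 / (n + 1)\<close>.\<close>

lemma compact_countable_basis:
  assumes "compact (UNIV :: 'a::metric_space set)"
  obtains B :: "'a::metric_space set set" where "countable B" "topological_basis B"
proof -
  have "\<forall>n. \<exists>k. finite k \<and> (UNIV :: 'a set) \<subseteq> (\<Union>x\<in>k. ball x (1 / real (Suc n)))"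
    using assms unfolding compact_eq_totally_bounded by simp
  then obtain k :: "nat \<Rightarrow> 'a set" where k: "\<And>n. finite (k n)" "\<And>n. UNIV \<subseteq> (\<Union>x\<in>k n. ball x (1 / real (Suc n)))"
    by metis
  define B where "B = (\<Union>n. (\<lambda>x. ball x (1 / real (Suc n))) ` k n)"
  have "countable B" unfolding B_def by (rule countable_UN) (auto intro: countable_finite k(1))
  moreover have "topological_basis B"
  proof (rule topological_basisI)
    show "\<And>b. b \<in> B \<Longrightarrow> open b" by (auto simp: B_def)
    fix U :: "'a set" and x assume "open U" "x \<in> U"
    then obtain e where e: "0 < e" "ball x e \<subseteq> U" by (auto simp: open_contains_ball)
    obtain n where n: "1 / real (Suc n) < e / 2" using e(1) nat_approx_posE[of "e/2"] by auto
    obtain y where y: "y \<in> k n" "x \<in> ball y (1 / real (Suc n))" using k(2)[of n] by blast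
    have "ball y (1 / real (Suc n)) \<subseteq> ball x e"
    proof
      fix z assume "z \<in> ball y (1 / real (Suc n))"
      then show "z \<in> ball x e" using y(2) n dist_triangle[of x z y] by (simp add: dist_commute)
    qed
    then show "\<exists>b\<in>B. x \<in> b \<and> b \<subseteq> U" using y e(2) unfolding B_def by blast
  qed
  ultimately show thesis using that by blast
qed

section \<open>Best replies and neighbourhoods of non-equilibria\<close>

locale game =
  fixes C :: "'w::polish_space \<Rightarrow> 'x::metric_space set"
    and F :: "('w \<times> 'x) measure \<Rightarrow> 'w \<Rightarrow> 'x \<Rightarrow> real"
  assumes X_compact: "compact (UNIV :: 'x set)"
    and C_nonempty: "C w \<noteq> {}"
    and C_graph_closed: "closed {(w, x). x \<in> C w}"
    and C_lower: "ws \<longlonglongrightarrow> w \<Longrightarrow> x \<in> C w \<Longrightarrow>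
        \<exists>r xs. strict_mono r \<and> (\<forall>k. xs k \<in> C (ws (r k))) \<and> xs \<longlonglongrightarrow> x"
    and F_bounded: "\<exists>B. \<forall>m\<in>prob_measures. \<forall>w x. \<bar>F m w x\<bar> \<le> B"
    and F_cont: "continuous_map (prod_topology weak_top (prod_topology euclidean euclidean))
        euclideanreal (\<lambda>(m, w, x). F m w x)"
begin

lemma F_bdd_below:
  assumes "\<And>y. y \<in> A \<Longrightarrow> m y \<in> prob_measures"
  shows "bdd_below ((\<lambda>y. F (m y) w y) ` A)"
proof -
  obtain B where B: "\<forall>m\<in>prob_measures. \<forall>w x. \<bar>F m w x\<bar> \<le> B" using F_bounded by blast
  have "- B \<le> F (m y) w y" if "y \<in> A" for y
    using B assms[OF that] by (metis abs_le_D2 minus_le_iff)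
  then show ?thesis by (intro bdd_belowI2)
qed

text \<open>Comparisons in place of a real infimum, so that arguments about single deviations carry
  no boundedness conditions; \<open>mem_best_iff\<close> settles these once.\<close>

definition best :: "('w \<times> 'x) measure \<Rightarrow> ('w \<times> 'x) set" where
  "best m = {(w, x). x \<in> C w \<and> (\<forall>y\<in>C w. F m w x \<le> F m w y)}"

lemma mem_best_iff:
  assumes "m \<in> prob_measures"
  shows "z \<in> best m \<longleftrightarrow> snd z \<in> C (fst z) \<and> F m (fst z) (snd z) = (INF y\<in>C (fst z). F m (fst z) y)"
proof -
  have bdd: "bdd_below ((\<lambda>y. F m (fst z) y) ` C (fst z))" by (rule F_bdd_below) (rule assms)
  show ?thesis
  proof
    assume z: "z \<in> best m"
    have "F m (fst z) (snd z) \<le> (INF y\<in>C (fst z). F m (fst z) y)"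
      using z C_nonempty by (intro cINF_greatest) (auto simp: best_def)
    moreover have "(INF y\<in>C (fst z). F m (fst z) y) \<le> F m (fst z) (snd z)"
      using z by (intro cINF_lower bdd) (auto simp: best_def)
    ultimately show "snd z \<in> C (fst z) \<and> F m (fst z) (snd z) = (INF y\<in>C (fst z). F m (fst z) y)"
      using z by (auto simp: best_def)
  next
    assume "snd z \<in> C (fst z) \<and> F m (fst z) (snd z) = (INF y\<in>C (fst z). F m (fst z) y)"
    then show "z \<in> best m" using cINF_lower[OF bdd] by (auto simp: best_def split: prod.splits)
  qed
qed

lemma all_cournot_nash_iff:
  "m \<in> all_cournot_nash F C \<longleftrightarrow> m \<in> prob_measures \<and> (AE z in m. z \<in> best m)"
  unfolding all_cournot_nash_def cournot_nash_def
  using wmarg_prob by (auto simp: mem_best_iff)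

lemma nash_eqD:
  assumes "nash_eq F C n w x" "i < n"
  shows "x i \<in> C (w i)"
    and "y \<in> C (w i) \<Longrightarrow> F (emp_measure n (\<lambda>k. (w k, x k))) (w i) (x i)
      \<le> F (emp_measure n (\<lambda>k. (w k, (x(i := y)) k))) (w i) y"
proof -
  show "x i \<in> C (w i)" using assms by (simp add: nash_eq_def)
  assume y: "y \<in> C (w i)"
  have "F (emp_measure n (\<lambda>k. (w k, x k))) (w i) (x i) =
    (INF y\<in>C (w i). F (emp_measure n (\<lambda>k. (w k, (x(i := y)) k))) (w i) y)"
    using assms by (simp add: nash_eq_def)
  also have "\<dots> \<le> F (emp_measure n (\<lambda>k. (w k, (x(i := y)) k))) (w i) y"
    using assms(2) y by (intro cINF_lower F_bdd_below emp_measure_prob) auto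
  finally show "F (emp_measure n (\<lambda>k. (w k, x k))) (w i) (x i)
      \<le> F (emp_measure n (\<lambda>k. (w k, (x(i := y)) k))) (w i) y" .
qed

text \<open>Sequential lower hemicontinuity in open form. Were the claim false, points
  \<open>v n\<close> within \<open>1 / (n + 1)\<close> of \<open>w\<close> would have
  \<open>C (v n)\<close> disjoint from \<open>Y\<close>, but along a subsequence elements of these
  sets converge to \<open>y\<close>.\<close>

lemma C_lower_open:
  assumes "y \<in> C w" "open Y" "y \<in> Y"
  obtains V where "open V" "w \<in> V" "\<And>v. v \<in> V \<Longrightarrow> C v \<inter> Y \<noteq> {}"
proof (rule ccontr)
  assume "\<not> thesis"
  have "\<exists>v\<in>ball w (1 / real (Suc n)). C v \<inter> Y = {}" for n
  proof (rule ccontr)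
    assume *: "\<not> (\<exists>v\<in>ball w (1 / real (Suc n)). C v \<inter> Y = {})"
    have thesis by (rule that[of "ball w (1 / real (Suc n))"]) (use * in auto)
    with \<open>\<not> thesis\<close> show False ..
  qed
  then obtain v where v: "\<And>n. v n \<in> ball w (1 / real (Suc n))" "\<And>n. C (v n) \<inter> Y = {}" by metis
  have "v \<longlonglongrightarrow> w"
  proof (rule metric_tendsto_imp_tendsto)
    show "(\<lambda>n. 1 / real (Suc n)) \<longlonglongrightarrow> 0"
      by (rule LIMSEQ_inverse_real_of_nat[unfolded inverse_eq_divide])
    show "eventually (\<lambda>n. dist (v n) w \<le> dist (1 / real (Suc n)) 0) sequentially"
      using v(1) by (intro always_eventually) (auto simp: dist_commute less_imp_le)
  qed
  from C_lower[OF this assms(1)] obtain r xs where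
    "\<forall>k. xs k \<in> C (v (r k))" "xs \<longlonglongrightarrow> y" by blast
  moreover from this have "eventually (\<lambda>k. xs k \<in> Y) sequentially"
    using assms(2,3) by (auto dest: topological_tendstoD)
  ultimately show False using v(2) by (auto simp: eventually_sequentially)
qed

text \<open>Rectangles are kept because measurability of types and of actions is known
  separately.\<close>

lemma countable_basis:
  obtains B :: "('w \<times> 'x) set set" where "countable B" "topological_basis B"
    "\<And>b. b \<in> B \<Longrightarrow> \<exists>U V. open U \<and> open V \<and> b = U \<times> V"
proof -
  obtain B1 :: "'w set set" where B1: "countable B1" "topological_basis B1" using ex_countable_basis by blast
  obtain B2 :: "'x set set" where B2: "countable B2" "topological_basis B2"
    using compact_countable_basis[OF X_compact] by blast
  show thesis
  proof (rule that)
    show "countable ((\<lambda>(a, b). a \<times> b) ` (B1 \<times> B2))" using B1 B2 by auto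
    show "topological_basis ((\<lambda>(a, b). a \<times> b) ` (B1 \<times> B2))" by (rule topological_basis_prod[OF B1(2) B2(2)])
    show "\<exists>U V. open U \<and> open V \<and> b = U \<times> V" if "b \<in> (\<lambda>(a, b). a \<times> b) ` (B1 \<times> B2)" for b
      using that topological_basis_open[OF B1(2)] topological_basis_open[OF B2(2)] by blast
  qed
qed

text \<open>By second countability, locally null implies null. Its contrapositive yields a point of
  \<open>I\<close> all of whose neighbourhoods are charged; since \<open>I\<close> need not be
  measurable, it applies directly to the complement of \<open>best m\<close>.\<close>

lemma null_open_union:
  fixes m :: "('w \<times> 'x) measure"
  assumes m: "m \<in> prob_measures"
    and U: "\<And>z. z \<in> I \<Longrightarrow> \<exists>U. open U \<and> z \<in> U \<and> emeasure m U = 0"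
  shows "AE z in m. z \<notin> I"
proof -
  note sets = prob_measuresD(1)[OF m]
  obtain B :: "('w \<times> 'x) set set" where B: "countable B" "topological_basis B" by (rule countable_basis)
  define N where "N = {b \<in> B. emeasure m b = 0}"
  have "emeasure m (\<Union>N) = 0"
  proof -
    have "countable N" using B(1) unfolding N_def by (rule countable_subset[rotated]) auto
    moreover have "\<And>b. b \<in> N \<Longrightarrow> b \<in> null_sets m"
      using topological_basis_open[OF B(2)] by (auto simp: N_def null_sets_def sets)
    ultimately have "(\<Union>b\<in>N. b) \<in> null_sets m" by (rule null_sets_UN')
    then show ?thesis by auto
  qed
  moreover have "\<Union>N \<in> sets m"
    unfolding sets N_def using topological_basis_open[OF B(2)] by (intro borel_open open_Union) auto
  ultimately have "AE z in m. z \<notin> \<Union>N" by (intro AE_not_in) (simp add: null_sets_def)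
  moreover have "I \<subseteq> \<Union>N"
  proof
    fix z assume "z \<in> I"
    then obtain U where U: "open U" "z \<in> U" "emeasure m U = 0" using assms(2) by blast
    obtain b where b: "b \<in> B" "z \<in> b" "b \<subseteq> U" using topological_basisE[OF B(2) U(1,2)] by blast
    have "emeasure m b \<le> emeasure m U" using b U by (intro emeasure_mono) (auto simp: sets)
    then show "z \<in> \<Union>N" using b U(3) by (auto simp: N_def)
  qed
  ultimately show ?thesis by (auto elim!: eventually_mono)
qed

text \<open>Each agent perturbs the integral of a bounded function against the empirical measure by only
  \<open>O(1/n)\<close>, so for large \<open>n\<close> a unilateral deviation stays in the neighbourhood of \<open>m\<close> on which a
  profitable deviation at \<open>m\<close> remains profitable.\<close>

lemma not_cournot_nash_nhd:
  assumes m: "m \<in> prob_measures" "m \<notin> all_cournot_nash F C"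
  obtains U N where "openin weak_top U" "m \<in> U" "U \<inter> all_cournot_nash F C = {}"
    "\<And>n w x. N \<le> n \<Longrightarrow> nash_eq F C n w x \<Longrightarrow> emp_measure n (\<lambda>k. (w k, x k)) \<notin> U"
proof -
  have "\<not> (AE z in m. z \<notin> - best m)" using m by (simp add: all_cournot_nash_iff)
  \<comment> \<open>A point of the support of \<open>m\<close> at which the equilibrium condition
    fails.\<close>
  then obtain z0 where z0: "z0 \<notin> best m" "\<And>U. open U \<Longrightarrow> z0 \<in> U \<Longrightarrow> emeasure m U \<noteq> 0"
    using null_open_union[OF m(1), of "- best m"] by (metis Compl_iff)
  have pos: "0 < (\<integral>x. f x \<partial>m)" if "bcont f" "\<And>x. 0 \<le> f x" "z0 \<in> {x. 0 < f x}" for f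
  proof -
    have o: "open {x. 0 < f x}" using that(1) by (intro open_Collect_less bcont_continuous continuous_intros)
    then have "{x. 0 < f x} \<in> sets m" by (simp add: prob_measuresD(1)[OF m(1)])
    moreover have "{x \<in> space m. \<not> f x = 0} = {x. 0 < f x}"
    proof -
      have "f x \<noteq> 0 \<longleftrightarrow> 0 < f x" for x using that(2)[of x] by linarith
      then show ?thesis by (simp add: prob_measuresD(3)[OF m(1)])
    qed
    ultimately have "(AE x in m. f x = 0) \<longleftrightarrow> emeasure m {x. 0 < f x} = 0" by (rule AE_iff_measurable)
    moreover have "emeasure m {x. 0 < f x} \<noteq> 0" using z0(2)[OF o that(3)] .
    ultimately have "\<not> (AE x in m. f x = 0)" by simp
    then show ?thesis using integral_pos_iff[OF m(1) that(1,2)] by simp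
  qed
  show thesis
  proof (cases "snd z0 \<in> C (fst z0)")
    case False
    \<comment> \<open>An inadmissible \<open>z0\<close>: a bump on the open complement of the graph
      has positive integral under \<open>m\<close> and integral zero under every equilibrium, finite
      or Cournot-Nash.\<close>
    have "open (- {(w, x). x \<in> C w})" using C_graph_closed by (simp add: open_Compl)
    then obtain f where f: "bcont f" "\<And>x. 0 \<le> f x" "\<And>x. f x \<le> 1" "- {(w, x). x \<in> C w} = {x. 0 < f x}"
      by (rule open_bump) blast
    have f0: "f (w, x) = 0" if "x \<in> C w" for w x
    proof -
      have "(w, x) \<notin> {x. 0 < f x}" using that unfolding f(4)[symmetric] by simp
      then show ?thesis using f(2)[of "(w, x)"] by simp
    qed
    have "z0 \<in> {x. 0 < f x}" unfolding f(4)[symmetric] using False by (auto split: prod.splits)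
    note p = pos[OF f(1,2) this]
    show thesis
    proof (rule that)
      show "openin weak_top {k \<in> prob_measures. (\<integral>x. f x \<partial>k) \<in> {0<..}}"
        by (rule weak_top_subbasis[OF f(1)]) simp
      show "m \<in> {k \<in> prob_measures. (\<integral>x. f x \<partial>k) \<in> {0<..}}" using p m by simp
      show "{k \<in> prob_measures. (\<integral>x. f x \<partial>k) \<in> {0<..}} \<inter> all_cournot_nash F C = {}"
      proof -
        have "\<not> 0 < (\<integral>x. f x \<partial>k)" if k: "k \<in> all_cournot_nash F C" for k
        proof -
          have "k \<in> prob_measures" "AE z in k. z \<in> best k" using k by (auto simp: all_cournot_nash_iff)
          moreover from this(2) have "AE z in k. f z = 0"
            by eventually_elim (auto simp: best_def f0)
          ultimately show ?thesis using integral_pos_iff[OF _ f(1,2)] by blast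
        qed
        then show ?thesis by auto
      qed
      fix n w x assume n: "1 \<le> n" and nash: "nash_eq F C n w x"
      have "(\<integral>z. f z \<partial>emp_measure n (\<lambda>k. (w k, x k))) = (\<Sum>i<n. f (w i, x i)) / real n"
        using n by (intro integral_emp_measure bcont_measurable f) auto
      also have "\<dots> = 0" using nash_eqD(1)[OF nash] by (simp add: f0)
      finally show "emp_measure n (\<lambda>k. (w k, x k)) \<notin> {k \<in> prob_measures. (\<integral>x. f x \<partial>k) \<in> {0<..}}" by simp
    qed
  next
    case True
    obtain w0 x0 where z0_eq: "z0 = (w0, x0)" by fastforce
    obtain y0 where y0: "y0 \<in> C w0" "F m w0 y0 < F m w0 x0"
      using z0(1) True by (auto simp: z0_eq best_def not_le)
    \<comment> \<open>A level strictly between the cost of \<open>x0\<close> and that of the better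
      reply \<open>y0\<close>.\<close>
    define c where "c = (F m w0 y0 + F m w0 x0) / 2"
    have c: "F m w0 y0 < c" "c < F m w0 x0" using y0 by (auto simp: c_def)
    let ?T = "prod_topology weak_top (prod_topology euclidean euclidean) :: (('w \<times> 'x) measure \<times> 'w \<times> 'x) topology"
    \<comment> \<open>Joint continuity in box form, used at \<open>x0\<close> for costs above
      \<open>c\<close> and at \<open>y0\<close> for costs below \<open>c\<close>.\<close>
    have nbhd: "\<exists>A V X. openin weak_top A \<and> open V \<and> open X \<and> m \<in> A \<and> w0 \<in> V \<and> x \<in> X \<and>
       (\<forall>k\<in>A. \<forall>w\<in>V. \<forall>y\<in>X. F k w y \<in> R)" if "open R" "F m w0 x \<in> R" for R x
    proof -
      define Q where "Q = {p \<in> topspace ?T. (case p of (m, w, x) \<Rightarrow> F m w x) \<in> R}"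
      have Q: "openin ?T Q"
        unfolding Q_def by (rule openin_continuous_map_preimage[OF F_cont]) (use that in simp)
      have mQ: "(m, w0, x) \<in> Q"
        using that m by (simp add: Q_def topspace_weak_top)
      obtain A Z where A: "openin weak_top A" "openin (prod_topology euclidean euclidean) Z"
        "m \<in> A" "(w0, x) \<in> Z" "A \<times> Z \<subseteq> Q"
        using openin_prod_topology_alt[THEN iffD1, rule_format, OF Q mQ] by (elim exE conjE)
      obtain V X where V: "openin euclidean V" "openin euclidean X" "w0 \<in> V" "x \<in> X" "V \<times> X \<subseteq> Z"
        using openin_prod_topology_alt[THEN iffD1, rule_format, OF A(2,4)] by (elim exE conjE)
      have "F k w y \<in> R" if "k \<in> A" "w \<in> V" "y \<in> X" for k w y
      proof -
        have "(k, w, y) \<in> Q" using A(5) V(5) that by blast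
        then show ?thesis by (simp add: Q_def)
      qed
      then show ?thesis using A(1,3) V(1-4) by (metis open_openin)
    qed
    obtain A1 V1 X1 where 1: "openin weak_top A1" "open V1" "open X1" "m \<in> A1" "w0 \<in> V1" "x0 \<in> X1"
      "\<forall>k\<in>A1. \<forall>w\<in>V1. \<forall>y\<in>X1. F k w y \<in> {c<..}"
      using nbhd[of "{c<..}" x0] c(2) by auto
    obtain A2 V2 X2 where 2: "openin weak_top A2" "open V2" "open X2" "m \<in> A2" "w0 \<in> V2" "y0 \<in> X2"
      "\<forall>k\<in>A2. \<forall>w\<in>V2. \<forall>y\<in>X2. F k w y \<in> {..<c}"
      using nbhd[of "{..<c}" y0] c(1) by auto
    \<comment> \<open>Types near \<open>w0\<close> still have an admissible action near
      \<open>y0\<close>, so the profitable deviation persists.\<close>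
    obtain V3 where 3: "open V3" "w0 \<in> V3" "\<And>v. v \<in> V3 \<Longrightarrow> C v \<inter> X2 \<noteq> {}"
      using C_lower_open[OF y0(1) 2(3,6)] by blast
    have "open ((V1 \<inter> V2 \<inter> V3) \<times> X1)" using 1 2 3 by (intro open_Times open_Int)
    then obtain f where f: "bcont f" "\<And>x. 0 \<le> f x" "\<And>x. f x \<le> 1" "(V1 \<inter> V2 \<inter> V3) \<times> X1 = {x. 0 < f x}"
      by (rule open_bump) blast
    have fpos: "w \<in> V1 \<and> w \<in> V2 \<and> w \<in> V3 \<and> x \<in> X1" if "f (w, x) \<noteq> 0" for w x
    proof -
      have "(w, x) \<in> {x. 0 < f x}" using that f(2)[of "(w, x)"] by simp
      then show ?thesis unfolding f(4)[symmetric] by simp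
    qed
    have "z0 \<in> {x. 0 < f x}" unfolding f(4)[symmetric] z0_eq using 1 2 3 by simp
    note p = pos[OF f(1,2) this]
    have "openin weak_top (A1 \<inter> A2)" "m \<in> A1 \<inter> A2" using 1 2 by auto
    then obtain S d where S: "finite S" "0 < d" "\<And>g. g \<in> S \<Longrightarrow> bcont g"
      "{k \<in> prob_measures. \<forall>g\<in>S. \<bar>(\<integral>x. g x \<partial>k) - (\<integral>x. g x \<partial>m)\<bar> < d} \<subseteq> A1 \<inter> A2"
      by (rule weak_top_nhd) blast
    have "\<exists>D. \<forall>g\<in>S. \<forall>x. \<bar>g x\<bar> \<le> D"
    proof -
      obtain D where D: "\<And>g x. g \<in> S \<Longrightarrow> \<bar>g x\<bar> \<le> D g" using S(3) bcontE by metis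
      have "\<bar>g x\<bar> \<le> Max (insert 0 (D ` S))" if "g \<in> S" for g x
        using that S(1) D[OF that] by (intro order_trans[OF D[OF that] Max_ge]) auto
      then show ?thesis by blast
    qed
    then obtain D where D: "\<And>g x. g \<in> S \<Longrightarrow> \<bar>g x\<bar> \<le> D" by blast
    \<comment> \<open>Moving one of \<open>n\<close> points changes each integral by at most
      \<open>2 * D / n\<close>, which has to be below \<open>d/2\<close>.\<close>
    obtain N0 where N0: "4 * D / d < real N0" using reals_Archimedean2 by blast
    \<comment> \<open>Radius \<open>d/2\<close> reserves the other half for the deviation of one
      agent; the positive integral of \<open>f\<close> guarantees that some agent sits in the box
      where deviating pays.\<close>
    define U where "U = {k \<in> prob_measures. \<forall>g\<in>S. \<bar>(\<integral>x. g x \<partial>k) - (\<integral>x. g x \<partial>m)\<bar> < d / 2} \<inter>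
      {k \<in> prob_measures. (\<integral>x. f x \<partial>k) \<in> {0<..}}"
    have UA: "U \<subseteq> A1" using S(2,4) unfolding U_def by force
    show thesis
    proof (rule that)
      show "openin weak_top U"
        unfolding U_def by (intro openin_Int openin_weak_ball S weak_top_subbasis f) auto
      show "m \<in> U" using m S(2) p by (simp add: U_def)
      have "k \<notin> U" if k: "k \<in> all_cournot_nash F C" for k
      proof
        assume kU: "k \<in> U"
        then have kp: "k \<in> prob_measures" "0 < (\<integral>x. f x \<partial>k)" by (auto simp: U_def)
        have "AE z in k. z \<in> best k" using k by (simp add: all_cournot_nash_iff)
        moreover have "\<not> (AE z in k. f z = 0)" using kp integral_pos_iff[OF kp(1) f(1,2)] by simp
        ultimately obtain z where z: "z \<in> best k" "f z \<noteq> 0"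
          by (meson eventually_mono)
        obtain w x where [simp]: "z = (w, x)" by fastforce
        have wx: "w \<in> V1" "w \<in> V2" "w \<in> V3" "x \<in> X1" using fpos z(2) by auto
        obtain y where y: "y \<in> C w" "y \<in> X2" using 3(3)[OF wx(3)] by auto
        have "k \<in> A1 \<inter> A2" using kU S(2,4) unfolding U_def by force
        then have "F k w y < c" "c < F k w x" using 1(7) 2(7) wx y by auto
        moreover have "F k w x \<le> F k w y" using z(1) y by (auto simp: best_def)
        ultimately show False by simp
      qed
      then show "U \<inter> all_cournot_nash F C = {}" by auto
      fix n w x assume n: "Suc N0 \<le> n" and nash: "nash_eq F C n w x"
      let ?m = "emp_measure n (\<lambda>k. (w k, x k))"
      have n0: "0 < n" using n by simp
      show "?m \<notin> U"
      proof
        assume mU: "?m \<in> U"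
        have "(\<integral>z. f z \<partial>?m) = (\<Sum>i<n. f (w i, x i)) / real n"
          by (intro integral_emp_measure n0 bcont_measurable f)
        then have "(\<Sum>i<n. f (w i, x i)) \<noteq> 0" using mU by (auto simp: U_def)
        then obtain i where i: "i < n" "f (w i, x i) \<noteq> 0" by (meson lessThan_iff sum.not_neutral_contains_not_neutral)
        note wx = fpos[OF i(2)]
        then obtain y where y: "y \<in> C (w i)" "y \<in> X2" using 3(3) by blast
        let ?k = "emp_measure n (\<lambda>k. (w k, (x(i := y)) k))"
        have "\<bar>(\<integral>z. g z \<partial>?k) - (\<integral>z. g z \<partial>m)\<bar> < d" if g: "g \<in> S" for g
        proof -
          have "(\<integral>z. g z \<partial>?k) - (\<integral>z. g z \<partial>?m) = ((\<Sum>j<n. g (w j, (x(i := y)) j)) - (\<Sum>j<n. g (w j, x j))) / real n"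
            using S(3)[OF g] by (simp add: integral_emp_measure[OF n0] bcont_measurable diff_divide_distrib)
          also have "(\<Sum>j<n. g (w j, (x(i := y)) j)) - (\<Sum>j<n. g (w j, x j)) =
            (\<Sum>j<n. if j = i then g (w i, y) - g (w i, x i) else 0)"
            unfolding sum_subtractf[symmetric] by (intro sum.cong) auto
          also have "\<dots> = g (w i, y) - g (w i, x i)" using i by simp
          finally have eq: "(\<integral>z. g z \<partial>?k) - (\<integral>z. g z \<partial>?m) = (g (w i, y) - g (w i, x i)) / real n" .
          have "\<bar>g (w i, y) - g (w i, x i)\<bar> \<le> 2 * D" using D[OF g, of "(w i, y)"] D[OF g, of "(w i, x i)"] by linarith
          moreover have "4 * D < d * real n"
          proof -
            have "4 * D / d < real n" using N0 n by linarith
            then show ?thesis using S(2) by (simp add: field_simps)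
          qed
          ultimately have "\<bar>(g (w i, y) - g (w i, x i)) / real n\<bar> < d / 2"
            using n0 by (simp add: abs_divide divide_less_eq)
          moreover have "\<bar>(\<integral>z. g z \<partial>?m) - (\<integral>z. g z \<partial>m)\<bar> < d / 2" using mU g by (auto simp: U_def)
          ultimately show ?thesis using eq by linarith
        qed
        then have "?k \<in> A2" using S(4) emp_measure_prob[OF n0] by blast
        then have "F ?k (w i) y < c" using 2(7) wx y by auto
        moreover have "c < F ?m (w i) (x i)" using 1(7) wx mU UA by auto
        ultimately show False using nash_eqD(2)[OF nash i(1) y(1)] by linarith
      qed
    qed
  qed
qed

end

subsection \<open>Exponential estimates\<close>

definition weak_borel :: "'a::topological_space measure measure" where
  "weak_borel = sigma prob_measures {U. openin weak_top U}"

lemma openin_weak_top_subset: "openin weak_top U \<Longrightarrow> U \<subseteq> prob_measures"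
  using openin_subset[of weak_top U] by (simp add: topspace_weak_top)

lemma space_weak_borel: "space weak_borel = prob_measures"
  unfolding weak_borel_def by (rule space_measure_of) (auto dest: openin_weak_top_subset)

lemma sets_weak_borel: "sets weak_borel = weak_borel_sets"
  unfolding weak_borel_def weak_borel_sets_def
  by (rule sets_measure_of) (auto dest: openin_weak_top_subset)

lemma openin_weak_borel: "openin weak_top U \<Longrightarrow> U \<in> sets weak_borel"
  unfolding sets_weak_borel weak_borel_sets_def by (rule sigma_sets.Basic) simp

lemma product_sigma_finite_prob:
  "lam \<in> prob_measures \<Longrightarrow> product_sigma_finite (\<lambda>_. lam)"
  unfolding product_sigma_finite_def
  by (auto intro: prob_space_imp_sigma_finite prob_measuresD)

abbreviation iid :: "nat \<Rightarrow> 'a measure \<Rightarrow> (nat \<Rightarrow> 'a) measure" where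
  "iid n lam \<equiv> PiM {..<n} (\<lambda>_. lam)"

lemma sets_PiM_prob:
  assumes "lam \<in> prob_measures"
  shows "sets (PiM I (\<lambda>_. lam)) = sets (PiM I (\<lambda>_. borel))"
  by (intro sets_PiM_cong refl prob_measuresD(1)[OF assms])

text \<open>Markov's inequality for the exponential of the sum, whose expectation factorises over
  the coordinates.\<close>

lemma chernoff:
  fixes g :: "'w::topological_space \<Rightarrow> real"
  assumes lam: "lam \<in> prob_measures" and g: "g \<in> borel_measurable borel" "\<And>x. \<bar>g x\<bar> \<le> B"
  shows "measure (iid n lam) {w \<in> space (iid n lam). real n * a \<le> (\<Sum>i<n. g (w i))}
    \<le> exp (- real n * a) * (\<integral>x. exp (g x) \<partial>lam) ^ n"
proof -
  interpret product_sigma_finite "\<lambda>_. lam" by (rule product_sigma_finite_prob[OF lam])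
  let ?P = "iid n lam"
  have ie: "integrable lam (\<lambda>x. exp (g x))"
    by (rule integrable_exp_bounded[OF lam g])
  have iP: "integrable ?P (\<lambda>w. \<Prod>i<n. exp (g (w i)))"
    by (rule product_integrable_prod) (use ie in auto)
  have eq: "{w \<in> space ?P. real n * a \<le> (\<Sum>i<n. g (w i))}
    = {w \<in> space ?P. exp (real n * a) \<le> (\<Prod>i<n. exp (g (w i)))}"
    by (simp flip: exp_sum)
  have "measure ?P {w \<in> space ?P. exp (real n * a) \<le> (\<Prod>i<n. exp (g (w i)))}
    \<le> (\<integral>w. (\<Prod>i<n. exp (g (w i))) \<partial>?P) / exp (real n * a)"
    by (rule integral_Markov_inequality_measure[OF iP sets.top]) (auto intro!: AE_I2 prod_nonneg)
  also have "(\<integral>w. (\<Prod>i<n. exp (g (w i))) \<partial>?P) = (\<integral>x. exp (g x) \<partial>lam) ^ n"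
    by (subst product_integral_prod) (use ie in auto)
  finally show ?thesis unfolding eq by (simp add: exp_minus field_simps)
qed

text \<open>The sets \<open>K j\<close> are chosen so large that the exponential moment of
  \<open>t j\<close> times the indicator of the complement is at most 2. Chernoff's bound then
  controls the event that a fraction \<open>1 / (j + 1)\<close> of the types leaves
  \<open>K j\<close>, summably in \<open>j\<close>. The same test functions in
  \<open>rel_entropy_ge\<close> show that the same compact sets serve for all laws of entropy at
  most \<open>L\<close>, as goodness of the rate function requires.\<close>

lemma exponential_tightness:
  fixes lam :: "'w::polish_space measure"
  assumes lam: "lam \<in> prob_measures" and L: "0 \<le> L"
  obtains K where "\<And>j. compact (K j)"
    "\<And>n. 0 < n \<Longrightarrow> measure (iid n lam) {w \<in> space (iid n lam).
       \<exists>j. real n * (1 / real (Suc j)) \<le> (\<Sum>i<n. indicator (- K j) (w i))} \<le> exp (- real n * L)"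
    "\<And>lam' j. lam' \<in> prob_measures \<Longrightarrow> rel_entropy lam' lam \<le> ereal L \<Longrightarrow> measure lam' (- K j) \<le> 1 / real (Suc j)"
proof -
  interpret prob_space lam by (rule prob_measuresD[OF lam])
  \<comment> \<open>Division by \<open>Suc j\<close> leaves \<open>L + j + 2\<close>: the part
    \<open>L\<close> is the wanted rate, 1 pays for the exponential moment, and \<open>j + 1\<close>
    makes the probabilities summable.\<close>
  define t where "t j = real (Suc j) * (L + real j + 2)" for j
  have t: "0 < t j" for j unfolding t_def using L by (intro mult_pos_pos) auto
  have "\<forall>j. \<exists>K. compact K \<and> measure lam (- K) < exp (- t j)"
    using prob_tight[OF lam exp_gt_zero] by metis
  then obtain K where K: "\<And>j. compact (K j)" "\<And>j. measure lam (- K j) < exp (- t j)" by metis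
  have Kb: "- K j \<in> sets borel" for j using compact_imp_closed[OF K(1)] by (simp add: borel_comp)
  define g where "g j x = t j * indicator (- K j) x" for j x
  have g: "g j \<in> borel_measurable borel" "\<bar>g j x\<bar> \<le> t j" for j x
  proof -
    show "g j \<in> borel_measurable borel" unfolding g_def using Kb by measurable
    show "\<bar>g j x\<bar> \<le> t j" using t[of j] by (auto simp: g_def indicator_def)
  qed
  have Z: "(\<integral>x. exp (g j x) \<partial>lam) \<le> 2" for j
  proof -
    have "(\<integral>x. exp (g j x) \<partial>lam) = (\<integral>x. 1 + (exp (t j) - 1) * indicator (- K j) x \<partial>lam)"
      by (rule Bochner_Integration.integral_cong) (auto simp: g_def indicator_def)
    also have "\<dots> = 1 + (exp (t j) - 1) * measure lam (- K j)"
      using integrable_indicator_borel[OF lam Kb] Kb prob_measuresD(1)[OF lam] by (simp add: prob_space)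
    also have "\<dots> \<le> 1 + exp (t j) * exp (- t j)"
      using K(2)[of j] by (intro add_left_mono mult_mono) auto
    also have "\<dots> = 2" by (simp flip: exp_add)
    finally show ?thesis .
  qed
  have Zpos: "0 < (\<integral>x. exp (g j x) \<partial>lam)" for j by (rule integral_exp_pos[OF lam g])
  have 2: "measure (iid n lam) {w \<in> space (iid n lam).
       \<exists>j. real n * (1 / real (Suc j)) \<le> (\<Sum>i<n. indicator (- K j) (w i))} \<le> exp (- real n * L)"
    if n: "0 < n" for n
  proof -
    let ?P = "iid n lam"
    interpret P: prob_space ?P by (rule prob_space_PiM) (rule prob_measuresD[OF lam])
    define E where "E j = {w \<in> space ?P. real n * (1 / real (Suc j)) \<le> (\<Sum>i<n. indicator (- K j) (w i))}" for j
    have E: "E j \<in> sets ?P" for j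
    proof -
      have [measurable]: "(indicator (- K j) :: 'w \<Rightarrow> real) \<in> borel_measurable lam"
        using integrable_indicator_borel[OF lam Kb] by auto
      show ?thesis unfolding E_def by measurable
    qed
    have "measure ?P (E j) \<le> exp (- real n * L) * (1 / 2) ^ Suc j" for j
    proof -
      have tj: "t j * (1 / real (Suc j)) = L + real j + 2" by (simp add: t_def)
      have "E j = {w \<in> space ?P. real n * (L + real j + 2) \<le> (\<Sum>i<n. g j (w i))}"
      proof -
        have "real n * (1 / real (Suc j)) \<le> s \<longleftrightarrow> real n * (L + real j + 2) \<le> t j * s" for s
        proof -
          have "real n * (1 / real (Suc j)) \<le> s \<longleftrightarrow> t j * (real n * (1 / real (Suc j))) \<le> t j * s"
            by (simp only: mult_le_cancel_left_pos[OF t])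
          also have "t j * (real n * (1 / real (Suc j))) = real n * (t j * (1 / real (Suc j)))" by (simp only: mult.left_commute)
          finally show ?thesis unfolding tj .
        qed
        then show ?thesis unfolding E_def g_def sum_distrib_left[symmetric] by simp
      qed
      then have "measure ?P (E j) \<le> exp (- real n * (L + real j + 2)) * (\<integral>x. exp (g j x) \<partial>lam) ^ n"
        using chernoff[OF lam g] by simp
      also have "\<dots> \<le> exp (- real n * (L + real j + 2)) * exp (real n * 1)"
      proof (intro mult_left_mono)
        have "(\<integral>x. exp (g j x) \<partial>lam) \<le> exp 1" using Z[of j] exp_ge_add_one_self[of 1] by linarith
        then have "(\<integral>x. exp (g j x) \<partial>lam) ^ n \<le> exp 1 ^ n" using Zpos[of j] by (intro power_mono) auto
        then show "(\<integral>x. exp (g j x) \<partial>lam) ^ n \<le> exp (real n * 1)" using exp_of_nat_mult[of n "1 :: real"] by simp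
      qed simp
      also have "\<dots> = exp (- real n * L) * exp (- (real n * real (Suc j)))"
        by (simp add: algebra_simps flip: exp_add)
      also have "exp (- (real n * real (Suc j))) \<le> exp (- (1 * real (Suc j)))"
        using n mult_right_mono[of 1 "real n" "real (Suc j)"] by (simp del: of_nat_Suc)
      also have "exp (- (1 * real (Suc j))) = exp (- 1) ^ Suc j"
        using exp_of_nat_mult[of "Suc j" "- 1 :: real"] by simp
      also have "\<dots> \<le> (1 / 2) ^ Suc j"
      proof (rule power_mono)
        have "2 \<le> exp (1 :: real)" using exp_ge_add_one_self[of 1] by simp
        then show "exp (- 1) \<le> (1 / 2 :: real)" by (simp add: exp_minus field_simps)
      qed simp
      finally show ?thesis by simp
    qed
    note Ej = this
    have sums: "(\<lambda>j. exp (- real n * L) * (1 / 2) ^ Suc j) sums (exp (- real n * L) * 1)"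
      by (intro sums_mult power_half_series)
    have summ: "summable (\<lambda>j. measure ?P (E j))"
      by (rule summable_comparison_test'[OF sums_summable[OF sums], of 0]) (use Ej in auto)
    have "measure ?P (\<Union>j. E j) \<le> (\<Sum>j. measure ?P (E j))"
      by (rule P.finite_measure_subadditive_countably[OF _ summ]) (use E in auto)
    also have "\<dots> \<le> (\<Sum>j. exp (- real n * L) * (1 / 2) ^ Suc j)"
      by (rule suminf_le[OF Ej summ sums_summable[OF sums]])
    also have "\<dots> = exp (- real n * L)" using sums_unique[OF sums] by simp
    also have "(\<Union>j. E j) = {w \<in> space ?P. \<exists>j. real n * (1 / real (Suc j)) \<le> (\<Sum>i<n. indicator (- K j) (w i))}"
      unfolding E_def by blast
    finally show ?thesis .
  qed
  have 3: "measure lam' (- K j) \<le> 1 / real (Suc j)"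
    if l': "lam' \<in> prob_measures" and H: "rel_entropy lam' lam \<le> ereal L" for lam' j
  proof -
    have "ereal ((\<integral>x. g j x \<partial>lam') - ln (\<integral>x. exp (g j x) \<partial>lam)) \<le> ereal L"
      using rel_entropy_ge[OF lam l' g] H by (rule order_trans)
    moreover have "(\<integral>x. g j x \<partial>lam') = t j * measure lam' (- K j)"
      using Kb prob_measuresD[OF l'] by (simp add: g_def)
    moreover have "ln (\<integral>x. exp (g j x) \<partial>lam) \<le> 1"
      using ln_le_minus_one[OF Zpos[of j]] Z[of j] by linarith
    ultimately have "t j * measure lam' (- K j) \<le> L + real j + 2" by simp
    also have "\<dots> = t j * (1 / real (Suc j))" by (simp add: t_def)
    finally show ?thesis using t[of j] by (simp only: mult_le_cancel_left_pos)
  qed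
  show thesis by (rule that[OF K(1) 2 3])
qed

section \<open>Laws of empirical measures under a measurable selection of equilibria\<close>

locale game_selection = game C F
  for C :: "'w::polish_space \<Rightarrow> 'x::metric_space set" and F :: "('w \<times> 'x) measure \<Rightarrow> 'w \<Rightarrow> 'x \<Rightarrow> real" +
  fixes xhat :: "nat \<Rightarrow> nat \<Rightarrow> (nat \<Rightarrow> 'w) \<Rightarrow> 'x"
  assumes xhat_meas: "i < n \<Longrightarrow> xhat n i \<in> borel_measurable (iid n borel)"
    and xhat_nash: "w \<in> space (iid n (borel :: 'w measure)) \<Longrightarrow> nash_eq F C n w (\<lambda>i. xhat n i w)"
begin

definition emp :: "nat \<Rightarrow> (nat \<Rightarrow> 'w) \<Rightarrow> ('w \<times> 'x) measure" where
  "emp n w = emp_measure n (\<lambda>i. (w i, xhat n i w))"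

definition law :: "'w measure \<Rightarrow> nat \<Rightarrow> ('w \<times> 'x) measure measure" where
  "law lam n = distr (iid n lam) weak_borel (emp n)"

lemma emp_prob: "0 < n \<Longrightarrow> emp n w \<in> prob_measures"
  unfolding emp_def by (rule emp_measure_prob)

text \<open>If an empirical measure lies in \<open>U\<close>, so do those of all configurations
  whose points stay in suitable basis rectangles around the given ones. There are only countably
  many lists of basis rectangles, so the preimage is a countable union of measurable boxes, although
  a weakly open set may be an uncountable union of basic ones.\<close>

lemma emp_vimage_open:
  assumes n: "0 < n" and U: "openin weak_top U"
  shows "emp n -` U \<inter> space (iid n borel) \<in> sets (iid n (borel :: 'w measure))"
proof -
  let ?P = "iid n (borel :: 'w measure)"
  obtain B :: "('w \<times> 'x) set set" where B: "countable B" "topological_basis B"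
    "\<And>b. b \<in> B \<Longrightarrow> \<exists>U V. open U \<and> open V \<and> b = U \<times> V" by (rule countable_basis) blast
  define G where "G = {bs \<in> lists B. length bs = n \<and> (\<forall>z. (\<forall>i<n. z i \<in> bs ! i) \<longrightarrow> emp_measure n z \<in> U)}"
  define box where "box bs = {w \<in> space ?P. \<forall>i<n. (w i, xhat n i w) \<in> bs ! i}" for bs
  have "countable G" unfolding G_def by (rule countable_subset[OF _ countable_lists[OF B(1)]]) auto
  have box: "box bs \<in> sets ?P" if "bs \<in> G" for bs
  proof -
    have "{w \<in> space ?P. (w i, xhat n i w) \<in> bs ! i} \<in> sets ?P" if i: "i \<in> {..<n}" for i
    proof -
      have "bs ! i \<in> B" using \<open>bs \<in> G\<close> i by (auto simp: G_def in_lists_conv_set)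
      then obtain U V where UV: "open U" "open V" "bs ! i = U \<times> V" using B(3) by blast
      have "xhat n i \<in> borel_measurable ?P" using xhat_meas i by simp
      moreover have "(\<lambda>w. w i) \<in> borel_measurable ?P" by (rule measurable_component_singleton[OF i])
      moreover have "{w \<in> space ?P. (w i, xhat n i w) \<in> bs ! i} =
        ((\<lambda>w. w i) -` U \<inter> space ?P) \<inter> (xhat n i -` V \<inter> space ?P)" by (auto simp: UV(3))
      ultimately show ?thesis using UV(1,2) by (simp only: sets.Int measurable_sets borel_open)
    qed
    then have "(\<Inter>i\<in>{..<n}. {w \<in> space ?P. (w i, xhat n i w) \<in> bs ! i}) \<in> sets ?P"
      using n by (intro sets.finite_INT) auto
    also have "(\<Inter>i\<in>{..<n}. {w \<in> space ?P. (w i, xhat n i w) \<in> bs ! i}) = box bs"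
      using n by (auto simp: box_def)
    finally show ?thesis .
  qed
  have "emp n -` U \<inter> space ?P = (\<Union>bs\<in>G. box bs)"
  proof (intro equalityI subsetI)
    fix w assume w: "w \<in> emp n -` U \<inter> space ?P"
    define z where "z i = (w i, xhat n i w)" for i
    have "emp_measure n z \<in> U" using w by (simp add: emp_def z_def[abs_def])
    then obtain S d where S: "finite S" "0 < d" "\<And>g. g \<in> S \<Longrightarrow> bcont g"
      "{k \<in> prob_measures. \<forall>g\<in>S. \<bar>(\<integral>x. g x \<partial>k) - (\<integral>x. g x \<partial>emp_measure n z)\<bar> < d} \<subseteq> U"
      by (rule weak_top_nhd[OF U]) blast
    define V where "V i = (\<Inter>g\<in>S. {y. \<bar>g y - g (z i)\<bar> < d})" for i
    have V: "open (V i)" "z i \<in> V i" for i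
    proof -
      show "open (V i)"
        unfolding V_def by (intro open_INT ballI S(1) open_Collect_less continuous_on_rabs
            continuous_on_diff continuous_on_const bcont_continuous S(3))
    qed (use S(2) in \<open>simp add: V_def\<close>)
    have "\<forall>i. \<exists>b. b \<in> B \<and> z i \<in> b \<and> b \<subseteq> V i" using topological_basisE[OF B(2) V] by metis
    then obtain b where b: "\<And>i. b i \<in> B" "\<And>i. z i \<in> b i" "\<And>i. b i \<subseteq> V i" by metis
    define bs where "bs = map b [0..<n]"
    have bs: "length bs = n" "\<And>i. i < n \<Longrightarrow> bs ! i = b i" by (auto simp: bs_def)
    have "emp_measure n z' \<in> U" if z': "\<forall>i<n. z' i \<in> bs ! i" for z'
    proof -
      have "\<bar>(\<integral>x. g x \<partial>emp_measure n z') - (\<integral>x. g x \<partial>emp_measure n z)\<bar> < d" if g: "g \<in> S" for g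
      proof -
        have "\<bar>(\<integral>x. g x \<partial>emp_measure n z') - (\<integral>x. g x \<partial>emp_measure n z)\<bar>
          = \<bar>\<Sum>i<n. g (z' i) - g (z i)\<bar> / real n"
          using S(3)[OF g] n
          by (simp add: integral_emp_measure bcont_measurable sum_subtractf flip: diff_divide_distrib)
        also have "\<dots> \<le> (\<Sum>i<n. \<bar>g (z' i) - g (z i)\<bar>) / real n" by (intro divide_right_mono sum_abs) simp
        also have "\<dots> < (\<Sum>i<n. d) / real n"
        proof (intro divide_strict_right_mono sum_strict_mono)
          fix i assume "i \<in> {..<n}"
          then have "z' i \<in> b i" using z' bs(2) by (metis lessThan_iff)
          then have "z' i \<in> V i" using b(3) by blast
          then show "\<bar>g (z' i) - g (z i)\<bar> < d" using g by (auto simp: V_def)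
        qed (use n in auto)
        also have "\<dots> = d" using n by simp
        finally show ?thesis .
      qed
      then show ?thesis using S(4) emp_measure_prob[OF n] by blast
    qed
    then have "bs \<in> G" using bs b(1) by (auto simp: G_def bs_def in_lists_conv_set)
    moreover have "w \<in> box bs" using w b(2) bs by (auto simp: box_def z_def)
    ultimately show "w \<in> (\<Union>bs\<in>G. box bs)" by blast
  next
    fix w assume "w \<in> (\<Union>bs\<in>G. box bs)"
    then show "w \<in> emp n -` U \<inter> space ?P" by (auto simp: G_def box_def emp_def)
  qed
  also have "\<dots> \<in> sets ?P" by (rule sets.countable_UN'[OF \<open>countable G\<close>]) (use box in auto)
  finally show ?thesis .
qed

lemma emp_measurable_borel:
  assumes "0 < n" shows "emp n \<in> measurable (iid n borel) weak_borel"
  unfolding weak_borel_def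
  by (rule measurable_measure_of)
    (use emp_vimage_open[OF assms] emp_prob[OF assms] in \<open>auto dest: openin_weak_top_subset\<close>)

lemma emp_measurable:
  assumes "0 < n" "lam \<in> prob_measures" shows "emp n \<in> measurable (iid n lam) weak_borel"
  using emp_measurable_borel[OF assms(1)]
  unfolding measurable_cong_sets[OF sets_PiM_prob[OF assms(2)] refl] .

lemma prob_space_law:
  assumes "0 < n" "lam \<in> prob_measures" shows "prob_space (law lam n)"
  unfolding law_def
  by (intro prob_space.prob_space_distr prob_space_PiM emp_measurable assms prob_measuresD)

lemma sets_law: "sets (law lam n) = sets weak_borel"
  by (simp add: law_def)

lemma measure_law:
  assumes "0 < n" "lam \<in> prob_measures" "A \<in> sets weak_borel"
  shows "measure (law lam n) A = measure (iid n lam) {w \<in> space (iid n lam). emp n w \<in> A}"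
proof -
  have "emp n -` A \<inter> space (iid n lam) = {w \<in> space (iid n lam). emp n w \<in> A}" by auto
  then show ?thesis
    unfolding law_def using measure_distr[OF emp_measurable[OF assms(1,2)] assms(3)] by simp
qed

lemma emp_not_in_law:
  assumes "openin weak_top U" "0 < n" "lam \<in> prob_measures"
    and "\<And>w x. nash_eq F C n w x \<Longrightarrow> emp_measure n (\<lambda>k. (w k, x k)) \<notin> U"
  shows "measure (law lam n) U = 0"
proof -
  have "space (iid n lam) = space (iid n (borel :: 'w measure))"
    using sets_PiM_prob[OF assms(3)] by (rule sets_eq_imp_space_eq)
  then have "{w \<in> space (iid n lam). emp n w \<in> U} = {}"
    using assms(4)[OF xhat_nash] by (auto simp: emp_def)
  then show ?thesis by (simp only: measure_law[OF assms(2,3) openin_weak_borel[OF assms(1)]] measure_empty)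
qed

lemma integral_emp_fst:
  fixes f :: "'w \<Rightarrow> real"
  assumes "0 < n" "f \<in> borel_measurable borel"
  shows "(\<integral>z. f (fst z) \<partial>emp n w) = (\<Sum>i<n. f (w i)) / real n"
  unfolding emp_def
  by (subst integral_emp_measure[OF assms(1)]) (auto intro: measurable_compose[OF fst_borel_measurable assms(2)])

text \<open>The event concerns the types alone, so Chernoff's bound for an i.i.d. sum applies, and
  the threshold \<open>c + ln Z\<close> cancels the factor \<open>Z ^ n\<close>. The last conclusion
  is used for closedness of the sublevel sets.\<close>

lemma chernoff_nbhd:
  assumes lam: "lam \<in> prob_measures" and m: "m \<in> prob_measures" and f: "bcont f"
    and c: "c < (\<integral>z. f (fst z) \<partial>m) - ln (\<integral>x. exp (f x) \<partial>lam)"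
  obtains U where "openin weak_top U" "m \<in> U" "\<And>n. 0 < n \<Longrightarrow> measure (law lam n) U \<le> exp (- real n * c)"
    "\<And>k. k \<in> U \<Longrightarrow> c < (\<integral>z. f (fst z) \<partial>k) - ln (\<integral>x. exp (f x) \<partial>lam)"
proof -
  define Z where "Z = (\<integral>x. exp (f x) \<partial>lam)"
  obtain B where B: "0 < B" "\<And>x. \<bar>f x\<bar> \<le> B" using bcontE[OF f] by blast
  have Z: "0 < Z" unfolding Z_def by (rule integral_exp_pos[OF lam bcont_measurable[OF f] B(2)])
  have fb: "bcont (\<lambda>z :: 'w \<times> 'x. f (fst z))" by (rule bcont_compose[OF f]) (intro continuous_intros)
  define U where "U = {k \<in> (prob_measures :: ('w \<times> 'x) measure set). (\<integral>z. f (fst z) \<partial>k) \<in> {c + ln Z<..}}"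
  show thesis
  proof (rule that)
    show Uo: "openin weak_top U" unfolding U_def by (rule weak_top_subbasis[OF fb]) simp
    show "m \<in> U" using m c by (simp add: U_def Z_def)
    show "c < (\<integral>z. f (fst z) \<partial>k) - ln (\<integral>x. exp (f x) \<partial>lam)" if "k \<in> U" for k
      using that by (simp add: U_def Z_def)
    fix n :: nat assume n: "0 < n"
    let ?P = "iid n lam"
    interpret P: prob_space ?P by (rule prob_space_PiM) (rule prob_measuresD[OF lam])
    have [measurable]: "f \<in> borel_measurable lam" using bcont_integrable[OF lam f] by auto
    have "measure (law lam n) U = measure ?P {w \<in> space ?P. emp n w \<in> U}"
      by (rule measure_law[OF n lam openin_weak_borel[OF Uo]])
    also have "\<dots> \<le> measure ?P {w \<in> space ?P. real n * (c + ln Z) \<le> (\<Sum>i<n. f (w i))}"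
    proof (rule P.finite_measure_mono)
      show "{w \<in> space ?P. real n * (c + ln Z) \<le> (\<Sum>i<n. f (w i))} \<in> sets ?P" by measurable
      show "{w \<in> space ?P. emp n w \<in> U} \<subseteq> {w \<in> space ?P. real n * (c + ln Z) \<le> (\<Sum>i<n. f (w i))}"
        using n by (auto simp: U_def integral_emp_fst[OF n bcont_measurable[OF f]] field_simps)
    qed
    also have "\<dots> \<le> exp (- real n * (c + ln Z)) * Z ^ n"
      unfolding Z_def by (rule chernoff[OF lam bcont_measurable[OF f] B(2)])
    also have "Z ^ n = exp (real n * ln Z)" using Z by (simp add: exp_of_nat_mult)
    also have "exp (- real n * (c + ln Z)) * exp (real n * ln Z) = exp (- real n * c)"
      by (simp add: algebra_simps flip: exp_add)
    finally show "measure (law lam n) U \<le> exp (- real n * c)" .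
  qed
qed

end

subsection \<open>Large deviation bounds\<close>

text \<open>Strict positivity of the entropy, witnessed by a continuous function. Along
  \<open>f = t * g\<close> the functional vanishes at \<open>t = 0\<close> with derivative
  \<open>D\<close>, the difference of the two integrals of \<open>g\<close>, and the second-order
  error is at most \<open>(t * B)\<^sup>2\<close>.\<close>

lemma separating_tilt:
  fixes lam k :: "'w::metric_space measure"
  assumes lam: "lam \<in> prob_measures" and k: "k \<in> prob_measures" and ne: "k \<noteq> lam"
  obtains f where "bcont f" "0 < (\<integral>x. f x \<partial>k) - ln (\<integral>x. exp (f x) \<partial>lam)"
proof -
  interpret prob_space lam by (rule prob_measuresD[OF lam])
  obtain g0 where g0: "bcont g0" "(\<integral>x. g0 x \<partial>k) \<noteq> (\<integral>x. g0 x \<partial>lam)"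
    using prob_measures_eqI[OF k lam] ne by blast
  obtain g where g: "bcont g" "(\<integral>x. g x \<partial>lam) < (\<integral>x. g x \<partial>k)"
  proof (cases "(\<integral>x. g0 x \<partial>lam) < (\<integral>x. g0 x \<partial>k)")
    case True
    then show ?thesis using that g0 by blast
  next
    case False
    have "bcont (\<lambda>x. 0 - g0 x)" by (intro bcont_diff bcont_const g0)
    then show ?thesis using that[of "\<lambda>x. 0 - g0 x"] False g0(2) by simp
  qed
  obtain B where B: "0 < B" "\<And>x. \<bar>g x\<bar> \<le> B" using bcontE[OF g(1)] by blast
  define D where "D = (\<integral>x. g x \<partial>k) - (\<integral>x. g x \<partial>lam)"
  have D: "0 < D" using g by (simp add: D_def)
  \<comment> \<open>The first bound keeps the tilt within \<open>[-1, 1]\<close>, where the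
    quadratic estimate of the exponential is used; the second limits the error to half of the gain
    \<open>t * D\<close>.\<close>
  define t where "t = min (1 / B) (D / (2 * B\<^sup>2))"
  have t: "0 < t" "t * B \<le> 1" "t * B\<^sup>2 \<le> D / 2"
    using B D unfolding t_def by (auto simp: min_def field_simps)
  define f where "f x = t * g x" for x
  have f: "bcont f" unfolding f_def by (intro bcont_mult bcont_const g)
  have fB: "\<bar>f x\<bar> \<le> t * B" for x unfolding f_def abs_mult using B t by (intro mult_mono) auto
  have ie: "integrable lam (\<lambda>x. exp (f x))" by (rule integrable_exp_bounded[OF lam bcont_measurable[OF f] fB])
  have ig: "integrable lam g" by (rule bcont_integrable[OF lam g(1)])
  have "(\<integral>x. exp (f x) \<partial>lam) \<le> (\<integral>x. 1 + t * g x + (t * B)\<^sup>2 \<partial>lam)"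
  proof (rule integral_mono[OF ie])
    fix x
    have "exp (f x) \<le> 1 + f x + (f x)\<^sup>2"
    proof -
      have "\<bar>f x\<bar> \<le> 1" using fB[of x] t by linarith
      show ?thesis
      proof (cases "0 \<le> f x")
        case True
        then show ?thesis using exp_bound[of "f x"] \<open>\<bar>f x\<bar> \<le> 1\<close> by simp
      next
        case False
        then have "0 < - f x" by simp
        then have "1 + (- f x) \<le> exp (- f x)" using exp_ge_add_one_self[of "- f x"] by simp
        then have "exp (f x) \<le> 1 / (1 - f x)" using \<open>0 < - f x\<close> by (simp add: exp_minus field_simps)
        also have "\<dots> \<le> 1 + f x + (f x)\<^sup>2"
        proof -
          have "(1 + f x + (f x)\<^sup>2) * (1 - f x) = 1 - f x * (f x)\<^sup>2" by (simp add: algebra_simps power2_eq_square)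
          moreover have "f x * (f x)\<^sup>2 \<le> 0" using False by (intro mult_nonpos_nonneg) auto
          ultimately show ?thesis using \<open>0 < - f x\<close> by (simp add: divide_le_eq)
        qed
        finally show ?thesis .
      qed
    qed
    also have "(f x)\<^sup>2 \<le> (t * B)\<^sup>2" using fB[of x] by (simp add: abs_le_square_iff[symmetric])
    finally show "exp (f x) \<le> 1 + t * g x + (t * B)\<^sup>2" by (simp add: f_def)
  qed (use ig in auto)
  also have "\<dots> = 1 + t * (\<integral>x. g x \<partial>lam) + (t * B)\<^sup>2" using ig by (simp add: prob_space)
  finally have Z: "(\<integral>x. exp (f x) \<partial>lam) \<le> 1 + t * (\<integral>x. g x \<partial>lam) + (t * B)\<^sup>2" .
  have "0 < (\<integral>x. exp (f x) \<partial>lam)" by (rule integral_exp_pos[OF lam bcont_measurable[OF f] fB])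
  then have "ln (\<integral>x. exp (f x) \<partial>lam) \<le> t * (\<integral>x. g x \<partial>lam) + (t * B)\<^sup>2"
    using ln_le_minus_one Z by fastforce
  moreover have "(\<integral>x. f x \<partial>k) = t * (\<integral>x. g x \<partial>k)" by (simp add: f_def)
  moreover have "(t * B)\<^sup>2 \<le> t * (D / 2)"
    using mult_left_mono[OF t(3), of t] t(1) by (simp add: power2_eq_square mult_ac)
  moreover have "t * (D / 2) < t * D" using t(1) D by simp
  moreover have "t * D = t * (\<integral>x. g x \<partial>k) - t * (\<integral>x. g x \<partial>lam)" by (simp add: D_def right_diff_distrib)
  ultimately have "0 < (\<integral>x. f x \<partial>k) - ln (\<integral>x. exp (f x) \<partial>lam)" by linarith
  then show thesis using that f by blast
qed

text \<open>Testing the variational inequality with a multiple of the indicator of \<open>E\<close> replaces the law of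
  large numbers for the log-likelihood in the change of measure.\<close>

lemma change_of_measure:
  fixes D :: "'a \<Rightarrow> real"
  assumes P: "prob_space P" and Q: "prob_space Q" and D: "D \<in> borel_measurable P" "\<And>x. 0 \<le> D x"
    and QD: "Q = density P (\<lambda>x. ennreal (D x))" and int: "integrable Q (\<lambda>x. ln (D x))"
    and E: "E \<in> sets P" and pos: "0 < measure Q E"
  shows "0 < measure P E" "- ln (measure P E) * measure Q E \<le> (\<integral>x. ln (D x) \<partial>Q) + ln 2"
proof -
  interpret P: prob_space P by fact
  interpret Q: prob_space Q by fact
  have EQ: "E \<in> sets Q" using E QD by simp
  have key: "t * measure Q E - ln (1 + (exp t - 1) * measure P E) \<le> (\<integral>x. ln (D x) \<partial>Q)" if "0 \<le> t" for t
  proof -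
    have "(\<integral>x. t * indicator E x \<partial>Q) - ln (\<integral>x. exp (t * indicator E x) \<partial>P) \<le> (\<integral>x. ln (D x) \<partial>Q)"
      by (rule gibbs_variational[OF P Q D QD int, where B = t]) (use E that in \<open>auto simp: indicator_def\<close>)
    moreover have "(\<integral>x. exp (t * indicator E x) \<partial>P) = (\<integral>x. 1 + (exp t - 1) * indicator E x \<partial>P)"
      by (rule Bochner_Integration.integral_cong) (auto simp: indicator_def)
    moreover have "\<dots> = 1 + (exp t - 1) * measure P E"
    proof -
      have "integrable P (indicator E :: 'a \<Rightarrow> real)"
        by (rule P.integrable_const_bound[where B = 1]) (use E in \<open>auto simp: indicator_def\<close>)
      then show ?thesis using E by (simp add: P.prob_space)
    qed
    ultimately show ?thesis using EQ by simp
  qed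
  show pP: "0 < measure P E"
  proof (rule ccontr)
    assume "\<not> 0 < measure P E"
    then have 0: "measure P E = 0" using measure_nonneg[of P E] by linarith
    \<comment> \<open>If \<open>P\<close> did not charge \<open>E\<close>, the normalising term
      would vanish and a large multiple of the indicator would violate the variational
      bound.\<close>
    define t where "t = (\<bar>\<integral>x. ln (D x) \<partial>Q\<bar> + 1) / measure Q E"
    have "0 \<le> t" using pos by (simp add: t_def)
    from key[OF this] have "t * measure Q E \<le> (\<integral>x. ln (D x) \<partial>Q)" by (simp add: 0)
    moreover have "t * measure Q E = \<bar>\<integral>x. ln (D x) \<partial>Q\<bar> + 1" using pos by (simp add: t_def)
    ultimately show False by linarith
  qed
  \<comment> \<open>With this multiplier \<open>exp t * measure P E = 1\<close>, so the normalising
    integral is at most 2.\<close>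
  have "0 \<le> - ln (measure P E)" using pP by simp
  from key[OF this] have "- ln (measure P E) * measure Q E
    \<le> (\<integral>x. ln (D x) \<partial>Q) + ln (1 + (exp (- ln (measure P E)) - 1) * measure P E)" by simp
  also have "1 + (exp (- ln (measure P E)) - 1) * measure P E = 2 - measure P E"
    using pP by (simp add: exp_minus field_simps)
  also have "ln (2 - measure P E) \<le> ln 2"
    by (subst ln_le_cancel_iff) (use pP P.prob_le_1[of E] in linarith)+
  finally show "- ln (measure P E) * measure Q E \<le> (\<integral>x. ln (D x) \<partial>Q) + ln 2" by simp
qed

lemma PiM_density:
  fixes h :: "'w::topological_space \<Rightarrow> real" and n :: nat
  assumes l0: "lam0 \<in> prob_measures" and l: "lam \<in> prob_measures"
    and h: "h \<in> borel_measurable borel" "\<And>x. 0 \<le> h x" and dens: "lam = density lam0 (\<lambda>x. ennreal (h x))"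
  shows "iid n lam = density (iid n lam0) (\<lambda>w. ennreal (\<Prod>i<n. h (w i)))"
proof -
  interpret p0: product_sigma_finite "\<lambda>_ :: nat. lam0" by (rule product_sigma_finite_prob[OF l0])
  interpret p1: product_sigma_finite "\<lambda>_ :: nat. lam" by (rule product_sigma_finite_prob[OF l])
  note sets0 = prob_measuresD(1)[OF l0] and sets1 = prob_measuresD(1)[OF l]
  have h0[measurable]: "h \<in> borel_measurable lam0" by (rule measurable_prob_measures[OF l0 h(1)])
  show ?thesis
  proof (rule p1.PiM_eqI[symmetric])
    show "sets (density (iid n lam0) (\<lambda>w. ennreal (\<Prod>i<n. h (w i)))) = sets (iid n lam)"
      unfolding sets_density sets_PiM_prob[OF l0] sets_PiM_prob[OF l] ..
    fix A :: "nat \<Rightarrow> 'w set" assume "\<And>i. i \<in> {..<n} \<Longrightarrow> A i \<in> sets lam"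
    then have A: "A i \<in> sets lam0" if "i < n" for i using that sets0 sets1 by simp
    have "emeasure (density (iid n lam0) (\<lambda>w. ennreal (\<Prod>i<n. h (w i)))) (PiE {..<n} A)
      = (\<integral>\<^sup>+w. ennreal (\<Prod>i<n. h (w i)) * indicator (PiE {..<n} A) w \<partial>iid n lam0)"
      by (rule emeasure_density) (use A in \<open>auto intro!: sets_PiM_I_finite\<close>)
    also have "\<dots> = (\<integral>\<^sup>+w. (\<Prod>i<n. ennreal (h (w i)) * indicator (A i) (w i)) \<partial>iid n lam0)"
    proof (rule nn_integral_cong)
      fix w assume w: "w \<in> space (iid n lam0)"
      have "indicator (PiE {..<n} A) w = (\<Prod>i<n. indicator (A i) (w i) :: ennreal)"
      proof (cases "w \<in> PiE {..<n} A")
        case False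
        then obtain i where "i < n" "w i \<notin> A i" using w by (auto simp: space_PiM PiE_iff)
        then have "(\<Prod>i<n. indicator (A i) (w i) :: ennreal) = 0" by (intro prod_zero bexI[of _ i]) auto
        then show ?thesis using False by simp
      next
        case True
        then have "(\<Prod>i<n. indicator (A i) (w i) :: ennreal) = 1" by (intro prod.neutral) (auto simp: PiE_iff)
        then show ?thesis using True by simp
      qed
      then show "ennreal (\<Prod>i<n. h (w i)) * indicator (PiE {..<n} A) w = (\<Prod>i<n. ennreal (h (w i)) * indicator (A i) (w i))"
        using h(2) by (simp add: prod.distrib prod_ennreal)
    qed
    also have "\<dots> = (\<Prod>i<n. \<integral>\<^sup>+x. ennreal (h x) * indicator (A i) x \<partial>lam0)"
      by (rule p0.product_nn_integral_prod) (use A in auto)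
    also have "\<dots> = (\<Prod>i<n. emeasure lam (A i))"
      by (intro prod.cong refl, subst dens, subst emeasure_density) (use A in auto)
    finally show "emeasure (density (iid n lam0) (\<lambda>w. ennreal (\<Prod>i<n. h (w i)))) (PiE {..<n} A)
      = (\<Prod>i\<in>{..<n}. emeasure lam (A i))" .
  qed simp
qed

text \<open>Additivity of entropy over independent coordinates. The logarithm of the product splits
  where all factors are positive, which is almost everywhere under the tilted law.\<close>

lemma ln_prod_density:
  fixes h :: "'w::topological_space \<Rightarrow> real"
  assumes l0: "lam0 \<in> prob_measures" and l: "lam \<in> prob_measures"
    and h: "h \<in> borel_measurable borel" "\<And>x. 0 \<le> h x" and dens: "lam = density lam0 (\<lambda>x. ennreal (h x))"
    and int: "integrable lam (\<lambda>x. ln (h x))"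
  shows "integrable (iid n lam) (\<lambda>w. ln (\<Prod>i<n. h (w i)))"
    and "(\<integral>w. ln (\<Prod>i<n. h (w i)) \<partial>iid n lam) = real n * (\<integral>x. ln (h x) \<partial>lam)"
proof -
  let ?P = "iid n lam"
  note ps = prob_measuresD(2)[OF l]
  have [measurable]: "h \<in> borel_measurable lam" by (rule measurable_prob_measures[OF l h(1)])
  have h0[measurable]: "h \<in> borel_measurable lam0" by (rule measurable_prob_measures[OF l0 h(1)])
  have "AE x in lam. 0 < h x" using h(2) by (subst dens, subst AE_density) (auto simp: less_le)
  then have "AE w in ?P. 0 < h (w i)" if "i < n" for i
    using that by (intro AE_PiM_component ps) auto
  then have "AE w in ?P. \<forall>i\<in>{..<n}. 0 < h (w i)"
    by (intro AE_finite_allI) auto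
  then have eq: "AE w in ?P. ln (\<Prod>i<n. h (w i)) = (\<Sum>i<n. ln (h (w i)))"
  proof eventually_elim
    case (elim w)
    have "h (w i) \<noteq> 0" if "i \<in> {..<n}" for i using bspec[OF elim that] by simp
    then show ?case by (intro ln_prod) auto
  qed
  have comp: "integrable ?P (\<lambda>w. ln (h (w i)))" "(\<integral>w. ln (h (w i)) \<partial>?P) = (\<integral>x. ln (h x) \<partial>lam)" if "i < n" for i
  proof -
    have d: "distr ?P lam (\<lambda>w. w i) = lam" by (rule distr_PiM_component) (use ps that in auto)
    have m: "(\<lambda>w. w i) \<in> measurable ?P lam" using that by simp
    show "integrable ?P (\<lambda>w. ln (h (w i)))"
      by (rule integrable_distr[OF m, of "\<lambda>x. ln (h x)"]) (simp only: d int)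
    show "(\<integral>w. ln (h (w i)) \<partial>?P) = (\<integral>x. ln (h x) \<partial>lam)"
      using integral_distr[OF m, of "\<lambda>x. ln (h x)"] by (simp add: d)
  qed
  have m1: "(\<lambda>w. \<Sum>i<n. ln (h (w i))) \<in> borel_measurable ?P" "(\<lambda>w. ln (\<Prod>i<n. h (w i))) \<in> borel_measurable ?P"
    by measurable
  have isum: "integrable ?P (\<lambda>w. \<Sum>i<n. ln (h (w i)))"
    by (rule Bochner_Integration.integrable_sum) (use comp in auto)
  show "integrable ?P (\<lambda>w. ln (\<Prod>i<n. h (w i)))"
    using isum integrable_cong_AE[OF m1(2,1) eq] by simp
  have "(\<integral>w. ln (\<Prod>i<n. h (w i)) \<partial>?P) = (\<integral>w. (\<Sum>i<n. ln (h (w i))) \<partial>?P)"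
    by (rule integral_cong_AE[OF m1(2,1) eq])
  also have "\<dots> = (\<Sum>i<n. \<integral>x. ln (h x) \<partial>lam)"
    by (subst Bochner_Integration.integral_sum) (use comp in auto)
  finally show "(\<integral>w. ln (\<Prod>i<n. h (w i)) \<partial>?P) = real n * (\<integral>x. ln (h x) \<partial>lam)" by simp
qed

section \<open>Upper bound, concentration and lower bound\<close>

context game_selection
begin

definition tight_set :: "(nat \<Rightarrow> 'w set) \<Rightarrow> ('w \<times> 'x) measure set" where
  "tight_set K = {m \<in> prob_measures. \<forall>j. measure m (- (K j \<times> UNIV)) \<le> 1 / real (Suc j)}"

lemma compactin_tight_set:
  assumes "\<And>j. compact (K j)" shows "compactin weak_top (tight_set K)"
  unfolding tight_set_def using assms X_compact
  by (intro compactin_tight compact_Times LIMSEQ_inverse_real_of_nat[unfolded inverse_eq_divide])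

text \<open>The hypothesis asks for a tilt at each equilibrium instead of an entropy bound, so it
  can be met by \<open>rel_entropy_witness\<close> at any level and by
  \<open>separating_tilt\<close> at level 0. The finite subcover contributes only a constant factor
  \<open>R\<close> and a minimum of finitely many rates, all strictly above
  \<open>c\<close>.\<close>

lemma upper_bound:
  assumes lam: "lam \<in> prob_measures" and A: "A \<in> sets weak_borel"
    and H: "\<And>m. m \<in> weak_top closure_of A \<Longrightarrow> m \<in> all_cournot_nash F C \<Longrightarrow>
      \<exists>f. bcont f \<and> c < (\<integral>z. f (fst z) \<partial>m) - ln (\<integral>x. exp (f x) \<partial>lam)"
  obtains c' R N where "c < c'" "\<And>n. N \<le> n \<Longrightarrow> measure (law lam n) A \<le> R * exp (- real n * c')"
proof -
  \<comment> \<open>Nonnegative for \<open>exponential_tightness\<close>, and above \<open>c\<close>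
    so that the noncompact part is negligible.\<close>
  define L where "L = max 0 (c + 1)"
  have L: "0 \<le> L" "c + 1 \<le> L" by (auto simp: L_def)
  obtain K where K: "\<And>j. compact (K j)"
    "\<And>n. 0 < n \<Longrightarrow> measure (iid n lam) {w \<in> space (iid n lam).
       \<exists>j. real n * (1 / real (Suc j)) \<le> (\<Sum>i<n. indicator (- K j) (w i))} \<le> exp (- real n * L)"
    by (rule exponential_tightness[OF lam L(1)]) (rule that)
  have Kb: "- K j \<in> sets borel" for j using compact_imp_closed[OF K(1)] by (simp add: borel_comp)
  have A_sub: "A \<subseteq> prob_measures" using sets.sets_into_space[OF A] by (simp add: space_weak_borel)
  \<comment> \<open>The claim localised to \<open>U\<close>. Points outside the closure and
    non-equilibria have neighbourhoods in which the probability is eventually 0, so there the rate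
    \<open>c + 1\<close> is an arbitrary choice.\<close>
  define good where "good U \<longleftrightarrow> openin weak_top U \<and>
    (\<exists>c'>c. \<exists>N. \<forall>n\<ge>N. measure (law lam n) (A \<inter> U) \<le> exp (- real n * c'))" for U
  have AU_le: "measure (law lam n) (A \<inter> U) \<le> measure (law lam n) U" if "openin weak_top U" "0 < n" for U n
  proof -
    interpret prob_space "law lam n" by (rule prob_space_law[OF that(2) lam])
    show ?thesis by (rule finite_measure_mono) (use openin_weak_borel[OF that(1)] in \<open>auto simp: sets_law\<close>)
  qed
  have ex_good: "\<exists>U. good U \<and> m \<in> U" if m: "m \<in> prob_measures" for m
  proof (cases "m \<in> weak_top closure_of A")
    case False
    have "openin weak_top (topspace weak_top - weak_top closure_of A)" by (simp add: openin_diff)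
    moreover have "A \<inter> (topspace weak_top - weak_top closure_of A) = {}"
      using closure_of_subset[of A weak_top] A_sub by (auto simp: topspace_weak_top)
    ultimately have "good (topspace weak_top - weak_top closure_of A)"
      unfolding good_def by (auto intro!: exI[of _ "c + 1"])
    then show ?thesis using False m by (auto simp: topspace_weak_top)
  next
    case cl: True
    show ?thesis
    proof (cases "m \<in> all_cournot_nash F C")
      case True
      then obtain f where f: "bcont f" "c < (\<integral>z. f (fst z) \<partial>m) - ln (\<integral>x. exp (f x) \<partial>lam)" using H cl by blast
      then obtain c' where c': "c < c'" "c' < (\<integral>z. f (fst z) \<partial>m) - ln (\<integral>x. exp (f x) \<partial>lam)" using dense by blast
      obtain U where U: "openin weak_top U" "m \<in> U" "\<And>n. 0 < n \<Longrightarrow> measure (law lam n) U \<le> exp (- real n * c')"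
        by (rule chernoff_nbhd[OF lam m f(1) c'(2)]) (rule that)
      have "measure (law lam n) (A \<inter> U) \<le> exp (- real n * c')" if "1 \<le> n" for n
        using order_trans[OF AU_le[OF U(1)] U(3)] that by simp
      then have "good U" unfolding good_def using U(1) c'(1) by blast
      then show ?thesis using U(2) by blast
    next
      case False
      obtain U N where U: "openin weak_top U" "m \<in> U"
        "\<And>n w x. N \<le> n \<Longrightarrow> nash_eq F C n w x \<Longrightarrow> emp_measure n (\<lambda>k. (w k, x k)) \<notin> U"
        by (rule not_cournot_nash_nhd[OF m False]) (rule that)
      have "measure (law lam n) (A \<inter> U) \<le> exp (- real n * (c + 1))" if "max 1 N \<le> n" for n
      proof -
        have "measure (law lam n) U = 0" using that U(3) by (intro emp_not_in_law[OF U(1) _ lam]) auto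
        then show ?thesis using AU_le[OF U(1), of n] that by (auto intro: order_trans)
      qed
      then have "good U"
        unfolding good_def using U(1) by (intro conjI exI[of _ "c + 1"] exI[of _ "max 1 N"]) auto
      then show ?thesis using U(2) by blast
    qed
  qed
  have "compactin weak_top (tight_set K)" using K(1) by (rule compactin_tight_set)
  moreover have "\<forall>U\<in>Collect good. openin weak_top U" by (auto simp: good_def)
  moreover have "tight_set K \<subseteq> \<Union>(Collect good)" using ex_good by (auto simp: tight_set_def)
  ultimately obtain T where T: "finite T" "T \<subseteq> Collect good" "tight_set K \<subseteq> \<Union>T"
    unfolding compactin_def by meson
  \<comment> \<open>Each added set raises the constant by 1 and takes the minimum of the
    rates.\<close>
  have "\<exists>c'>c. \<exists>R\<ge>0. \<exists>N. \<forall>n\<ge>N. measure (law lam n) (A \<inter> \<Union>T) \<le> R * exp (- real n * c')"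
    using T(1,2)
  proof (induction T rule: finite_induct)
    case empty
    show ?case by (rule exI[of _ "c + 1"]) auto
  next
    case (insert U T)
    obtain c1 N1 where 1: "c < c1" "\<And>n. N1 \<le> n \<Longrightarrow> measure (law lam n) (A \<inter> U) \<le> exp (- real n * c1)"
      and Uo: "openin weak_top U" using insert.prems unfolding good_def by auto
    obtain c2 R N2 where 2: "c < c2" "0 \<le> R" "\<And>n. N2 \<le> n \<Longrightarrow> measure (law lam n) (A \<inter> \<Union>T) \<le> R * exp (- real n * c2)"
      using insert.IH insert.prems by auto
    have To: "openin weak_top (\<Union>T)" using insert.prems by (intro openin_Union) (auto simp: good_def)
    define c' where "c' = min c1 c2"
    have "measure (law lam n) (A \<inter> \<Union>(insert U T)) \<le> (R + 1) * exp (- real n * c')" if n: "max 1 (max N1 N2) \<le> n" for n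
    proof -
      interpret prob_space "law lam n" by (rule prob_space_law[OF _ lam]) (use n in simp)
      have "A \<inter> \<Union>(insert U T) = (A \<inter> U) \<union> (A \<inter> \<Union>T)" by auto
      then have "measure (law lam n) (A \<inter> \<Union>(insert U T)) \<le> measure (law lam n) (A \<inter> U) + measure (law lam n) (A \<inter> \<Union>T)"
        using A openin_weak_borel[OF Uo] openin_weak_borel[OF To]
        by (simp only:) (intro measure_Un_le, auto simp: sets_law)
      also have "\<dots> \<le> exp (- real n * c1) + R * exp (- real n * c2)"
        using 1(2)[of n] 2(3)[of n] n by (intro add_mono) auto
      also have "\<dots> \<le> exp (- real n * c') + R * exp (- real n * c')"
        using 2(2) by (intro add_mono mult_left_mono) (auto simp: c'_def mult_left_mono)
      finally show ?thesis by (simp add: algebra_simps)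
    qed
    then have "\<exists>R\<ge>0. \<exists>N. \<forall>n\<ge>N. measure (law lam n) (A \<inter> \<Union>(insert U T)) \<le> R * exp (- real n * c')"
      using 2(2) by (intro exI[of _ "R + 1"] conjI exI[of _ "max 1 (max N1 N2)"]) auto
    moreover have "c < c'" using 1 2 by (simp add: c'_def)
    ultimately show ?case by blast
  qed
  then obtain c1 R N where c1: "c < c1" "0 \<le> R" "\<And>n. N \<le> n \<Longrightarrow> measure (law lam n) (A \<inter> \<Union>T) \<le> R * exp (- real n * c1)"
    by blast
  have To: "openin weak_top (\<Union>T)" using T(2) by (intro openin_Union) (auto simp: good_def)
  define c' where "c' = min c1 L"
  show thesis
  proof (rule that)
    show "c < c'" using c1(1) L by (simp add: c'_def)
    fix n assume n: "max 1 N \<le> n"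
    then have n0: "0 < n" by simp
    let ?P = "iid n lam"
    interpret P: prob_space ?P by (rule prob_space_PiM) (rule prob_measuresD[OF lam])
    define E where "E = {w \<in> space ?P. \<exists>j. real n * (1 / real (Suc j)) \<le> (\<Sum>i<n. indicator (- K j) (w i))}"
    have ind[measurable]: "(indicator (- K j) :: 'w \<Rightarrow> real) \<in> borel_measurable lam" for j
      using integrable_indicator_borel[OF lam Kb] by auto
    have E: "E \<in> sets ?P" unfolding E_def by measurable
    define G where "G = {w \<in> space ?P. emp n w \<in> A \<inter> \<Union>T}"
    have AT: "A \<inter> \<Union>T \<in> sets weak_borel" using A openin_weak_borel[OF To] by auto
    have G: "G \<in> sets ?P"
      unfolding G_def using measurable_sets[OF emp_measurable[OF n0 lam] AT] by (simp add: vimage_def Int_def conj_commute)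
    \<comment> \<open>Off \<open>E\<close>, few types leave each \<open>K j\<close>, so the
      empirical measure lies in the compact set and thus in the finite cover.\<close>
    have sub: "{w \<in> space ?P. emp n w \<in> A} \<subseteq> G \<union> E"
    proof
      fix w assume w: "w \<in> {w \<in> space ?P. emp n w \<in> A}"
      show "w \<in> G \<union> E"
      proof (cases "w \<in> E")
        case False
        have "measure (emp n w) (- (K j \<times> UNIV)) \<le> 1 / real (Suc j)" for j
        proof -
          define S where "S = - (K j \<times> (UNIV :: 'x set))"
          have eq: "indicator S z = (indicator (- K j) (fst z) :: real)" for z
            by (auto simp: S_def indicator_def mem_Times_iff)
          have "S \<in> sets borel"
            unfolding S_def by (rule borel_comp[OF borel_closed[OF compact_imp_closed[OF compact_Times[OF K(1) X_compact]]]])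
          then have "measure (emp n w) S = (\<integral>z. indicator S z \<partial>emp n w)"
            using prob_measuresD(1)[OF emp_prob[OF n0]] by simp
          also have "\<dots> = (\<integral>z. indicator (- K j) (fst z) \<partial>emp n w)" by (simp only: eq)
          also have "\<dots> = (\<Sum>i<n. indicator (- K j) (w i)) / real n"
            by (rule integral_emp_fst[OF n0]) (use Kb in simp)
          also have "\<dots> \<le> 1 / real (Suc j)"
          proof -
            have "(\<Sum>i<n. indicator (- K j) (w i)) \<le> real n * (1 / real (Suc j))"
              using False w by (auto simp: E_def not_le intro: less_imp_le)
            then show ?thesis using n0 by (simp add: divide_le_eq mult.commute)
          qed
          finally show ?thesis unfolding S_def .
        qed
        then have "emp n w \<in> tight_set K" using emp_prob[OF n0] by (simp add: tight_set_def)
        then show ?thesis using w T(3) by (auto simp: G_def)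
      qed simp
    qed
    have "measure (law lam n) A = measure ?P {w \<in> space ?P. emp n w \<in> A}" by (rule measure_law[OF n0 lam A])
    also have "\<dots> \<le> measure ?P (G \<union> E)" using sub G E by (intro P.finite_measure_mono) auto
    also have "\<dots> \<le> measure ?P G + measure ?P E" using G E by (rule measure_Un_le)
    also have "measure ?P G = measure (law lam n) (A \<inter> \<Union>T)"
      unfolding G_def by (rule measure_law[OF n0 lam AT, symmetric])
    also have "measure (law lam n) (A \<inter> \<Union>T) + measure ?P E \<le> R * exp (- real n * c1) + exp (- real n * L)"
      using c1(3)[of n] K(2)[OF n0] n unfolding E_def by (intro add_mono) auto
    also have "\<dots> \<le> R * exp (- real n * c') + exp (- real n * c')"
      using c1(2) by (intro add_mono mult_left_mono) (auto simp: c'_def mult_left_mono)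
    finally show "measure (law lam n) A \<le> (R + 1) * exp (- real n * c')" by (simp add: algebra_simps)
  qed
qed

text \<open>The upper bound at level 0. An equilibrium outside \<open>G\<close> differs from
  \<open>m\<close>, so by uniqueness its marginal is not \<open>lam\<close>, and
  \<open>separating_tilt\<close> provides a tilt of positive value.\<close>

lemma law_tendsto_1:
  assumes lam: "lam \<in> prob_measures" and G: "openin weak_top G" "m \<in> G"
    and uniq: "\<And>k. k \<in> cournot_nash F C lam \<Longrightarrow> k = m"
  shows "(\<lambda>n. measure (law lam n) G) \<longlonglongrightarrow> 1"
proof -
  let ?A = "topspace weak_top - G"
  have A: "?A \<in> sets weak_borel"
    using openin_weak_borel[OF G(1)] by (metis sets.compl_sets space_weak_borel topspace_weak_top)
  have cl: "weak_top closure_of ?A = ?A" by (intro closure_of_closedin closedin_diff closedin_topspace G(1))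
  have tilt: "\<exists>f. bcont f \<and> 0 < (\<integral>z. f (fst z) \<partial>k) - ln (\<integral>x. exp (f x) \<partial>lam)"
    if "k \<in> weak_top closure_of ?A" "k \<in> all_cournot_nash F C" for k
  proof -
    have k: "k \<in> prob_measures" "k \<notin> G" using that(1) unfolding cl by (auto simp: topspace_weak_top)
    have "wmarg k \<noteq> lam"
      using that(2) uniq[of k] k(2) G(2) by (auto simp: all_cournot_nash_def cournot_nash_def)
    then obtain f where f: "bcont f" "0 < (\<integral>x. f x \<partial>wmarg k) - ln (\<integral>x. exp (f x) \<partial>lam)"
      by (rule separating_tilt[OF lam wmarg_prob[OF k(1)]])
    then show ?thesis using integral_wmarg[OF k(1) bcont_measurable[OF f(1)]] by auto
  qed
  obtain c' R N where c': "0 < c'" "\<And>n. N \<le> n \<Longrightarrow> measure (law lam n) ?A \<le> R * exp (- real n * c')"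
    by (rule upper_bound[OF lam A], rule tilt, assumption, assumption) (rule that)
  have compl: "measure (law lam n) G = 1 - measure (law lam n) ?A" if "0 < n" for n
  proof -
    interpret prob_space "law lam n" by (rule prob_space_law[OF that lam])
    have "space (law lam n) = topspace weak_top" by (simp add: law_def space_weak_borel topspace_weak_top)
    then show ?thesis using prob_compl[of G] openin_weak_borel[OF G(1)] by (simp add: sets_law)
  qed
  have "(\<lambda>n. R * exp (- real n * c')) \<longlonglongrightarrow> R * 0"
  proof (rule tendsto_mult_left)
    have "(\<lambda>n. exp (- c') ^ n) \<longlonglongrightarrow> 0" using c'(1) by (intro LIMSEQ_realpow_zero) auto
    then show "(\<lambda>n. exp (- real n * c')) \<longlonglongrightarrow> 0" by (simp add: exp_of_nat_mult[symmetric])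
  qed
  then have R0: "(\<lambda>n. R * exp (- real n * c')) \<longlonglongrightarrow> 0" by simp
  have "eventually (\<lambda>n. measure (law lam n) ?A \<le> R * exp (- real n * c')) sequentially"
    unfolding eventually_sequentially using c'(2) by blast
  with _ have "(\<lambda>n. measure (law lam n) ?A) \<longlonglongrightarrow> 0"
    by (rule tendsto_sandwich[OF _ _ tendsto_const R0]) (rule always_eventually, simp)
  from tendsto_diff[OF tendsto_const[of 1] this]
  have "(\<lambda>n. 1 - measure (law lam n) ?A) \<longlonglongrightarrow> 1" by simp
  then show ?thesis
    by (rule Lim_transform_eventually) (use compl in \<open>auto simp: eventually_sequentially intro!: exI[of _ 1]\<close>)
qed

lemma lower_bound:
  assumes l0: "lam0 \<in> prob_measures" and lam: "lam \<in> prob_measures" and fin: "rel_entropy lam lam0 \<noteq> \<infinity>"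
    and G: "openin weak_top G" "m \<in> G" and uniq: "\<And>k. k \<in> cournot_nash F C lam \<Longrightarrow> k = m"
  shows "\<exists>b. b \<longlonglongrightarrow> - rel_entropy lam lam0 \<and>
    (\<forall>\<^sub>F n in sequentially. 0 < measure (law lam0 n) G \<and> b n \<le> ereal (ln (measure (law lam0 n) G) / real n))"
proof -
  obtain h where h: "h \<in> borel_measurable borel" "\<And>x. 0 \<le> h x" "lam = density lam0 (\<lambda>x. ennreal (h x))"
    "integrable lam (\<lambda>x. ln (h x))" "rel_entropy lam lam0 = ereal (\<integral>x. ln (h x) \<partial>lam)"
    using rel_entropy_finite_density[OF l0 lam fin] by blast
  define H where "H = (\<integral>x. ln (h x) \<partial>lam)"
  let ?q = "\<lambda>n. measure (law lam n) G" and ?p = "\<lambda>n. measure (law lam0 n) G"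
  have q: "?q \<longlonglongrightarrow> 1" by (rule law_tendsto_1[OF lam G uniq])
  \<comment> \<open>Obtained from \<open>change_of_measure\<close>, where the product law has
    entropy \<open>n * H\<close>, upon division by \<open>n * ?q n\<close>; it tends to
    \<open>- H\<close> because \<open>?q\<close> tends to 1.\<close>
  define b where "b n = - ((H + ln 2 / real n) / ?q n)" for n
  have "(\<lambda>n. ln 2 / real n) \<longlonglongrightarrow> 0" by (rule lim_const_over_n)
  then have "b \<longlonglongrightarrow> - ((H + 0) / 1)"
    unfolding b_def by (intro tendsto_minus tendsto_divide tendsto_add tendsto_const q) auto
  then have lim: "(\<lambda>n. ereal (b n)) \<longlonglongrightarrow> - rel_entropy lam lam0" by (simp add: h(5) H_def)
  have "eventually (\<lambda>n. 0 < ?q n) sequentially" using order_tendstoD(1)[OF q, of 0] by simp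
  then have ev: "eventually (\<lambda>n. 0 < ?q n \<and> 0 < n) sequentially"
    using eventually_gt_at_top[of 0] by (rule eventually_conj)
  have "eventually (\<lambda>n. 0 < ?p n \<and> ereal (b n) \<le> ereal (ln (?p n) / real n)) sequentially"
    using ev
  proof eventually_elim
    case (elim n)
    then have n: "0 < n" and qn: "0 < ?q n" by auto
    let ?P = "iid n lam0" and ?Q = "iid n lam"
    define E where "E = {w \<in> space ?P. emp n w \<in> G}"
    have Gb: "G \<in> sets weak_borel" by (rule openin_weak_borel[OF G(1)])
    have E: "E \<in> sets ?P"
      unfolding E_def using measurable_sets[OF emp_measurable[OF n l0] Gb] by (simp add: vimage_def Int_def conj_commute)
    have sp: "space ?P = space ?Q"
      by (rule sets_eq_imp_space_eq) (simp only: sets_PiM_prob[OF l0] sets_PiM_prob[OF lam])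
    have pE: "?p n = measure ?P E" unfolding E_def by (rule measure_law[OF n l0 Gb])
    have qE: "?q n = measure ?Q E" unfolding E_def sp by (rule measure_law[OF n lam Gb])
    have hm[measurable]: "h \<in> borel_measurable lam0" by (rule measurable_prob_measures[OF l0 h(1)])
    have Dm: "(\<lambda>w. \<Prod>i<n. h (w i)) \<in> borel_measurable ?P" by measurable
    have D0: "0 \<le> (\<Prod>i<n. h (w i))" for w by (intro prod_nonneg) (use h(2) in auto)
    note cm = change_of_measure[OF prob_space_PiM[OF prob_measuresD(2)[OF l0]] prob_space_PiM[OF prob_measuresD(2)[OF lam]]
      Dm D0 PiM_density[OF l0 lam h(1,2,3)] ln_prod_density(1)[OF l0 lam h(1-4)] E]
    have pos: "0 < ?p n" and le: "- ln (?p n) * ?q n \<le> real n * H + ln 2"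
      using cm qn unfolding pE qE ln_prod_density(2)[OF l0 lam h(1-4)] H_def by auto
    have "- (ln (?p n) / real n) = (- ln (?p n) * ?q n) / (real n * ?q n)" using qn n by simp
    also have "\<dots> \<le> (real n * H + ln 2) / (real n * ?q n)" using le qn n by (intro divide_right_mono) auto
    also have "\<dots> = - b n" using n qn by (simp add: b_def field_simps)
    finally show ?case using pos by simp
  qed
  with lim show ?thesis by blast
qed

end

lemma limsup_log_le:
  fixes p :: "nat \<Rightarrow> real"
  assumes "\<And>n. N \<le> n \<Longrightarrow> p n \<le> R * exp (- real n * c)" "\<And>n. 0 \<le> p n"
  shows "limsup (\<lambda>n. ereal (1 / real n) * eln (p n)) \<le> ereal (- c)"
proof -
  \<comment> \<open>\<open>R\<close> need not be positive, but its logarithm is taken.\<close>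
  define R' where "R' = max R 1"
  have R': "0 < R'" by (simp add: R'_def)
  have "limsup (\<lambda>n. ereal (1 / real n) * eln (p n)) \<le> limsup (\<lambda>n. ereal (ln R' / real n - c))"
  proof (rule Limsup_mono)
    \<comment> \<open>The index 0 is excluded: there the factor is 0, and 0 times minus infinity
      counts as 0.\<close>
    have "ereal (1 / real n) * eln (p n) \<le> ereal (ln R' / real n - c)" if n: "max 1 N \<le> n" for n
    proof (cases "p n = 0")
      case True
      then show ?thesis using n by (simp add: eln_def)
    next
      case False
      then have pos: "0 < p n" using assms(2)[of n] by linarith
      have "p n \<le> R * exp (- real n * c)" using assms(1) n by simp
      also have "\<dots> \<le> R' * exp (- real n * c)" by (intro mult_right_mono) (auto simp: R'_def)
      finally have "ln (p n) \<le> ln (R' * exp (- real n * c))" using pos R' by (subst ln_le_cancel_iff) auto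
      also have "\<dots> = ln R' - real n * c" using R' by (simp add: ln_mult)
      finally have "ln (p n) / real n \<le> (ln R' - real n * c) / real n" by (intro divide_right_mono) auto
      also have "\<dots> = ln R' / real n - c" using n by (simp add: diff_divide_distrib)
      finally show ?thesis using False by (simp add: eln_def)
    qed
    then show "\<forall>\<^sub>F n in sequentially. ereal (1 / real n) * eln (p n) \<le> ereal (ln R' / real n - c)"
      unfolding eventually_sequentially by blast
  qed
  also have "limsup (\<lambda>n. ereal (ln R' / real n - c)) = ereal (- c)"
  proof (rule lim_imp_Limsup)
    have "(\<lambda>n. ln R' / real n - c) \<longlonglongrightarrow> 0 - c" by (intro tendsto_diff lim_const_over_n tendsto_const)
    then show "(\<lambda>n. ereal (ln R' / real n - c)) \<longlonglongrightarrow> ereal (- c)" by simp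
  qed simp
  finally show ?thesis .
qed

section \<open>Goodness of the rate function\<close>

context game_selection
begin

text \<open>A closed subset of a compact tight set. A non-equilibrium has a neighbourhood without
  equilibria, and an equilibrium of entropy above \<open>c\<close> is separated from the sublevel
  set by a continuous test function, which bounds the entropy from below throughout a
  neighbourhood.\<close>

lemma compactin_rate_sublevel:
  assumes lam: "lam \<in> prob_measures"
  shows "compactin weak_top {m \<in> prob_measures.
    (if m \<in> all_cournot_nash F C then rel_entropy (wmarg m) lam else \<infinity>) \<le> ereal c}"
    (is "compactin _ ?R")
proof -
  define L where "L = max 0 c"
  have L: "0 \<le> L" by (simp add: L_def)
  obtain K where K: "\<And>j. compact (K j)"
    "\<And>k j. k \<in> prob_measures \<Longrightarrow> rel_entropy k lam \<le> ereal L \<Longrightarrow> measure k (- K j) \<le> 1 / real (Suc j)"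
    by (rule exponential_tightness[OF lam L]) (rule that)
  have sub: "?R \<subseteq> tight_set K"
  proof
    fix m assume m: "m \<in> ?R"
    then have mp: "m \<in> prob_measures" by simp
    have "rel_entropy (wmarg m) lam \<le> ereal c" using m by (auto split: if_splits)
    also have "\<dots> \<le> ereal L" by (simp add: L_def)
    finally have H: "rel_entropy (wmarg m) lam \<le> ereal L" .
    have "measure m (- (K j \<times> UNIV)) \<le> 1 / real (Suc j)" for j
    proof -
      have tail: "- K j \<in> sets borel" using compact_imp_closed[OF K(1)] by (simp add: borel_comp)
      have "measure m (- (K j \<times> UNIV)) \<le> measure m ((- K j) \<times> UNIV)"
      proof -
        have "- (K j \<times> (UNIV :: 'x set)) = (- K j) \<times> UNIV" by (auto simp: mem_Times_iff)
        then show ?thesis by simp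
      qed
      also have "\<dots> = measure (wmarg m) (- K j)" by (rule measure_wmarg[OF mp tail, symmetric])
      also have "\<dots> \<le> 1 / real (Suc j)" by (rule K(2)[OF wmarg_prob[OF mp] H])
      finally show ?thesis .
    qed
    then show "m \<in> tight_set K" using mp by (simp add: tight_set_def)
  qed
  have cl: "closedin weak_top ?R"
    unfolding closedin_def
  proof (intro conjI)
    show "?R \<subseteq> topspace weak_top" by (auto simp: topspace_weak_top)
    show "openin weak_top (topspace weak_top - ?R)"
    proof (subst openin_subopen, intro ballI)
      fix m assume "m \<in> topspace weak_top - ?R"
      then have m: "m \<in> prob_measures" "m \<notin> ?R" by (auto simp: topspace_weak_top)
      show "\<exists>U. openin weak_top U \<and> m \<in> U \<and> U \<subseteq> topspace weak_top - ?R"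
      proof (cases "m \<in> all_cournot_nash F C")
        case False
        obtain U where U: "openin weak_top U" "m \<in> U" "U \<inter> all_cournot_nash F C = {}"
          by (rule not_cournot_nash_nhd[OF m(1) False]) (rule that)
        then have "U \<subseteq> topspace weak_top - ?R" using openin_subset[OF U(1)] by auto
        then show ?thesis using U by blast
      next
        case True
        then have "ereal c < rel_entropy (wmarg m) lam" using m by (auto simp: not_le)
        then obtain f where f: "bcont f" "c < (\<integral>x. f x \<partial>wmarg m) - ln (\<integral>x. exp (f x) \<partial>lam)"
          by (rule rel_entropy_witness[OF lam wmarg_prob[OF m(1)]])
        then have c: "c < (\<integral>z. f (fst z) \<partial>m) - ln (\<integral>x. exp (f x) \<partial>lam)"
          using integral_wmarg[OF m(1) bcont_measurable[OF f(1)]] by simp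
        obtain U where U: "openin weak_top U" "m \<in> U"
          "\<And>k. k \<in> U \<Longrightarrow> c < (\<integral>z. f (fst z) \<partial>k) - ln (\<integral>x. exp (f x) \<partial>lam)"
          by (rule chernoff_nbhd[OF lam m(1) f(1) c]) (rule that)
        obtain B where B: "\<And>x. \<bar>f x\<bar> \<le> B" using bcontE[OF f(1)] by blast
        have "k \<notin> ?R" if k: "k \<in> U" for k
        proof -
          have kp: "k \<in> prob_measures" using openin_weak_top_subset[OF U(1)] k by auto
          have "ereal c < ereal ((\<integral>x. f x \<partial>wmarg k) - ln (\<integral>x. exp (f x) \<partial>lam))"
            using U(3)[OF k] integral_wmarg[OF kp bcont_measurable[OF f(1)]] by simp
          also have "\<dots> \<le> rel_entropy (wmarg k) lam"
            by (rule rel_entropy_ge[OF lam wmarg_prob[OF kp] bcont_measurable[OF f(1)] B])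
          finally show ?thesis by (auto simp: not_le)
        qed
        then have "U \<subseteq> topspace weak_top - ?R" using openin_subset[OF U(1)] by blast
        then show ?thesis using U by blast
      qed
    qed
  qed
  show ?thesis by (rule closed_compactin[OF compactin_tight_set[OF K(1)] sub cl])
qed

end

section \<open>Transfer to the given type sequence and derivation of the principle\<close>

theorem theorem2p4:
  fixes C :: "'w::polish_space \<Rightarrow> 'x::metric_space set"
    and F :: "('w \<times> 'x) measure \<Rightarrow> 'w \<Rightarrow> 'x \<Rightarrow> real"
    and lam0 :: "'w measure"
    and M :: "'a measure"
    and W :: "nat \<Rightarrow> 'a \<Rightarrow> 'w"
    and xhat :: "nat \<Rightarrow> nat \<Rightarrow> (nat \<Rightarrow> 'w) \<Rightarrow> 'x"
    and A :: "('w \<times> 'x) measure set"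
  assumes X_compact: "compact (UNIV :: 'x set)"
    and C_nonempty: "\<And>w. C w \<noteq> {}"
    and C_closed: "\<And>w. closed (C w)"
    and C_graph_closed: "closed {(w, x). x \<in> C w}"
    and C_lower: "\<And>ws w x. ws \<longlonglongrightarrow> w \<Longrightarrow> x \<in> C w \<Longrightarrow>
        \<exists>r xs. strict_mono r \<and> (\<forall>k. xs k \<in> C (ws (r k))) \<and> xs \<longlonglongrightarrow> x"
    and F_bounded: "\<exists>B. \<forall>m\<in>prob_measures. \<forall>w x. \<bar>F m w x\<bar> \<le> B"
    and F_cont: "continuous_map (prod_topology weak_top (prod_topology euclidean euclidean))
        euclideanreal (\<lambda>(m, w, x). F m w x)"
    and Nash_exist: "\<And>n w. \<exists>x. nash_eq F C n w x"
    and lam0: "lam0 \<in> prob_measures"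
    and M: "prob_space M"
    and W_meas: "\<And>i. W i \<in> borel_measurable M"
    and W_indep: "prob_space.indep_vars M (\<lambda>_. borel) W UNIV"
    and W_law: "\<And>i. distr M borel (W i) = lam0"
    and xhat_meas: "\<And>n i. i < n \<Longrightarrow> xhat n i \<in> borel_measurable (PiM {..<n} (\<lambda>_. borel))"
    and xhat_nash: "\<And>n w. w \<in> space (PiM {..<n} (\<lambda>_. (borel :: 'w measure))) \<Longrightarrow>
        nash_eq F C n w (\<lambda>i. xhat n i w)"
    and unique: "\<And>lam. lam \<in> prob_measures \<Longrightarrow> absolutely_continuous lam0 lam \<Longrightarrow>
        \<exists>!m. m \<in> cournot_nash F C lam"
    and A_sub: "A \<subseteq> prob_measures"
    and A_meas: "A \<in> weak_borel_sets"
  defines "mu \<equiv> \<lambda>n \<omega>. emp_measure n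
        (\<lambda>i. (W i \<omega>, xhat n i (restrict (\<lambda>k. W k \<omega>) {..<n})))"
  shows "limsup (\<lambda>n. ereal (1 / real n) * eln (measure M {\<omega> \<in> space M. mu n \<omega> \<in> A}))
           \<le> - (INF m \<in> (weak_top closure_of A) \<inter> all_cournot_nash F C. rel_entropy (wmarg m) lam0)
         \<and> liminf (\<lambda>n. ereal (1 / real n) * eln (measure M {\<omega> \<in> space M. mu n \<omega> \<in> A}))
           \<ge> - (INF m \<in> (weak_top interior_of A) \<inter> all_cournot_nash F C. rel_entropy (wmarg m) lam0)
         \<and> (\<forall>c::real. compactin weak_top
           {m \<in> prob_measures. (if m \<in> all_cournot_nash F C then rel_entropy (wmarg m) lam0 else \<infinity>) \<le> ereal c})"
proof -
  interpret game_selection C F xhat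
    by unfold_locales (fact X_compact C_nonempty C_graph_closed F_bounded F_cont | rule C_lower xhat_meas xhat_nash, assumption+)+
  interpret M: prob_space M by (rule M)
  have A: "A \<in> sets weak_borel" using A_meas by (simp add: sets_weak_borel)
  define p where "p n = measure M {\<omega> \<in> space M. mu n \<omega> \<in> A}" for n
  have p_nonneg: "0 \<le> p n" for n by (simp add: p_def)
  have p_law: "p n = measure (law lam0 n) A" if n: "0 < n" for n
  proof -
    define Y where "Y \<omega> = (\<lambda>i\<in>{..<n}. W i \<omega>)" for \<omega>
    have Y: "Y \<in> measurable M (iid n borel)"
      unfolding Y_def by (intro measurable_restrict W_meas)
    have "M.indep_vars (\<lambda>_. borel) W {..<n}" by (rule M.indep_vars_subset[OF W_indep]) simp
    \<comment> \<open>Independence enters here, as the statement that the joint law of the first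
      \<open>n\<close> types is the product of their laws.\<close>
    then have "distr M (iid n borel) Y = PiM {..<n} (\<lambda>i. distr M borel (W i))"
      unfolding Y_def using n W_meas by (subst (asm) M.indep_vars_iff_distr_eq_PiM') auto
    then have dY: "distr M (iid n borel) Y = iid n lam0" by (simp add: W_law)
    \<comment> \<open>Only coordinates below \<open>n\<close> matter to an empirical measure, so
      passing to the restricted type vector changes nothing.\<close>
    have mu: "mu n \<omega> = emp n (Y \<omega>)" for \<omega>
      unfolding mu_def emp_def Y_def restrict_def by (intro emp_measure_cong) (auto simp: restrict_def)
    have "measure (law lam0 n) A = measure (iid n lam0) (emp n -` A \<inter> space (iid n lam0))"
      unfolding law_def by (rule measure_distr[OF emp_measurable[OF n lam0] A])
    also have "\<dots> = measure (distr M (iid n borel) Y) (emp n -` A \<inter> space (iid n borel))"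
      unfolding dY[symmetric] by simp
    also have "\<dots> = measure M (Y -` (emp n -` A \<inter> space (iid n borel)) \<inter> space M)"
      by (rule measure_distr[OF Y measurable_sets[OF emp_measurable_borel[OF n] A]])
    also have "Y -` (emp n -` A \<inter> space (iid n borel)) \<inter> space M = {\<omega> \<in> space M. mu n \<omega> \<in> A}"
      using measurable_space[OF Y] by (auto simp: mu)
    finally show ?thesis by (simp add: p_def)
  qed
  let ?x = "\<lambda>n. ereal (1 / real n) * eln (p n)"
  let ?I = "INF m \<in> (weak_top closure_of A) \<inter> all_cournot_nash F C. rel_entropy (wmarg m) lam0"
  let ?J = "INF m \<in> (weak_top interior_of A) \<inter> all_cournot_nash F C. rel_entropy (wmarg m) lam0"
  have upper: "limsup ?x \<le> - ?I"
  proof (rule ccontr)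
    assume "\<not> limsup ?x \<le> - ?I"
    then have "- limsup ?x < ?I" by (simp add: not_le ereal_uminus_less_reorder)
    \<comment> \<open>A real level strictly below the infimum is what
      \<open>rel_entropy_witness\<close> accepts; this also covers an infinite infimum.\<close>
    then obtain c where c: "- limsup ?x < ereal c" "ereal c < ?I" using ereal_dense2 by blast
    have tilt: "\<exists>f. bcont f \<and> c < (\<integral>z. f (fst z) \<partial>m) - ln (\<integral>x. exp (f x) \<partial>lam0)"
      if m: "m \<in> weak_top closure_of A" "m \<in> all_cournot_nash F C" for m
    proof -
      have mp: "m \<in> prob_measures" using m(2) by (simp add: all_cournot_nash_iff)
      have "?I \<le> rel_entropy (wmarg m) lam0" using m by (intro INF_lower) auto
      with c(2) have "ereal c < rel_entropy (wmarg m) lam0" by (rule less_le_trans)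
      then obtain f where "bcont f" "c < (\<integral>x. f x \<partial>wmarg m) - ln (\<integral>x. exp (f x) \<partial>lam0)"
        by (rule rel_entropy_witness[OF lam0 wmarg_prob[OF mp]])
      then show ?thesis using integral_wmarg[OF mp bcont_measurable] by auto
    qed
    obtain c' R N where c': "c < c'" "\<And>n. N \<le> n \<Longrightarrow> measure (law lam0 n) A \<le> R * exp (- real n * c')"
      by (rule upper_bound[OF lam0 A], rule tilt, assumption, assumption) (rule that)
    have "p n \<le> R * exp (- real n * c')" if "max 1 N \<le> n" for n
      using that c'(2)[of n] p_law[of n] by simp
    then have "limsup ?x \<le> ereal (- c')" using p_nonneg by (rule limsup_log_le)
    also have "\<dots> \<le> ereal (- c)" using c'(1) by simp
    finally have "limsup ?x \<le> - ereal c" by simp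
    then have "ereal c \<le> - limsup ?x"
      using ereal_minus_le_minus[of "- ereal c" "limsup ?x"] by simp
    with c(1) show False by simp
  qed
  have lower: "- ?J \<le> liminf ?x"
  proof -
    have "- liminf ?x \<le> rel_entropy (wmarg m) lam0"
      if m: "m \<in> (weak_top interior_of A) \<inter> all_cournot_nash F C" for m
    proof (cases "rel_entropy (wmarg m) lam0 = \<infinity>")
      case False
      have mp: "m \<in> prob_measures" using m by (simp add: all_cournot_nash_iff)
      let ?lam = "wmarg m" and ?G = "weak_top interior_of A"
      have lam: "?lam \<in> prob_measures" by (rule wmarg_prob[OF mp])
      have "absolutely_continuous lam0 ?lam" using False by (auto simp: rel_entropy_def split: if_splits)
      from unique[OF lam this] have ex1: "\<exists>!k. k \<in> cournot_nash F C ?lam" .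
      have "m \<in> cournot_nash F C ?lam" using m by (auto simp: all_cournot_nash_def cournot_nash_def)
      \<comment> \<open>Finite entropy gives absolute continuity, so the assumed uniqueness applies
        to the marginal of \<open>m\<close> and identifies its equilibrium with
        \<open>m\<close>.\<close>
      with ex1 have uniq: "k = m" if "k \<in> cournot_nash F C ?lam" for k using that by blast
      have G: "openin weak_top ?G" "m \<in> ?G" using m by auto
      obtain b where b: "b \<longlonglongrightarrow> - rel_entropy ?lam lam0"
        "\<forall>\<^sub>F n in sequentially. 0 < measure (law lam0 n) ?G \<and> b n \<le> ereal (ln (measure (law lam0 n) ?G) / real n)"
        using lower_bound[OF lam0 lam False G uniq] by blast
      have "\<forall>\<^sub>F n in sequentially. b n \<le> ?x n"
        using eventually_conj[OF b(2) eventually_gt_at_top[of 0]]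
      proof eventually_elim
        case (elim n)
        then have n: "0 < n" by simp
        interpret L: prob_space "law lam0 n" by (rule prob_space_law[OF n lam0])
        have "measure (law lam0 n) ?G \<le> measure (law lam0 n) A"
          by (rule L.finite_measure_mono[OF interior_of_subset]) (use A in \<open>simp add: sets_law\<close>)
        then have le: "measure (law lam0 n) ?G \<le> p n" using p_law[OF n] by simp
        then have pos: "0 < p n" using elim by linarith
        have "b n \<le> ereal (ln (measure (law lam0 n) ?G) / real n)" using elim by simp
        also have "\<dots> \<le> ereal (ln (p n) / real n)"
          using le elim by (auto intro!: divide_right_mono)
        also have "\<dots> = ?x n" using pos by (simp add: eln_def)
        finally show ?case .
      qed
      then have "liminf b \<le> liminf ?x" by (rule Liminf_mono)
      moreover have "liminf b = - rel_entropy ?lam lam0" using b(1) by (intro lim_imp_Liminf) auto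
      ultimately show ?thesis by (simp add: ereal_uminus_le_reorder)
    qed simp
    then have "- liminf ?x \<le> ?J" by (intro INF_greatest)
    then show ?thesis by (simp add: ereal_uminus_le_reorder)
  qed
  show ?thesis
    unfolding p_def[symmetric] by (intro conjI allI upper lower compactin_rate_sublevel[OF lam0])
qed

end
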